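(* Let $G$ and $g$ satisfy the standing assumptions (S1)–(S4), suppose Assumption (M) holds, let $u_h$ be the approximating solution of the scheme built from the pair $(\sigma_0,p)$ of Assumption (M), and let $h=T/n\in(0,h_0)$. Let $u$ be the bounded viscosity solution of $$-\partial_t u-G(t,x,u,Du,D^2u)=0 \text{ on } [0,T)\times\mathbb{R}^d,\qquad u(T,\cdot)=g.$$ Assume further that $u\in C_b^{[4]}([0,T]\times\mathbb{R}^d)$ and that $G$ is locally uniformly Lipschitz continuous in $x$, locally uniformly on $(y,z,\gamma)$. Then there exists a constant $C$, independent of $h$ (or $n$), such that $$|u_h(t,x)-u(t,x)|\le Ch\qquad\text{for all }(t,x)\in[0,T]\times\mathbb{R}^d.$$
   Context: Notation. $T>0$, $d\ge1$; $\mathbb{S}^d$ is the set of symmetric $d\times d$ matrices with its usual partial order ($\gamma\le\tilde\gamma$ iff $\tilde\gamma-\gamma$ is nonnegative definite); $\mathbb{R}^{d\times d}_+$ is the set of nondegenerate (invertible) $d\times d$ matrices. $\gamma:\tilde\gamma=\operatorname{tr}(\gamma\tilde\gamma^\top)$, $|\gamma|=\sqrt{\gamma:\gamma}$. For a matrix $\gamma$, $D[\gamma]$ is the diagonal matrix with the same diagonal entries as $\gamma$. $\sigma^{-\top}:=(\sigma^{-1})^\top$. $\mathbf 0$ is the zero of $\mathbb{R}^d$ or $\mathbb{S}^d$. Function spaces. $C^{[2]}_b([0,T]\times\mathbb{R}^d)$ is the set of $u\in C^{1,2}([0,T]\times\mathbb{R}^d)$ such that $u,\partial_tu,Du,D^2u$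 are bounded; $C^{[4]}_b([0,T]\times\mathbb{R}^d)$ is the set of $u\in C^{[2]}_b$ such that each component of $\partial_tu,Du,D^2u$ is also in $C^{[2]}_b$. Data: $G:[0,T]\times\mathbb{R}^d\times\mathbb{R}\times\mathbb{R}^d\times\mathbb{S}^d\to\mathbb{R}$, $(t,x,y,z,\gamma)\mapsto G$, and $g:\mathbb{R}^d\to\mathbb{R}$. For notational convenience $G$ is assumed differentiable in $(y,z,\gamma)$; $G_\gamma$ is the ($\mathbb{S}^d$-valued) derivative in $\gamma$. Viscosity solutions. An upper (resp. lower) semicontinuous $u$ is a viscosity subsolution (resp. supersolution) of the PDE if $u(T,\cdot)\le g$ (resp. $\ge g$) and for every $(t,x)\in[0,T)\times\mathbb{R}^d$ and smooth $\varphi$ with $[u-\varphi](t,x)=0\ge[u-\varphi](s,y)$ (resp. $\le$) for all $(s,y)\in[0,T]\times\mathbb{R}^d$, one has $[-\partial_t\varphi-G(\cdot,\varphi,D\varphi,D^2\varphi)](t,x)\le0$ (resp. $\ge0$). A viscosity solution is both. Standing assumptions. (S1) $G(\cdot,0,\mathbf 0,\mathbf 0)$ and $g$ are bounded. (S2) $G$ is continuous in $t$ and uniformly Lipschitz continuous in $(x,y,z,\gamma)$; $g$ is uniformly Lipschitz continuous. (S3) $G$ is nondecreasing in $\gamma$. (S4) Comparison holds for the PDE in the class of bounded viscosity solutions: if $u_1,u_2$ are bounded viscosity sub- and supersolutions respectively, then $u_1\le u_2$. Scheme. Given $\sigma_0:[0,T]\times\mathbb{R}^d\to\mathbb{R}^{d\times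 d}_+$ and $p:[0,T]\times\mathbb{R}^d\to(0,1)$ with $\sigma_0,\sigma_0^{-1},p^{-1}$ bounded, put $a_0=\sigma_0\sigma_0^\top$, $F(t,x,y,z,\gamma)=G(t,x,y,z,\gamma)-\frac12a_0(t,x):\gamma$, and $\widetilde G_\gamma=\sigma_0^{-1}G_\gamma\sigma_0^{-\top}$ (with $\sigma_0=\sigma_0(t,x)$). For each $(t,x)$ let $\xi=\xi^{t,x}$ be an $\mathbb{R}^d$-valued random variable with i.i.d. components, $\mathbb{P}(\xi_i=\pm1/\sqrt p)=p/2$ for each sign, $\mathbb{P}(\xi_i=0)=1-p$, $p=p(t,x)$. For $t\in[0,T)$, $h>0$ with $t+h\le T$, and measurable $\varphi:\mathbb{R}^d\to\mathbb{R}$, define (with $\sigma_0,p,\xi$ taken at $(t,x)$) $$\mathcal{D}^{t,i}_h\varphi(x)=\mathbb{E}[\varphi(x+\sqrt h\,\sigma_0\xi)K_i(\xi)],\ i=0,1,2,\quad K_0=1,\quad K_1(\xi)=\frac{\sigma_0^{-\top}\xi}{\sqrt h},$$ $$K_2(\xi)=\frac{\sigma_0^{-\top}\big[(1-p)\xi\xi^\top-(1-3p)D[\xi\xi^\top]-2pI_d\big]\sigma_0^{-1}}{(1-p)h},$$ $$\mathbb{T}^t_h[\varphi](x)=\mathcal{D}^{t,0}_h\varphi(x)+hF\big(t,x,\mathcal{D}^{t,0}_h\varphi(x),\mathcal{D}^{t,1}_h\varphi(x),\mathcal{D}^{t,2}_h\varphi(x)\big).$$ For $n\ge1$, $h=T/n$,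 $t_i=ih$, set $u_h(t_n,\cdot)=g$ and, for $i=n,\dots,1$, $u_h(t,\cdot)=\mathbb{T}^t_{t_i-t}[u_h(t_i,\cdot)]$ for $t\in[t_{i-1},t_i)$. Assumption (M): there exist $\sigma_0,p$ with $\sigma_0,\sigma_0^{-1},p^{-1}$ bounded satisfying (M1), (M2) below. Associated to $\sigma_0$ define $\underline\alpha(t,x)=\sup\{\alpha>0:\alpha I_d\le D[\widetilde G_\gamma](t,x,y,z,\gamma)\ \forall(y,z,\gamma)\}$, $\bar\alpha(t,x)=\inf\{\alpha>0:\alpha I_d\ge D[\widetilde G_\gamma](t,x,y,z,\gamma)\ \forall(y,z,\gamma)\}$, $\Lambda=\bar\alpha/\underline\alpha$, $\theta(t,x)=\inf\{\theta\ge0:D[\widetilde G_\gamma]\le(1+\theta)\widetilde G_\gamma\ \forall (y,z,\gamma)\}$, and for $p\in(0,1)$ $$\alpha_p=\frac{p(2+3\theta)-\theta}{p(1+\theta)},\quad c_p=\sqrt{2p\Lambda+\alpha_p-2p},\quad \lambda_p=\sqrt p\Big[(1-p+pd)c_p-\frac{2pd\Lambda}{c_p}\Big]\frac{\sqrt{\underline\alpha}}{|\sigma_0^{-1}|},$$ $$\lambda^*=\inf_{(t,x)\in[0,T]\times\mathbb{R}^d}\ \sup_{p\in[\frac{\theta}{2(1+\theta)},\frac13]\cap(0,\frac13]}\lambda_p(t,x).$$ (M1) $\theta(t,x)\le2$ for all $(t,x)$ and $\lambda^*>0$. (M2) For all $(t,x)$, with $p=p(t,x)$: $p\in[\frac{\theta}{2(1+\theta)},\frac13]\cap(0,\frac13]$,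 $\lambda_p\ge\lambda^*/2$, and $\underline\alpha=c_p^{-2}$. The constant $h_0>0$ is a constant (depending only on $d,T,\lambda^*$ and the bounds and Lipschitz constants in (S1), (S2) and of $\sigma_0,\sigma_0^{-1},p^{-1}$; it exists under these assumptions) such that for all $h\in(0,h_0]$ the operator $\mathbb{T}^t_h$ is monotone: $\mathbb{T}^t_h[\varphi]\le\mathbb{T}^t_h[\psi]$ whenever $\varphi\le\psi$. *)

theory Defs
  imports "HOL-Analysis.Analysis" "HOL-Probability.Probability"
begin

text \<open>
  The dimension is \<open>d = CARD('n)\<close>. On \<open>real ^ 'n ^ 'n\<close> the library's inner product and norm are
  \<open>\<gamma> : \<gamma>' = tr (\<gamma> \<gamma>'\<^sup>T)\<close> and \<open>\<bar>\<gamma>\<bar> = sqrt (\<gamma> : \<gamma>)\<close>. A function on \<open>[0,T] \<times> \<real>\<^sup>d\<close> or on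
  \<open>[0,T] \<times> \<real>\<^sup>d \<times> \<real> \<times> \<real>\<^sup>d \<times> \<S>\<^sup>d\<close> is a total curried function; no condition below
  constrains its values at times outside \<open>[0,T]\<close> or at nonsymmetric \<open>\<gamma>\<close>.
\<close>

type_synonym 'n scalar_fun = "real \<Rightarrow> real ^ 'n \<Rightarrow> real"
type_synonym 'n mat_fun = "real \<Rightarrow> real ^ 'n \<Rightarrow> real ^ 'n ^ 'n"
type_synonym 'n nonlinearity =
  "real \<Rightarrow> real ^ 'n \<Rightarrow> real \<Rightarrow> real ^ 'n \<Rightarrow> real ^ 'n ^ 'n \<Rightarrow> real"


section \<open>Matrices\<close>

definition sym_mats :: "(real ^ 'n ^ 'n) set" where
  "sym_mats = {\<gamma>. transpose \<gamma> = \<gamma>}"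

definition mat_le :: "real ^ 'n ^ 'n \<Rightarrow> real ^ 'n ^ 'n \<Rightarrow> bool" (infix "\<preceq>" 50) where
  "\<gamma> \<preceq> \<gamma>' \<longleftrightarrow> (\<forall>v. 0 \<le> v \<bullet> ((\<gamma>' - \<gamma>) *v v))"

definition diag_part :: "real ^ 'n ^ 'n \<Rightarrow> real ^ 'n ^ 'n" where
  "diag_part \<gamma> = (\<chi> i j. if i = j then \<gamma> $ i $ j else 0)"

definition outer :: "real ^ 'n \<Rightarrow> real ^ 'n ^ 'n" where
  "outer v = (\<chi> i j. v $ i * v $ j)"


section \<open>Function spaces\<close>

abbreviation strip :: "real \<Rightarrow> (real \<times> (real ^ 'n)) set" where
  "strip T \<equiv> {0..T} \<times> UNIV"

text \<open>\<open>ut\<close>, \<open>Du\<close>, \<open>D2u\<close> are the time derivative, gradient and Hessian of \<open>u\<close>; the time derivative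
  is one-sided at \<open>0\<close> and \<open>T\<close>.\<close>

definition C12_with ::
  "real \<Rightarrow> ('n::finite) scalar_fun \<Rightarrow> ('n::finite) scalar_fun \<Rightarrow> (real \<Rightarrow> real ^ 'n \<Rightarrow> real ^ 'n) \<Rightarrow> ('n::finite) mat_fun \<Rightarrow> bool" where
  "C12_with T u ut Du D2u \<longleftrightarrow>
     continuous_on (strip T) (\<lambda>(t, x). u t x) \<and>
     continuous_on (strip T) (\<lambda>(t, x). ut t x) \<and>
     continuous_on (strip T) (\<lambda>(t, x). Du t x) \<and>
     continuous_on (strip T) (\<lambda>(t, x). D2u t x) \<and>
     (\<forall>t\<in>{0..T}. \<forall>x.
        ((\<lambda>s. u s x) has_real_derivative ut t x) (at t within {0..T}) \<and>
        GDERIV (u t) x :> Du t x \<and>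
        (Du t has_derivative (\<lambda>v. D2u t x *v v)) (at x))"

definition bounded_on_strip ::
  "real \<Rightarrow> (real \<Rightarrow> real ^ 'n \<Rightarrow> 'b::real_normed_vector) \<Rightarrow> bool" where
  "bounded_on_strip T u \<longleftrightarrow> bounded ((\<lambda>(t, x). u t x) ` strip T)"

definition C2b_with ::
  "real \<Rightarrow> ('n::finite) scalar_fun \<Rightarrow> ('n::finite) scalar_fun \<Rightarrow> (real \<Rightarrow> real ^ 'n \<Rightarrow> real ^ 'n) \<Rightarrow> ('n::finite) mat_fun \<Rightarrow> bool" where
  "C2b_with T u ut Du D2u \<longleftrightarrow>
     C12_with T u ut Du D2u \<and>
     bounded_on_strip T u \<and> bounded_on_strip T ut \<and>
     bounded_on_strip T Du \<and> bounded_on_strip T D2u"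

definition C2b :: "real \<Rightarrow> ('n::finite) scalar_fun \<Rightarrow> bool" where
  "C2b T u \<longleftrightarrow> (\<exists>ut Du D2u. C2b_with T u ut Du D2u)"

definition C4b :: "real \<Rightarrow> ('n::finite) scalar_fun \<Rightarrow> bool" where
  "C4b T u \<longleftrightarrow>
     (\<exists>ut Du D2u. C2b_with T u ut Du D2u \<and>
        C2b T ut \<and>
        (\<forall>i. C2b T (\<lambda>t x. Du t x $ i)) \<and>
        (\<forall>i j. C2b T (\<lambda>t x. D2u t x $ i $ j)))"


section \<open>Viscosity solutions\<close>

definition usc_on :: "'a::topological_space set \<Rightarrow> ('a \<Rightarrow> real) \<Rightarrow> bool" where
  "usc_on S f \<longleftrightarrow> (\<forall>a. openin (top_of_set S) {z \<in> S. f z < a})"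

definition lsc_on :: "'a::topological_space set \<Rightarrow> ('a \<Rightarrow> real) \<Rightarrow> bool" where
  "lsc_on S f \<longleftrightarrow> (\<forall>a. openin (top_of_set S) {z \<in> S. a < f z})"

text \<open>Test functions are of class \<open>C\<^sup>1\<^sup>,\<^sup>2\<close> on \<open>[0,T] \<times> \<real>\<^sup>d\<close>.\<close>

definition viscosity_subsolution ::
  "real \<Rightarrow> ('n::finite) nonlinearity \<Rightarrow> (real ^ 'n \<Rightarrow> real) \<Rightarrow> ('n::finite) scalar_fun \<Rightarrow> bool" where
  "viscosity_subsolution T G g u \<longleftrightarrow>
     usc_on (strip T) (\<lambda>(t, x). u t x) \<and>
     (\<forall>x. u T x \<le> g x) \<and>
     (\<forall>t\<in>{0..<T}. \<forall>x. \<forall>\<phi> \<phi>t D\<phi> D2\<phi>.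
        C12_with T \<phi> \<phi>t D\<phi> D2\<phi> \<longrightarrow>
        u t x - \<phi> t x = 0 \<longrightarrow>
        (\<forall>s\<in>{0..T}. \<forall>y. u s y - \<phi> s y \<le> 0) \<longrightarrow>
        - \<phi>t t x - G t x (\<phi> t x) (D\<phi> t x) (D2\<phi> t x) \<le> 0)"

definition viscosity_supersolution ::
  "real \<Rightarrow> ('n::finite) nonlinearity \<Rightarrow> (real ^ 'n \<Rightarrow> real) \<Rightarrow> ('n::finite) scalar_fun \<Rightarrow> bool" where
  "viscosity_supersolution T G g u \<longleftrightarrow>
     lsc_on (strip T) (\<lambda>(t, x). u t x) \<and>
     (\<forall>x. g x \<le> u T x) \<and>
     (\<forall>t\<in>{0..<T}. \<forall>x. \<forall>\<phi> \<phi>t D\<phi> D2\<phi>.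
        C12_with T \<phi> \<phi>t D\<phi> D2\<phi> \<longrightarrow>
        u t x - \<phi> t x = 0 \<longrightarrow>
        (\<forall>s\<in>{0..T}. \<forall>y. 0 \<le> u s y - \<phi> s y) \<longrightarrow>
        0 \<le> - \<phi>t t x - G t x (\<phi> t x) (D\<phi> t x) (D2\<phi> t x))"

definition viscosity_solution ::
  "real \<Rightarrow> ('n::finite) nonlinearity \<Rightarrow> (real ^ 'n \<Rightarrow> real) \<Rightarrow> ('n::finite) scalar_fun \<Rightarrow> bool" where
  "viscosity_solution T G g u \<longleftrightarrow> viscosity_subsolution T G g u \<and> viscosity_supersolution T G g u"


section \<open>Standing assumptions\<close>

definition differentiable_nonlinearity :: "real \<Rightarrow> ('n::finite) nonlinearity \<Rightarrow> bool" where
  "differentiable_nonlinearity T G \<longleftrightarrow>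
     (\<forall>t\<in>{0..T}. \<forall>x y z. \<forall>\<gamma>\<in>sym_mats.
        (\<lambda>(y, z, \<gamma>). G t x y z \<gamma>) differentiable
          (at (y, z, \<gamma>) within UNIV \<times> UNIV \<times> sym_mats))"

text \<open>The derivative in \<open>\<gamma>\<close> is taken along \<open>\<S>\<^sup>d\<close> and represented by a symmetric matrix, which
  makes it unique (lemma \<open>G_gamma_unique\<close>).\<close>

definition is_G_gamma :: "(real ^ 'n ^ 'n \<Rightarrow> real) \<Rightarrow> real ^ 'n ^ 'n \<Rightarrow> real ^ 'n ^ 'n \<Rightarrow> bool" where
  "is_G_gamma f \<gamma> A \<longleftrightarrow>
     A \<in> sym_mats \<and> (f has_derivative (\<lambda>\<eta>. A \<bullet> \<eta>)) (at \<gamma> within sym_mats)"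

definition G_gamma ::
  "('n::finite) nonlinearity \<Rightarrow> real \<Rightarrow> real ^ 'n \<Rightarrow> real \<Rightarrow> real ^ 'n \<Rightarrow> real ^ 'n ^ 'n \<Rightarrow> real ^ 'n ^ 'n" where
  "G_gamma G t x y z \<gamma> = (THE A. is_G_gamma (G t x y z) \<gamma> A)"

definition assumption_S1 ::
  "real \<Rightarrow> real \<Rightarrow> ('n::finite) nonlinearity \<Rightarrow> (real ^ 'n \<Rightarrow> real) \<Rightarrow> bool" where
  "assumption_S1 T B G g \<longleftrightarrow>
     (\<forall>t\<in>{0..T}. \<forall>x. \<bar>G t x 0 0 0\<bar> \<le> B) \<and> (\<forall>x. \<bar>g x\<bar> \<le> B)"

definition assumption_S2 ::
  "real \<Rightarrow> real \<Rightarrow> ('n::finite) nonlinearity \<Rightarrow> (real ^ 'n \<Rightarrow> real) \<Rightarrow> bool" where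
  "assumption_S2 T L G g \<longleftrightarrow>
     (\<forall>x y z. \<forall>\<gamma>\<in>sym_mats. continuous_on {0..T} (\<lambda>t. G t x y z \<gamma>)) \<and>
     (\<forall>t\<in>{0..T}. L-lipschitz_on (UNIV \<times> UNIV \<times> UNIV \<times> sym_mats) (\<lambda>(x, y, z, \<gamma>). G t x y z \<gamma>)) \<and>
     L-lipschitz_on UNIV g"

definition assumption_S3 :: "real \<Rightarrow> ('n::finite) nonlinearity \<Rightarrow> bool" where
  "assumption_S3 T G \<longleftrightarrow>
     (\<forall>t\<in>{0..T}. \<forall>x y z. \<forall>\<gamma>\<in>sym_mats. \<forall>\<gamma>'\<in>sym_mats.
        \<gamma> \<preceq> \<gamma>' \<longrightarrow> G t x y z \<gamma> \<le> G t x y z \<gamma>')"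

definition assumption_S4 :: "real \<Rightarrow> ('n::finite) nonlinearity \<Rightarrow> (real ^ 'n \<Rightarrow> real) \<Rightarrow> bool" where
  "assumption_S4 T G g \<longleftrightarrow>
     (\<forall>u1 u2. bounded_on_strip T u1 \<longrightarrow> bounded_on_strip T u2 \<longrightarrow>
        viscosity_subsolution T G g u1 \<longrightarrow> viscosity_supersolution T G g u2 \<longrightarrow>
        (\<forall>t\<in>{0..T}. \<forall>x. u1 t x \<le> u2 t x))"

definition standing_assumptions ::
  "real \<Rightarrow> real \<Rightarrow> real \<Rightarrow> ('n::finite) nonlinearity \<Rightarrow> (real ^ 'n \<Rightarrow> real) \<Rightarrow> bool" where
  "standing_assumptions T B L G g \<longleftrightarrow>
     differentiable_nonlinearity T G \<and> assumption_S1 T B G g \<and> assumption_S2 T L G g \<and>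
     assumption_S3 T G \<and> assumption_S4 T G g"

definition locally_lipschitz_in_x :: "real \<Rightarrow> ('n::finite) nonlinearity \<Rightarrow> bool" where
  "locally_lipschitz_in_x T G \<longleftrightarrow>
     (\<forall>R. \<exists>L. \<forall>t\<in>{0..T}. \<forall>x\<in>cball 0 R. \<forall>x'\<in>cball 0 R.
        \<forall>y\<in>cball 0 R. \<forall>z\<in>cball 0 R. \<forall>\<gamma>\<in>sym_mats \<inter> cball 0 R.
          \<bar>G t x y z \<gamma> - G t x' y z \<gamma>\<bar> \<le> L * norm (x - x'))"


section \<open>The scheme\<close>

definition xi_coord_pmf :: "real \<Rightarrow> real pmf" where
  "xi_coord_pmf p = pmf_of_list [(1 / sqrt p, p / 2), (- 1 / sqrt p, p / 2), (0, 1 - p)]"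

definition xi_pmf :: "real \<Rightarrow> (real ^ 'n) pmf" where
  "xi_pmf p = map_pmf vec_lambda (Pi_pmf (UNIV :: 'n set) 0 (\<lambda>_. xi_coord_pmf p))"

definition F_op ::
  "('n::finite) nonlinearity \<Rightarrow> ('n::finite) mat_fun \<Rightarrow> ('n::finite) nonlinearity" where
  "F_op G \<sigma>0 t x y z \<gamma> = G t x y z \<gamma> - 1 / 2 * ((\<sigma>0 t x ** transpose (\<sigma>0 t x)) \<bullet> \<gamma>)"

definition K1 :: "real ^ 'n ^ 'n \<Rightarrow> real \<Rightarrow> real ^ 'n \<Rightarrow> real ^ 'n" where
  "K1 \<sigma> h \<xi> = (1 / sqrt h) *\<^sub>R (transpose (matrix_inv \<sigma>) *v \<xi>)"

definition K2 :: "real ^ 'n ^ 'n \<Rightarrow> real \<Rightarrow> real \<Rightarrow> real ^ 'n \<Rightarrow> real ^ 'n ^ 'n" where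
  "K2 \<sigma> p h \<xi> =
     (1 / ((1 - p) * h)) *\<^sub>R
       (transpose (matrix_inv \<sigma>) **
        ((1 - p) *\<^sub>R outer \<xi> - (1 - 3 * p) *\<^sub>R diag_part (outer \<xi>) - (2 * p) *\<^sub>R mat 1) **
        matrix_inv \<sigma>)"

definition D0 :: "('n::finite) mat_fun \<Rightarrow> ('n::finite) scalar_fun \<Rightarrow> real \<Rightarrow> real \<Rightarrow> (real ^ 'n \<Rightarrow> real) \<Rightarrow> real ^ 'n \<Rightarrow> real" where
  "D0 \<sigma>0 p t h \<phi> x =
     measure_pmf.expectation (xi_pmf (p t x)) (\<lambda>\<xi>. \<phi> (x + sqrt h *\<^sub>R (\<sigma>0 t x *v \<xi>)))"

definition D1 ::
  "('n::finite) mat_fun \<Rightarrow> ('n::finite) scalar_fun \<Rightarrow> real \<Rightarrow> real \<Rightarrow> (real ^ 'n \<Rightarrow> real) \<Rightarrow> real ^ 'n \<Rightarrow> real ^ 'n" where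
  "D1 \<sigma>0 p t h \<phi> x =
     measure_pmf.expectation (xi_pmf (p t x))
       (\<lambda>\<xi>. \<phi> (x + sqrt h *\<^sub>R (\<sigma>0 t x *v \<xi>)) *\<^sub>R K1 (\<sigma>0 t x) h \<xi>)"

definition D2 ::
  "('n::finite) mat_fun \<Rightarrow> ('n::finite) scalar_fun \<Rightarrow> real \<Rightarrow> real \<Rightarrow> (real ^ 'n \<Rightarrow> real) \<Rightarrow> real ^ 'n \<Rightarrow> real ^ 'n ^ 'n" where
  "D2 \<sigma>0 p t h \<phi> x =
     measure_pmf.expectation (xi_pmf (p t x))
       (\<lambda>\<xi>. \<phi> (x + sqrt h *\<^sub>R (\<sigma>0 t x *v \<xi>)) *\<^sub>R K2 (\<sigma>0 t x) (p t x) h \<xi>)"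

definition scheme_op ::
  "('n::finite) nonlinearity \<Rightarrow> ('n::finite) mat_fun \<Rightarrow> ('n::finite) scalar_fun \<Rightarrow> real \<Rightarrow> real \<Rightarrow>
   (real ^ 'n \<Rightarrow> real) \<Rightarrow> real ^ 'n \<Rightarrow> real" where
  "scheme_op G \<sigma>0 p t h \<phi> x =
     D0 \<sigma>0 p t h \<phi> x +
     h * F_op G \<sigma>0 t x (D0 \<sigma>0 p t h \<phi> x) (D1 \<sigma>0 p t h \<phi> x) (D2 \<sigma>0 p t h \<phi> x)"

text \<open>\<open>u_grid \<dots> n k\<close> is \<open>u\<^sub>h(t\<^sub>n\<^sub>-\<^sub>k, \<cdot>)\<close>. The recursion satisfied by \<open>u_h\<close> is stated in
  \<open>u_h_terminal\<close> and \<open>u_h_step\<close> below.\<close>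

primrec u_grid ::
  "real \<Rightarrow> ('n::finite) nonlinearity \<Rightarrow> (real ^ 'n \<Rightarrow> real) \<Rightarrow> ('n::finite) mat_fun \<Rightarrow> ('n::finite) scalar_fun \<Rightarrow>
   nat \<Rightarrow> nat \<Rightarrow> real ^ 'n \<Rightarrow> real" where
  "u_grid T G g \<sigma>0 p n 0 = g"
| "u_grid T G g \<sigma>0 p n (Suc k) =
     scheme_op G \<sigma>0 p (real (n - Suc k) * (T / real n))
       (real (n - k) * (T / real n) - real (n - Suc k) * (T / real n))
       (u_grid T G g \<sigma>0 p n k)"

definition u_h ::
  "real \<Rightarrow> ('n::finite) nonlinearity \<Rightarrow> (real ^ 'n \<Rightarrow> real) \<Rightarrow> ('n::finite) mat_fun \<Rightarrow> ('n::finite) scalar_fun \<Rightarrow>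
   nat \<Rightarrow> real \<Rightarrow> real ^ 'n \<Rightarrow> real" where
  "u_h T G g \<sigma>0 p n t =
     (if T \<le> t then g
      else let i = (LEAST i. t < real i * (T / real n))
           in scheme_op G \<sigma>0 p t (real i * (T / real n) - t) (u_grid T G g \<sigma>0 p n (n - i)))"

definition monotone_scheme ::
  "real \<Rightarrow> ('n::finite) nonlinearity \<Rightarrow> ('n::finite) mat_fun \<Rightarrow> ('n::finite) scalar_fun \<Rightarrow> real \<Rightarrow> bool" where
  "monotone_scheme T G \<sigma>0 p h0 \<longleftrightarrow>
     (\<forall>t\<in>{0..<T}. \<forall>h\<in>{0<..h0}. t + h \<le> T \<longrightarrow>
        (\<forall>\<phi>\<in>borel_measurable borel. \<forall>\<psi>\<in>borel_measurable borel.
           (\<forall>x. \<phi> x \<le> \<psi> x) \<longrightarrow>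
           (\<forall>x. scheme_op G \<sigma>0 p t h \<phi> x \<le> scheme_op G \<sigma>0 p t h \<psi> x)))"


section \<open>The monotonicity assumption\<close>

definition G_tilde ::
  "('n::finite) nonlinearity \<Rightarrow> ('n::finite) mat_fun \<Rightarrow>
   real \<Rightarrow> real ^ 'n \<Rightarrow> real \<Rightarrow> real ^ 'n \<Rightarrow> real ^ 'n ^ 'n \<Rightarrow> real ^ 'n ^ 'n" where
  "G_tilde G \<sigma>0 t x y z \<gamma> =
     matrix_inv (\<sigma>0 t x) ** G_gamma G t x y z \<gamma> ** transpose (matrix_inv (\<sigma>0 t x))"

text \<open>Suprema and infima are taken in the extended reals, so that \<open>inf {} = \<infinity>\<close> and
  \<open>sup {} = -\<infinity>\<close>: \<open>assumption_M\<close> then forces \<open>\<theta>\<close> and \<open>\<alpha>_low\<close> to be genuine real numbers, and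
  the conversions by \<open>real_of_ereal\<close> in \<open>\<Lambda>\<close> and \<open>\<lambda>_p\<close> are harmless
  (\<open>\<alpha>_up\<close> is finite because \<open>G\<close> is Lipschitz and \<open>\<sigma>0\<^sup>-\<^sup>1\<close> is bounded).\<close>

definition alpha_low :: "('n::finite) nonlinearity \<Rightarrow> ('n::finite) mat_fun \<Rightarrow> real \<Rightarrow> real ^ 'n \<Rightarrow> ereal" where
  "alpha_low G \<sigma>0 t x =
     Sup {ereal \<alpha> | \<alpha>. 0 < \<alpha> \<and>
       (\<forall>y z. \<forall>\<gamma>\<in>sym_mats. mat \<alpha> \<preceq> diag_part (G_tilde G \<sigma>0 t x y z \<gamma>))}"

definition alpha_up :: "('n::finite) nonlinearity \<Rightarrow> ('n::finite) mat_fun \<Rightarrow> real \<Rightarrow> real ^ 'n \<Rightarrow> ereal" where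
  "alpha_up G \<sigma>0 t x =
     Inf {ereal \<alpha> | \<alpha>. 0 < \<alpha> \<and>
       (\<forall>y z. \<forall>\<gamma>\<in>sym_mats. diag_part (G_tilde G \<sigma>0 t x y z \<gamma>) \<preceq> mat \<alpha>)}"

definition theta :: "('n::finite) nonlinearity \<Rightarrow> ('n::finite) mat_fun \<Rightarrow> real \<Rightarrow> real ^ 'n \<Rightarrow> ereal" where
  "theta G \<sigma>0 t x =
     Inf {ereal \<theta> | \<theta>. 0 \<le> \<theta> \<and>
       (\<forall>y z. \<forall>\<gamma>\<in>sym_mats.
          diag_part (G_tilde G \<sigma>0 t x y z \<gamma>) \<preceq> (1 + \<theta>) *\<^sub>R G_tilde G \<sigma>0 t x y z \<gamma>)}"

definition Lambda :: "('n::finite) nonlinearity \<Rightarrow> ('n::finite) mat_fun \<Rightarrow> real \<Rightarrow> real ^ 'n \<Rightarrow> real" where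
  "Lambda G \<sigma>0 t x = real_of_ereal (alpha_up G \<sigma>0 t x) / real_of_ereal (alpha_low G \<sigma>0 t x)"

definition alpha_p :: "('n::finite) nonlinearity \<Rightarrow> ('n::finite) mat_fun \<Rightarrow> real \<Rightarrow> real ^ 'n \<Rightarrow> real \<Rightarrow> real" where
  "alpha_p G \<sigma>0 t x p =
     (let \<theta> = real_of_ereal (theta G \<sigma>0 t x) in (p * (2 + 3 * \<theta>) - \<theta>) / (p * (1 + \<theta>)))"

definition c_p :: "('n::finite) nonlinearity \<Rightarrow> ('n::finite) mat_fun \<Rightarrow> real \<Rightarrow> real ^ 'n \<Rightarrow> real \<Rightarrow> real" where
  "c_p G \<sigma>0 t x p = sqrt (2 * p * Lambda G \<sigma>0 t x + alpha_p G \<sigma>0 t x p - 2 * p)"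

definition lambda_p :: "('n::finite) nonlinearity \<Rightarrow> ('n::finite) mat_fun \<Rightarrow> real \<Rightarrow> real ^ 'n \<Rightarrow> real \<Rightarrow> real" where
  "lambda_p G \<sigma>0 t x p =
     (let d = real CARD('n); c = c_p G \<sigma>0 t x p in
      sqrt p * ((1 - p + p * d) * c - 2 * p * d * Lambda G \<sigma>0 t x / c) *
      (sqrt (real_of_ereal (alpha_low G \<sigma>0 t x)) / norm (matrix_inv (\<sigma>0 t x))))"

definition p_range :: "('n::finite) nonlinearity \<Rightarrow> ('n::finite) mat_fun \<Rightarrow> real \<Rightarrow> real ^ 'n \<Rightarrow> real set" where
  "p_range G \<sigma>0 t x =
     (let \<theta> = real_of_ereal (theta G \<sigma>0 t x) in {\<theta> / (2 * (1 + \<theta>))..1 / 3} \<inter> {0<..1 / 3})"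

definition lambda_star :: "real \<Rightarrow> ('n::finite) nonlinearity \<Rightarrow> ('n::finite) mat_fun \<Rightarrow> ereal" where
  "lambda_star T G \<sigma>0 =
     (INF (t, x)\<in>strip T. SUP p\<in>p_range G \<sigma>0 t x. ereal (lambda_p G \<sigma>0 t x p))"

definition scheme_data :: "real \<Rightarrow> real \<Rightarrow> ('n::finite) mat_fun \<Rightarrow> ('n::finite) scalar_fun \<Rightarrow> bool" where
  "scheme_data T K \<sigma>0 p \<longleftrightarrow>
     (\<forall>t\<in>{0..T}. \<forall>x.
        invertible (\<sigma>0 t x) \<and> norm (\<sigma>0 t x) \<le> K \<and> norm (matrix_inv (\<sigma>0 t x)) \<le> K \<and>
        0 < p t x \<and> p t x < 1 \<and> 1 / p t x \<le> K)"

definition assumption_M1 :: "real \<Rightarrow> ('n::finite) nonlinearity \<Rightarrow> ('n::finite) mat_fun \<Rightarrow> bool" where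
  "assumption_M1 T G \<sigma>0 \<longleftrightarrow>
     (\<forall>t\<in>{0..T}. \<forall>x. theta G \<sigma>0 t x \<le> 2) \<and> 0 < lambda_star T G \<sigma>0"

definition assumption_M2 :: "real \<Rightarrow> ('n::finite) nonlinearity \<Rightarrow> ('n::finite) mat_fun \<Rightarrow> ('n::finite) scalar_fun \<Rightarrow> bool" where
  "assumption_M2 T G \<sigma>0 p \<longleftrightarrow>
     (\<forall>t\<in>{0..T}. \<forall>x.
        p t x \<in> p_range G \<sigma>0 t x \<and>
        lambda_star T G \<sigma>0 / 2 \<le> ereal (lambda_p G \<sigma>0 t x (p t x)) \<and>
        alpha_low G \<sigma>0 t x = ereal (1 / (c_p G \<sigma>0 t x (p t x))\<^sup>2))"

definition assumption_M :: "real \<Rightarrow> real \<Rightarrow> ('n::finite) nonlinearity \<Rightarrow> ('n::finite) mat_fun \<Rightarrow> ('n::finite) scalar_fun \<Rightarrow> bool" where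
  "assumption_M T K G \<sigma>0 p \<longleftrightarrow>
     scheme_data T K \<sigma>0 p \<and> assumption_M1 T G \<sigma>0 \<and> assumption_M2 T G \<sigma>0 p"


section \<open>Consistency of the definitions\<close>

lemma is_G_gamma_unique:
  assumes "\<gamma> \<in> sym_mats" "is_G_gamma f \<gamma> A" "is_G_gamma f \<gamma> A'"
  shows "A = A'"
proof -
  define H where "H = A - A'"
  have H: "H \<in> sym_mats"
    using assms(2,3) unfolding H_def is_G_gamma_def sym_mats_def
    by (simp add: transpose_def vec_eq_iff)
  have line: "\<gamma> + s *\<^sub>R H \<in> sym_mats" for s
    using assms(1) H by (simp add: sym_mats_def transpose_def vec_eq_iff)
  have dl: "((\<lambda>s. \<gamma> + s *\<^sub>R H) has_derivative (\<lambda>s. s *\<^sub>R H)) (at (0::real))"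
    by (auto intro!: derivative_eq_intros)
  have "((\<lambda>s. f (\<gamma> + s *\<^sub>R H)) has_real_derivative (M \<bullet> H)) (at 0)" if "is_G_gamma f \<gamma> M" for M
  proof -
    have "(f has_derivative (\<lambda>\<eta>. M \<bullet> \<eta>)) (at \<gamma> within range (\<lambda>s. \<gamma> + s *\<^sub>R H))"
      using that line unfolding is_G_gamma_def
      by (meson has_derivative_subset image_subsetI)
    then have "((\<lambda>s. f (\<gamma> + s *\<^sub>R H)) has_derivative (\<lambda>s. M \<bullet> (s *\<^sub>R H))) (at 0)"
      using has_derivative_in_compose[OF dl, of f "\<lambda>\<eta>. M \<bullet> \<eta>"] by simp
    then show ?thesis by (simp add: has_field_derivative_def mult.commute[of _ "M \<bullet> H"])
  qed
  then have "A \<bullet> H = A' \<bullet> H"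
    using assms(2,3) DERIV_unique by blast
  then have "H \<bullet> H = 0" by (simp add: H_def inner_diff_left)
  then show ?thesis by (simp add: H_def)
qed

lemma G_gamma_unique:
  assumes "\<gamma> \<in> sym_mats" "is_G_gamma (G t x y z) \<gamma> A"
  shows "G_gamma G t x y z \<gamma> = A"
  unfolding G_gamma_def using assms is_G_gamma_unique by blast

lemma pmf_xi_coord:
  assumes "0 < p" "p < 1"
  shows "pmf (xi_coord_pmf p) (1 / sqrt p) = p / 2"
    and "pmf (xi_coord_pmf p) (- 1 / sqrt p) = p / 2"
    and "pmf (xi_coord_pmf p) 0 = 1 - p"
proof -
  have "pmf_of_list_wf [(1 / sqrt p, p / 2), (- 1 / sqrt p, p / 2), (0, 1 - p)]"
    using assms by (intro pmf_of_list_wfI) auto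
  note w = pmf_pmf_of_list[OF this]
  have "1 / sqrt p \<noteq> - 1 / sqrt p" "1 / sqrt p \<noteq> 0" "- 1 / sqrt p \<noteq> 0"
    using assms by (auto simp: field_simps)
  then show "pmf (xi_coord_pmf p) (1 / sqrt p) = p / 2"
    "pmf (xi_coord_pmf p) (- 1 / sqrt p) = p / 2" "pmf (xi_coord_pmf p) 0 = 1 - p"
    unfolding xi_coord_pmf_def w using assms by auto
qed

lemma u_h_terminal: "u_h T G g \<sigma>0 p n T = g"
  by (simp add: u_h_def)

lemma u_h_step_grid:
  assumes T: "0 < T" and n: "1 \<le> n" and i: "i \<in> {1..n}"
    and t: "real (i - 1) * (T / real n) \<le> t" "t < real i * (T / real n)"
  shows "u_h T G g \<sigma>0 p n t =
    scheme_op G \<sigma>0 p t (real i * (T / real n) - t) (u_grid T G g \<sigma>0 p n (n - i))"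
proof -
  have h: "0 < T / real n" using T n by simp
  have "real i * (T / real n) \<le> real n * (T / real n)"
    using i h by (intro mult_right_mono) auto
  then have "t < T" using t n by simp
  moreover have "(LEAST i. t < real i * (T / real n)) = i"
  proof (rule Least_equality)
    fix j assume "t < real j * (T / real n)"
    then have "real (i - 1) < real j" using t(1) h
      by (meson le_less_trans mult_less_cancel_right_pos)
    then show "i \<le> j" by linarith
  qed (rule t(2))
  ultimately show ?thesis by (simp add: u_h_def)
qed

lemma u_h_grid:
  assumes T: "0 < T" and n: "1 \<le> n" and k: "k \<le> n"
  shows "u_h T G g \<sigma>0 p n (real (n - k) * (T / real n)) = u_grid T G g \<sigma>0 p n k"
proof (cases k)
  case 0
  then show ?thesis using n by (simp add: u_h_terminal)
next
  case (Suc m)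
  have h: "0 < T / real n" using T n by simp
  have "real (n - k) < real (n - m)" using Suc k by simp
  then have "real (n - k) * (T / real n) < real (n - m) * (T / real n)"
    using h by (rule mult_strict_right_mono)
  then show ?thesis
    using u_h_step_grid[OF T n, of "n - m" "real (n - k) * (T / real n)" G g \<sigma>0 p] Suc k
    by (simp del: times_divide_eq_right)
qed

lemma u_h_step:
  assumes "0 < T" "1 \<le> n" "i \<in> {1..n}"
    and "real (i - 1) * (T / real n) \<le> t" "t < real i * (T / real n)"
  shows "u_h T G g \<sigma>0 p n t =
    scheme_op G \<sigma>0 p t (real i * (T / real n) - t)
      (u_h T G g \<sigma>0 p n (real i * (T / real n)))"
  using u_h_step_grid[OF assms, of G g \<sigma>0 p] u_h_grid[OF assms(1,2), of "n - i" G g \<sigma>0 p] assms(3)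
  by simp

end

(* Monotonicity. By the mean value theorem, the difference of the scheme operator at two functions is
   the expectation of their difference against a weight that is 1 + h (G_gamma - a0 / 2) : K2 up to
   O(sqrt h). The normalisation alpha_low = 1 / c_p^2 makes lambda_p |sigma0^-1| / sqrt p a lower
   bound of this main part, which therefore dominates the error term for small h.

   Rate. By the moments of xi up to order four, D1 and D2 approximate Du and D2u up to O(h), and D0 u
   is u + h / 2 a0 : D2u up to O(h^2). Hence the local error is O(h^2) for the solution u, which
   satisfies the equation classically since it is its own test function.
   Monotonicity and T[phi + c] <= T[phi] + (1 + L h) c turn this into the global error O(h). *)
theory Submission
  imports Defs
begin

section \<open>Matrices\<close>

text \<open>Two obstacles shape the argument. First, \<open>G\<close> is controlled only at
  symmetric matrices: its derivative is taken within \<open>sym_mats\<close>, so every segment used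
  in a mean value argument has to stay there, and the symmetry of the Hessian, which
  \<open>C12_with\<close> does not assert, has to be proved. Second, the kernels have size h^(-1/2)
  and h^(-1), so bounding Taylor terms by absolute values would lose powers of h. Parity and exact
  moments prevent this: a term whose parity differs from that of the kernel vanishes, both kernels
  have mean zero, and the diagonal of \<open>K2\<close> is weighted according to the fourth moment 1
  / p so that quadratic forms are reproduced exactly. The second order term left in
  \<open>D0\<close> is cancelled by the summand of \<open>F_op\<close> that contains a0. The weight
  is measured in units of |\<sigma>0^-1| / sqrt p. Both its main part and the perturbation through
  \<open>K1\<close> scale in this way, and therefore the threshold for h depends on the given
  constants only.\<close>

lemma norm_matrix_sq: "(norm (A::real^'n^'m))\<^sup>2 = (\<Sum>i\<in>UNIV. (norm (A$i))\<^sup>2)"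
  by (simp add: power2_norm_eq_inner inner_vec_def)

lemma norm_matrix_vector_mult_le: "norm (A *v x) \<le> norm A * norm x" for A :: "real^'n^'m"
proof (rule power2_le_imp_le)
  have "(norm (A *v x))\<^sup>2 = (\<Sum>i\<in>UNIV. (A $ i \<bullet> x)\<^sup>2)"
    by (simp only: power2_norm_eq_inner inner_vec_def[of "A *v x"] matrix_vector_mul_component)
       (simp add: power2_eq_square)
  also have "\<dots> \<le> (\<Sum>i\<in>UNIV. (norm (A$i))\<^sup>2 * (norm x)\<^sup>2)"
    by (intro sum_mono) (metis Cauchy_Schwarz_ineq2 abs_ge_zero power2_abs power_mono
      power_mult_distrib)
  also have "\<dots> = (norm A * norm x)\<^sup>2"
    by (simp add: norm_matrix_sq power_mult_distrib sum_distrib_right)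
  finally show "(norm (A *v x))\<^sup>2 \<le> (norm A * norm x)\<^sup>2" .
qed simp

lemma norm_transpose: "norm (transpose A) = norm (A::real^'n^'m)"
proof -
  have "transpose A \<bullet> transpose A = A \<bullet> A"
    by (simp add: inner_vec_def transpose_def) (rule sum.swap)
  then show ?thesis by (simp add: norm_eq_sqrt_inner)
qed

lemma norm_matrix_mult_le: "norm (A ** B) \<le> norm A * norm B" for A :: "real^'n^'m" and B :: "real^'k^'n"
proof (rule power2_le_imp_le)
  have row: "(A ** B) $ i = transpose B *v (A $ i)" for i
    by (simp add: vec_eq_iff matrix_matrix_mult_def matrix_vector_mult_def transpose_def mult.commute)
  have "(norm (A ** B))\<^sup>2 = (\<Sum>i\<in>UNIV. (norm (transpose B *v (A $ i)))\<^sup>2)"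
    by (simp add: norm_matrix_sq row del: transpose_matrix_vector)
  also have "\<dots> \<le> (\<Sum>i\<in>UNIV. (norm (A$i))\<^sup>2 * (norm B)\<^sup>2)"
    by (intro sum_mono)
       (metis norm_matrix_vector_mult_le norm_transpose norm_ge_zero power_mono power_mult_distrib
           mult.commute)
  also have "\<dots> = (norm A * norm B)\<^sup>2"
    by (simp add: norm_matrix_sq[of A] power_mult_distrib sum_distrib_right)
  finally show "(norm (A ** B))\<^sup>2 \<le> (norm A * norm B)\<^sup>2" .
qed simp

text \<open>Multiplication by \<open>B\<close> and by \<open>transpose B\<close> are adjoint for the
  trace pairing. Together with the version for right factors, this moves the factors \<sigma>^-1 of
  \<open>K2\<close> onto \<open>G_gamma\<close>.\<close>

lemma inner_matrix_mult_left:
  "A \<bullet> (B ** C) = (transpose B ** A) \<bullet> C" for A :: "real^'n^'m" and B :: "real^'k^'m"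
proof -
  have "A \<bullet> (B ** C) = (\<Sum>i\<in>UNIV. \<Sum>j\<in>UNIV. \<Sum>k\<in>UNIV. A$i$j * (B$i$k * C$k$j))"
    by (simp add: inner_vec_def matrix_matrix_mult_def sum_distrib_left)
  also have "\<dots> = (\<Sum>i\<in>UNIV. \<Sum>k\<in>UNIV. \<Sum>j\<in>UNIV. A$i$j * (B$i$k * C$k$j))"
    by (intro sum.cong refl) (rule sum.swap)
  also have "\<dots> = (\<Sum>k\<in>UNIV. \<Sum>i\<in>UNIV. \<Sum>j\<in>UNIV. A$i$j * (B$i$k * C$k$j))"
    by (rule sum.swap)
  also have "\<dots> = (\<Sum>k\<in>UNIV. \<Sum>j\<in>UNIV. \<Sum>i\<in>UNIV. A$i$j * (B$i$k * C$k$j))"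
    by (intro sum.cong refl) (rule sum.swap)
  also have "\<dots> = (transpose B ** A) \<bullet> C"
    by (simp add: inner_vec_def matrix_matrix_mult_def transpose_def sum_distrib_left mult_ac)
  finally show ?thesis .
qed

lemma inner_transpose: "transpose A \<bullet> transpose B = A \<bullet> (B::real^'n^'m)"
  by (simp add: inner_vec_def transpose_def) (rule sum.swap)

lemma inner_matrix_mult_right:
  "A \<bullet> (B ** C) = (A ** transpose C) \<bullet> B" for A :: "real^'n^'m" and B :: "real^'k^'m"
proof -
  have "A \<bullet> (B ** C) = transpose A \<bullet> (transpose C ** transpose B)"
    by (simp only: inner_transpose flip: matrix_transpose_mul)
  also have "\<dots> = (C ** transpose A) \<bullet> transpose B"
    by (simp only: inner_matrix_mult_left transpose_transpose)
  also have "\<dots> = transpose (A ** transpose C) \<bullet> transpose B"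
    by (simp only: matrix_transpose_mul transpose_transpose)
  finally show ?thesis by (simp only: inner_transpose)
qed

lemma inner_outer: "A \<bullet> outer x = x \<bullet> (A *v x)"
  by (simp add: inner_vec_def outer_def matrix_vector_mult_def sum_distrib_left mult_ac)

lemma inner_mat_1: "A \<bullet> mat 1 = (\<Sum>i\<in>UNIV. A$i$i)" for A :: "real^'n^'n"
  by (simp add: inner_vec_def mat_def if_distrib[of "\<lambda>x. _ * x"] cong: if_cong)

lemma inner_diag_part: "A \<bullet> diag_part B = (\<Sum>i\<in>UNIV. A$i$i * B$i$i)" for A :: "real^'n^'n"
  by (simp add: inner_vec_def diag_part_def if_distrib[of "\<lambda>x. _ * x"] cong: if_cong)

lemma quad_diag_part: "v \<bullet> (diag_part A *v v) = (\<Sum>i\<in>UNIV. A$i$i * (v$i)\<^sup>2)" for A :: "real^'n^'n"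
  by (simp add: inner_vec_def diag_part_def matrix_vector_mult_def if_distrib[of "\<lambda>x. x * _"]
      power2_eq_square mult.left_commute cong: if_cong)

lemma inverse_matrix:
  assumes "invertible (A::real^'n^'n)"
  shows "A ** matrix_inv A = mat 1" "matrix_inv A ** A = mat 1"
    "transpose (matrix_inv A) ** transpose A = mat 1" "transpose A ** transpose (matrix_inv A) = mat 1"
proof -
  obtain A' where A': "A ** A' = mat 1 \<and> A' ** A = mat 1"
    using assms by (auto simp: invertible_def)
  then have "A ** matrix_inv A = mat 1 \<and> matrix_inv A ** A = mat 1"
    unfolding matrix_inv_def by (rule someI)
  then show "A ** matrix_inv A = mat 1" "matrix_inv A ** A = mat 1"
    "transpose (matrix_inv A) ** transpose A = mat 1" "transpose A ** transpose (matrix_inv A) = mat 1"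
    by (auto simp flip: matrix_transpose_mul)
qed

text \<open>The identity has norm sqrt d, which is at least 1. Besides giving |\<sigma>^-1| > 0, the
  bound lets a constant be absorbed into a multiple of |\<sigma>^-1| in the monotonicity
  estimate.\<close>

lemma norm_matrix_ge_1_inverse:
  assumes "invertible (A::real^'n^'n)"
  shows "1 \<le> norm A * norm (matrix_inv A)"
proof -
  have "1 \<le> norm (mat 1 :: real^'n^'n)"
  proof -
    have "(norm (mat 1 :: real^'n^'n))\<^sup>2 = real CARD('n)"
      by (simp add: power2_norm_eq_inner inner_mat_1) (simp add: mat_def)
    moreover have "1 \<le> real CARD('n)" by (simp add: Suc_leI)
    ultimately show ?thesis by (metis norm_ge_zero power2_le_imp_le power_one)
  qed
  also have "\<dots> \<le> norm A * norm (matrix_inv A)"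
    using norm_matrix_mult_le[of A "matrix_inv A"] by (simp add: inverse_matrix[OF assms])
  finally show ?thesis .
qed

lemma sym_mats_subspace: "subspace (sym_mats :: (real^'n^'n) set)"
  by (auto simp: subspace_def sym_mats_def transpose_def vec_eq_iff)

lemma conj_sym_mats: "S \<in> sym_mats \<Longrightarrow> transpose M ** S ** M \<in> sym_mats"
  by (simp add: sym_mats_def matrix_transpose_mul matrix_mul_assoc)


section \<open>Moments of the random vector\<close>

abbreviation xi_mean :: "real \<Rightarrow> (real ^ 'n \<Rightarrow> 'b::{banach,second_countable_topology}) \<Rightarrow> 'b" where
  "xi_mean p \<equiv> measure_pmf.expectation (xi_pmf p)"

lemma xi_coord_wf:
  assumes "0 < p" "p < 1"
  shows "pmf_of_list_wf [(1 / sqrt p, p / 2), (- 1 / sqrt p, p / 2), (0, 1 - p)]"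
  using assms by (intro pmf_of_list_wfI) auto

lemma set_xi_coord_pmf:
  assumes "0 < p" "p < 1"
  shows "set_pmf (xi_coord_pmf p) \<subseteq> {1 / sqrt p, - 1 / sqrt p, 0}"
  using set_pmf_of_list[OF xi_coord_wf[OF assms]] by (auto simp: xi_coord_pmf_def)

lemma set_xi_pmf:
  assumes "0 < p" "p < 1" "\<xi> \<in> set_pmf (xi_pmf p)"
  shows "\<xi> $ i \<in> {1 / sqrt p, - 1 / sqrt p, 0}"
  using assms set_xi_coord_pmf[of p] set_Pi_pmf_subset'[of "UNIV::'a set" 0 "\<lambda>_. xi_coord_pmf p"]
  unfolding xi_pmf_def by (auto simp: PiE_dflt_def) blast

lemma set_xi_pmf_sq:
  assumes "0 < p" "p < 1" "\<xi> \<in> set_pmf (xi_pmf p)"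
  shows "(\<xi> $ i)\<^sup>2 = 0 \<or> (\<xi> $ i)\<^sup>2 = 1 / p"
  using set_xi_pmf[OF assms, of i] assms(1) by (auto simp: power_divide)

lemma finite_set_xi_pmf:
  assumes "0 < p" "p < 1"
  shows "finite (set_pmf (xi_pmf p))"
proof -
  have "finite (set_pmf (Pi_pmf (UNIV::'a set) 0 (\<lambda>_. xi_coord_pmf p)))"
    by (rule finite_subset[OF set_Pi_pmf_subset'])
       (auto intro!: finite_subset[OF set_xi_coord_pmf[OF assms]])
  then show ?thesis by (simp add: xi_pmf_def)
qed

lemma integrable_xi_pmf:
  fixes f :: "real^'n \<Rightarrow> 'b::{banach,second_countable_topology}"
  assumes "0 < p" "p < 1"
  shows "integrable (measure_pmf (xi_pmf p)) f"
  by (rule integrable_measure_pmf_finite[OF finite_set_xi_pmf[OF assms]])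

lemma norm_xi_le:
  assumes "0 < p" "p < 1" "\<xi> \<in> set_pmf (xi_pmf p :: (real^'n) pmf)"
  shows "norm \<xi> \<le> sqrt (real CARD('n) / p)"
proof (rule real_le_rsqrt)
  have "(norm \<xi>)\<^sup>2 = (\<Sum>i\<in>UNIV. (\<xi>$i)\<^sup>2)"
    unfolding power2_norm_eq_inner by (simp add: inner_vec_def power2_eq_square)
  also have "\<dots> \<le> (\<Sum>i\<in>(UNIV::'n set). 1/p)"
    using set_xi_pmf_sq[OF assms] assms(1) by (intro sum_mono) (metis less_eq_real_def
        divide_nonneg_pos zero_le_one order_refl)
  finally show "(norm \<xi>)\<^sup>2 \<le> real CARD('n) / p" by simp
qed

text \<open>Independence of the coordinates: on the finite product support the mass factors, and a
  sum of products over a product set is a product of sums.\<close>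

lemma expectation_xi_prod:
  fixes f :: "'n::finite \<Rightarrow> real \<Rightarrow> real"
  assumes "0 < p" "p < 1"
  shows "xi_mean p (\<lambda>\<xi>. \<Prod>k\<in>UNIV. f k (\<xi> $ k)) =
    (\<Prod>k\<in>UNIV. measure_pmf.expectation (xi_coord_pmf p) (f k))"
proof -
  let ?S = "set_pmf (xi_coord_pmf p)"
  have fin: "finite ?S" by (rule finite_subset[OF set_xi_coord_pmf[OF assms]]) simp
  have P: "PiE_dflt UNIV 0 (\<lambda>_. ?S) = PiE UNIV (\<lambda>_::'n. ?S)"
    by (auto simp: PiE_dflt_def)
  have finP: "finite (PiE UNIV (\<lambda>_::'n. ?S))" by (intro finite_PiE) (auto simp: fin)
  have s: "set_pmf (Pi_pmf UNIV 0 (\<lambda>_::'n. xi_coord_pmf p)) = PiE UNIV (\<lambda>_::'n. ?S)"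
    using set_Pi_pmf[of "UNIV::'n set" 0 "\<lambda>_. xi_coord_pmf p"] by (simp add: o_def P)
  have "xi_mean p (\<lambda>\<xi>. \<Prod>k\<in>UNIV. f k (\<xi> $ k)) =
    measure_pmf.expectation (Pi_pmf UNIV 0 (\<lambda>_::'n. xi_coord_pmf p)) (\<lambda>y. \<Prod>k\<in>UNIV. f k (y k))"
    by (simp add: xi_pmf_def)
  also have "\<dots> = (\<Sum>y\<in>PiE UNIV (\<lambda>_::'n. ?S). (\<Prod>k\<in>UNIV. f k (y k)) * pmf (Pi_pmf UNIV 0 (\<lambda>_::'n.
      xi_coord_pmf p)) y)"
    by (rule integral_measure_pmf_real[OF finP]) (simp add: s)
  also have "\<dots> = (\<Sum>y\<in>PiE UNIV (\<lambda>_::'n. ?S). (\<Prod>k\<in>UNIV. f k (y k) * pmf (xi_coord_pmf p) (y k)))"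
    by (simp add: pmf_Pi prod.distrib)
  also have "\<dots> = (\<Prod>k\<in>UNIV. \<Sum>s\<in>?S. f k s * pmf (xi_coord_pmf p) s)"
    by (rule prod_sum_PiE[symmetric]) (auto simp: fin)
  also have "\<dots> = (\<Prod>k\<in>UNIV. measure_pmf.expectation (xi_coord_pmf p) (f k))"
    by (intro prod.cong refl integral_measure_pmf_real[symmetric] fin) simp
  finally show ?thesis .
qed

lemma expectation_xi_coord:
  assumes "0 < p" "p < 1"
  shows "measure_pmf.expectation (xi_coord_pmf p) f =
     p / 2 * f (1 / sqrt p) + p / 2 * f (- 1 / sqrt p) + (1 - p) * (f 0 :: real)"
proof -
  have ne: "1 / sqrt p \<noteq> - 1 / sqrt p" "1 / sqrt p \<noteq> 0" "- 1 / sqrt p \<noteq> 0"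
    using assms by (auto simp: field_simps)
  have "measure_pmf.expectation (xi_coord_pmf p) f =
      (\<Sum>s\<in>{1 / sqrt p, - 1 / sqrt p, 0}. f s * pmf (xi_coord_pmf p) s)"
    using set_xi_coord_pmf[OF assms] by (intro integral_measure_pmf_real) auto
  also have "\<dots> = f (1 / sqrt p) * pmf (xi_coord_pmf p) (1 / sqrt p) +
      f (- 1 / sqrt p) * pmf (xi_coord_pmf p) (- 1 / sqrt p) + f 0 * pmf (xi_coord_pmf p) 0"
    using ne by simp
  finally show ?thesis unfolding pmf_xi_coord[OF assms] by (simp add: mult.commute)
qed

lemma expectation_xi_coord_power:
  assumes "0 < p" "p < 1"
  shows "odd n \<Longrightarrow> measure_pmf.expectation (xi_coord_pmf p) (\<lambda>x. x ^ n) = 0"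
    "measure_pmf.expectation (xi_coord_pmf p) (\<lambda>x. x\<^sup>2) = 1"
    "measure_pmf.expectation (xi_coord_pmf p) (\<lambda>x. x ^ 4) = 1 / p"
proof -
  have "sqrt p ^ 4 = p\<^sup>2" using assms by (simp add: power4_eq_xxxx power2_eq_square)
  then show "measure_pmf.expectation (xi_coord_pmf p) (\<lambda>x. x ^ 4) = 1 / p"
    using assms by (simp add: expectation_xi_coord power_divide) (simp add: power2_eq_square)
  show "odd n \<Longrightarrow> measure_pmf.expectation (xi_coord_pmf p) (\<lambda>x. x ^ n) = 0"
    using assms by (auto simp: expectation_xi_coord power_divide power_0_left elim!: oddE)
  show "measure_pmf.expectation (xi_coord_pmf p) (\<lambda>x. x\<^sup>2) = 1"
    using assms by (simp add: expectation_xi_coord power_divide)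
qed

text \<open>The law of \<xi> is invariant under negation, so the mean equals its own negative. Only
  the parity of \<open>f\<close> enters, which disposes of the third order Taylor term without
  computing its moments.\<close>

lemma expectation_xi_odd:
  fixes f :: "real^'n \<Rightarrow> 'b::{banach,second_countable_topology}"
  assumes p: "0 < p" "p < 1" and odd: "\<And>\<xi>. f (- \<xi>) = - f \<xi>"
  shows "xi_mean p f = 0"
proof -
  have "map_pmf uminus (xi_coord_pmf p) = xi_coord_pmf p"
  proof (rule pmf_eqI)
    fix x :: real
    have "pmf (map_pmf uminus (xi_coord_pmf p)) x = pmf (xi_coord_pmf p) (- x)"
      using pmf_map_inj'[of uminus "xi_coord_pmf p" "- x"] by (simp add: inj_def)
    also have "\<dots> = pmf (xi_coord_pmf p) x"
    proof (cases "x \<in> {1 / sqrt p, - 1 / sqrt p, 0}")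
      case True
      then show ?thesis using pmf_xi_coord[OF p] by auto
    next
      case False
      then have "- x \<notin> {1 / sqrt p, - 1 / sqrt p, 0}" by (auto simp: minus_equation_iff)
      then have "x \<notin> set_pmf (xi_coord_pmf p)" "- x \<notin> set_pmf (xi_coord_pmf p)"
        using False set_xi_coord_pmf[OF p] by blast+
      then show ?thesis by (simp add: set_pmf_iff)
    qed
    finally show "pmf (map_pmf uminus (xi_coord_pmf p)) x = pmf (xi_coord_pmf p) x" .
  qed
  then have "map_pmf (\<lambda>h. uminus \<circ> h) (Pi_pmf (UNIV::'n set) 0 (\<lambda>_. xi_coord_pmf p)) =
      Pi_pmf UNIV 0 (\<lambda>_. xi_coord_pmf p)"
    using Pi_pmf_map[of "UNIV::'n set" uminus "0::real" 0 "\<lambda>_. xi_coord_pmf p"] by simp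
  then have "map_pmf vec_lambda (map_pmf (\<lambda>h. uminus \<circ> h) (Pi_pmf (UNIV::'n set) 0 (\<lambda>_. xi_coord_pmf
      p))) = xi_pmf p"
    by (simp add: xi_pmf_def)
  moreover have "vec_lambda (uminus \<circ> h) = - vec_lambda h" for h :: "'n \<Rightarrow> real"
    by (simp add: vec_eq_iff)
  ultimately have "map_pmf uminus (xi_pmf p :: (real^'n) pmf) = xi_pmf p"
    by (simp add: xi_pmf_def map_pmf_comp)
  then have "xi_mean p f = measure_pmf.expectation (map_pmf uminus (xi_pmf p)) f" by simp
  also have "\<dots> = - xi_mean p f" by (simp add: odd)
  finally show ?thesis by (metis add_eq_0_iff scaleR_2 scaleR_eq_0_iff zero_neq_numeral)
qed

lemma expectation_xi_monomial2:
  assumes p: "0 < p" "p < 1"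
  shows "xi_mean p (\<lambda>\<xi>. \<xi> $ i * \<xi> $ (j::'n::finite)) = (if i = j then 1 else 0)"
proof -
  \<comment> \<open>\<open>e k\<close> counts how often the coordinate \<open>k\<close> occurs in
    the monomial, so that independence gives a product of one-dimensional moments.\<close>
  define e where "e k = (if k = i then 1 else 0) + (if k = j then 1 else 0::nat)" for k
  define m where "m k = measure_pmf.expectation (xi_coord_pmf p) (\<lambda>x. x ^ e k)" for k
  have "\<xi> $ i * \<xi> $ j = (\<Prod>k\<in>UNIV. (\<xi> $ k) ^ e k)" for \<xi> :: "real^'n"
    by (simp add: e_def power_add prod.distrib if_distrib[of "\<lambda>m. _ ^ m"] cong: if_cong)
  then have eq: "xi_mean p (\<lambda>\<xi>. \<xi> $ i * \<xi> $ j) = (\<Prod>k\<in>UNIV. m k)"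
    using expectation_xi_prod[OF p, of "\<lambda>k x. x ^ e k"] by (simp add: m_def)
  show ?thesis
  proof (cases "i = j")
    case True
    then have "e k = (if k = j then 2 else 0)" for k by (simp add: e_def)
    then have "m k = 1" for k
      using expectation_xi_coord_power(2)[OF p] by (simp add: m_def)
    then show ?thesis using True eq by simp
  next
    case False
    then have "m i = 0"
      using expectation_xi_coord_power(1)[OF p, of 1] by (simp add: e_def m_def)
    then have "(\<Prod>k\<in>UNIV. m k) = 0" by (intro prod_zero) auto
    then show ?thesis using False eq by simp
  qed
qed

lemma expectation_xi_monomial4:
  assumes p: "0 < p" "p < 1"
  shows "xi_mean p (\<lambda>\<xi>. \<xi> $ a * \<xi> $ b * (\<xi> $ i * \<xi> $ (j::'n::finite))) =
    (if a = b \<and> i = j then (if a = i then 1 / p else 1)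
     else if (a = i \<and> b = j) \<or> (a = j \<and> b = i) then 1 else 0)"
proof -
  define e where "e k = (if k = a then 1 else 0) + (if k = b then 1 else 0::nat) +
    ((if k = i then 1 else 0) + (if k = j then 1 else 0::nat))" for k
  define m where "m k = measure_pmf.expectation (xi_coord_pmf p) (\<lambda>x. x ^ e k)" for k
  have "\<xi> $ a * \<xi> $ b * (\<xi> $ i * \<xi> $ j) = (\<Prod>k\<in>UNIV. (\<xi> $ k) ^ e k)" for \<xi> :: "real^'n"
    by (simp add: e_def power_add prod.distrib if_distrib[of "\<lambda>m. _ ^ m"] cong: if_cong)
  then have eq: "xi_mean p (\<lambda>\<xi>. \<xi> $ a * \<xi> $ b * (\<xi> $ i * \<xi> $ j)) = (\<Prod>k\<in>UNIV. m k)"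
    using expectation_xi_prod[OF p, of "\<lambda>k x. x ^ e k"] by (simp add: m_def)
  have one: "m k = 1" if "e k = 0 \<or> e k = 2" for k
    using that expectation_xi_coord_power(2)[OF p] by (auto simp: m_def)
  have zero: "(\<Prod>k\<in>UNIV. m k) = 0" if "odd (e k)" for k
    using expectation_xi_coord_power(1)[OF p that] by (intro prod_zero) (auto simp: m_def)
  \<comment> \<open>In the first four cases the indices can be paired and all exponents are even. In
    the last one some coordinate has an odd exponent, and its vanishing moment kills the
    product.\<close>
  consider "a = b" "i = j" "a = i"
    | "a = b" "i = j" "a \<noteq> i" | "a \<noteq> b" "a = i" "b = j" | "a \<noteq> b" "a = j" "b = i"
    | "\<not> ((a = b \<and> i = j) \<or> (a = i \<and> b = j) \<or> (a = j \<and> b = i))" by blast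
  then show ?thesis
  proof cases
    case 1
    have "(\<Prod>k\<in>UNIV. m k) = m i * (\<Prod>k\<in>UNIV - {i}. m k)" by (simp add: prod.remove)
    also have "(\<Prod>k\<in>UNIV - {i}. m k) = 1" using 1 by (intro prod.neutral ballI one) (simp add: e_def)
    also have "e i = 4" using 1 by (simp add: e_def)
    then have "m i = 1 / p" using expectation_xi_coord_power(3)[OF p] by (simp add: m_def)
    finally show ?thesis using 1 eq by simp
  next
    case 2
    then have "(\<Prod>k\<in>UNIV. m k) = 1" by (intro prod.neutral ballI one) (simp add: e_def)
    then show ?thesis using 2 eq by simp
  next
    case 3
    then have "(\<Prod>k\<in>UNIV. m k) = 1" by (intro prod.neutral ballI one) (simp add: e_def)
    then show ?thesis using 3 eq by simp
  next
    case 4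
    then have "(\<Prod>k\<in>UNIV. m k) = 1" by (intro prod.neutral ballI one) (simp add: e_def)
    then show ?thesis using 4 eq by simp
  next
    case 5
    then have "odd (e a) \<or> odd (e b) \<or> odd (e i) \<or> odd (e j)"
    proof (cases "a = b")
      case True
      then have "i \<noteq> j" using 5 by simp
      then have "odd (e i)" using True by (cases "i = b") (simp_all add: e_def)
      then show ?thesis by simp
    next
      case False
      consider "a \<noteq> i" "a \<noteq> j" | "a = i" "a = j" | "a = i" "a \<noteq> j" "b \<noteq> j" | "a = j" "a \<noteq> i" "b \<noteq> i"
        using 5 by blast
      then show ?thesis
        using False by cases (simp_all add: e_def)
    qed
    then have "(\<Prod>k\<in>UNIV. m k) = 0" using zero by blast
    moreover have "\<not> (a = b \<and> i = j)" "\<not> ((a = i \<and> b = j) \<or> (a = j \<and> b = i))" using 5 by blast+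
    ultimately show ?thesis using eq by (simp only: if_False)
  qed
qed

section \<open>The second order kernel freed from \<sigma> and h\<close>

definition kern2 :: "real \<Rightarrow> real ^ 'n \<Rightarrow> real ^ 'n ^ 'n" where
  "kern2 p \<xi> = (1 / (1 - p)) *\<^sub>R
     ((1 - p) *\<^sub>R outer \<xi> - (1 - 3 * p) *\<^sub>R diag_part (outer \<xi>) - (2 * p) *\<^sub>R mat 1)"

lemma matrix_mult_scaleR_right: "A ** (c *\<^sub>R B) = c *\<^sub>R (A ** B)"
    for A :: "real^'n^'m" and B :: "real^'k^'n"
  by (simp add: matrix_matrix_mult_def vec_eq_iff sum_distrib_left mult_ac)

lemma matrix_mult_scaleR_left: "(c *\<^sub>R A) ** B = c *\<^sub>R (A ** B)"
    for A :: "real^'n^'m" and B :: "real^'k^'n"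
  by (simp add: matrix_matrix_mult_def vec_eq_iff sum_distrib_left mult_ac)

lemma K2_eq_kern2: "K2 \<sigma> p h \<xi> = (1 / h) *\<^sub>R (transpose (matrix_inv \<sigma>) ** kern2 p \<xi> ** matrix_inv \<sigma>)"
  by (simp add: K2_def kern2_def matrix_mult_scaleR_right matrix_mult_scaleR_left)

text \<open>The diagonal factor 2 p / (1 - p) is 2 divided by the variance E \<xi>_i^4 - 1 = (1 - p)
  / p of \<xi>_i^2, which is what makes the kernel reproduce second derivatives. For p = 1/3 it
  equals 1 and the kernel is \<open>outer \<xi> - mat 1\<close>, as for a Gaussian vector.\<close>

lemma kern2_nth:
  assumes "p < 1"
  shows "kern2 p \<xi> $ i $ j = (if i = j then 2 * p / (1 - p) * ((\<xi>$i)\<^sup>2 - 1) else \<xi>$i * \<xi>$j)"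
proof -
  have "(1 - p) * q - (1 - 3 * p) * q - 2 * p = 2 * p * (q - 1)" for q by (simp add: algebra_simps)
  then show ?thesis
    using assms by (simp add: kern2_def outer_def diag_part_def mat_def power2_eq_square)
qed

lemma kern2_minus: "kern2 p (- \<xi>) = kern2 p \<xi>"
  by (simp add: kern2_def outer_def)

lemma kern2_sym: "kern2 p \<xi> \<in> sym_mats"
  by (simp add: kern2_def sym_mats_def outer_def diag_part_def mat_def transpose_def vec_eq_iff
    mult.commute)

lemma norm_matrix_le_entries:
  assumes "\<And>i j. \<bar>(A::real^'n^'m) $ i $ j\<bar> \<le> b"
  shows "norm A \<le> real CARD('m) * real CARD('n) * b"
proof -
  have "norm A \<le> (\<Sum>i\<in>UNIV. norm (A$i))" by (simp add: norm_vec_def L2_set_le_sum)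
  also have "\<dots> \<le> (\<Sum>i\<in>(UNIV::'m set). \<Sum>j\<in>(UNIV::'n set). b)"
    by (intro sum_mono order_trans[OF norm_le_l1_cart] assms)
  finally show ?thesis by (simp add: mult_ac)
qed

text \<open>Every entry is at most 1 / p: off the diagonal because |\<xi>_i| \<le> 1 / sqrt p, and
  on it because p \<le> 1/3 bounds the entry by 2 and 2 by 1 / p.\<close>

lemma norm_kern2_le:
  assumes "0 < p" "p \<le> 1 / 3" "\<xi> \<in> set_pmf (xi_pmf p :: (real^'n) pmf)"
  shows "norm (kern2 p \<xi>) \<le> (real CARD('n))\<^sup>2 / p"
proof -
  have p: "0 < p" "p < 1" using assms by auto
  have "\<bar>kern2 p \<xi> $ i $ j\<bar> \<le> 1 / p" for i j
  proof (cases "i = j")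
    case True
    have "\<bar>(\<xi>$i)\<^sup>2 - 1\<bar> \<le> (1 - p) / p"
    proof -
      have "3 \<le> 1 / p" using assms by (simp add: field_simps)
      then have "\<bar>q - 1\<bar> \<le> 1 / p - 1" if "q = 0 \<or> q = 1 / p" for q :: real
        using that by linarith
      then show ?thesis using set_xi_pmf_sq[OF p assms(3), of i] p by (simp add: diff_divide_distrib)
    qed
    then have "2 * p / (1 - p) * \<bar>(\<xi>$i)\<^sup>2 - 1\<bar> \<le> 2 * p / (1 - p) * ((1 - p) / p)"
      using p by (intro mult_left_mono) auto
    also have "\<dots> = 2" using p by simp
    also have "\<dots> \<le> 1 / p" using assms by (simp add: field_simps)
    finally show ?thesis using True p by (simp add: kern2_nth abs_mult)
  next
    case False
    have "\<bar>\<xi>$k\<bar> \<le> 1 / sqrt p" for k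
      using set_xi_pmf[OF p assms(3), of k] p by auto
    then have "\<bar>\<xi>$i\<bar> * \<bar>\<xi>$j\<bar> \<le> 1 / sqrt p * (1 / sqrt p)"
      using p by (intro mult_mono) auto
    then show ?thesis using False p by (simp add: kern2_nth abs_mult)
  qed
  then show ?thesis using norm_matrix_le_entries[of "kern2 p \<xi>" "1/p"] by (simp add: power2_eq_square)
qed

lemma quad_form_sum: "\<xi> \<bullet> (A *v \<xi>) = (\<Sum>a\<in>UNIV. \<Sum>b\<in>UNIV. A$a$b * (\<xi>$a * \<xi>$b))" for A :: "real^'n^'n"
  by (simp add: inner_vec_def matrix_vector_mult_def sum_distrib_left mult_ac)

section \<open>Mean values of linear and quadratic forms against the kernels\<close>

context
  fixes p :: real
  assumes p: "0 < p" "p < 1"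
begin

lemma expectation_xi_linear:
  fixes f :: "real^'n \<Rightarrow> 'b::{banach,second_countable_topology}"
  assumes "bounded_linear T"
  shows "xi_mean p (\<lambda>\<xi>. T (f \<xi>)) = T (xi_mean p f)"
  by (rule integral_bounded_linear[OF assms integrable_xi_pmf[OF p]])

lemma expectation_xi_norm_le:
  fixes f :: "real^'n \<Rightarrow> 'b::{banach,second_countable_topology}"
  assumes "\<And>\<xi>. \<xi> \<in> set_pmf (xi_pmf p) \<Longrightarrow> norm (f \<xi>) \<le> B"
  shows "norm (xi_mean p f) \<le> B"
proof -
  have "norm (xi_mean p f) \<le> xi_mean p (\<lambda>\<xi>. norm (f \<xi>))"
    by (rule integral_norm_bound)
  also have "\<dots> \<le> measure_pmf.expectation (xi_pmf p :: (real^'n) pmf) (\<lambda>_. B)"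
    by (intro integral_mono_AE integrable_xi_pmf p) (auto simp: AE_measure_pmf_iff assms)
  finally show ?thesis by simp
qed

lemma expectation_xi_nth:
  fixes f :: "real^'n \<Rightarrow> ('b::euclidean_space)^'m"
  shows "xi_mean p f $ i = xi_mean p (\<lambda>\<xi>. f \<xi> $ i)"
  using expectation_xi_linear[OF bounded_linear_vec_nth, of f i] by simp

lemma expectation_inner_xi: "xi_mean p (\<lambda>\<xi>. (b \<bullet> \<xi>) *\<^sub>R \<xi>) = (b :: real^'n)"
proof (rule vec_eq_iff[THEN iffD2], rule allI)
  fix i
  have "xi_mean p (\<lambda>\<xi>. (b \<bullet> \<xi>) *\<^sub>R \<xi>) $ i =
    xi_mean p (\<lambda>\<xi>. \<Sum>k\<in>UNIV. b $ k * (\<xi> $ k * \<xi> $ i))"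
    by (simp add: expectation_xi_nth inner_vec_def sum_distrib_left mult_ac)
  also have "\<dots> = (\<Sum>k\<in>UNIV. b $ k * xi_mean p (\<lambda>\<xi>. \<xi> $ k * \<xi> $ i))"
    by (subst Bochner_Integration.integral_sum) (simp_all add: integrable_xi_pmf[OF p])
  also have "\<dots> = b $ i" by (simp add: expectation_xi_monomial2[OF p] if_distrib[of
      "\<lambda>x. _ * x"] cong: if_cong)
  finally show "xi_mean p (\<lambda>\<xi>. (b \<bullet> \<xi>) *\<^sub>R \<xi>) $ i = b $ i" .
qed

lemma expectation_quad_xi:
  "xi_mean p (\<lambda>\<xi>. \<xi> \<bullet> (A *v \<xi>)) = (\<Sum>a\<in>UNIV. (A::real^'n^'n)$a$a)"
proof -
  have "xi_mean p (\<lambda>\<xi>. \<xi> \<bullet> (A *v \<xi>)) =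
    (\<Sum>a\<in>UNIV. \<Sum>b\<in>UNIV. A$a$b * xi_mean p (\<lambda>\<xi>. \<xi> $ a * \<xi> $ b))"
    by (simp add: quad_form_sum Bochner_Integration.integral_sum integrable_xi_pmf[OF p])
  then show ?thesis by (simp add: expectation_xi_monomial2[OF p] if_distrib[of
      "\<lambda>x. _ * x"] cong: if_cong)
qed

text \<open>By the pairings of the fourth moments, equal indices pick up the trace and the excess 1
  / p - 1 of the fourth moment of \<xi>_i; distinct indices pick up the two mixed entries.\<close>

lemma expectation_quad_xi_monomial2:
  fixes A :: "real^'n^'n"
  shows "xi_mean p (\<lambda>\<xi>. (\<xi> \<bullet> (A *v \<xi>)) * (\<xi> $ i * \<xi> $ j)) =
    (if i = j then (\<Sum>a\<in>UNIV. A$a$a) + (1 / p - 1) * A$i$i else A$i$j + A$j$i)"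
proof -
  have "xi_mean p (\<lambda>\<xi>. (\<xi> \<bullet> (A *v \<xi>)) * (\<xi> $ i * \<xi> $ j)) =
    xi_mean p (\<lambda>\<xi>. \<Sum>a\<in>UNIV. \<Sum>b\<in>UNIV. A$a$b * (\<xi> $ a * \<xi> $ b * (\<xi> $ i * \<xi> $ j)))"
    by (simp add: quad_form_sum sum_distrib_right mult.assoc)
  also have "\<dots> = (\<Sum>a\<in>UNIV. \<Sum>b\<in>UNIV. A$a$b * xi_mean p (\<lambda>\<xi>. \<xi> $ a * \<xi> $ b * (\<xi> $ i * \<xi> $ j)))"
    by (simp add: Bochner_Integration.integral_sum integrable_xi_pmf[OF p])
  also have "\<dots> = (if i = j then (\<Sum>a\<in>UNIV. A$a$a) + (1 / p - 1) * A$i$i else A$i$j + A$j$i)"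
  proof (cases "i = j")
    case True
    \<comment> \<open>The table of moments is rewritten with Kronecker deltas in a and b, so that
      both sums collapse.\<close>
    have "A$a$b * (if a = b \<and> i = j then (if a = i then 1 / p else 1)
        else if (a = i \<and> b = j) \<or> (a = j \<and> b = i) then 1 else 0) =
      (if b = a then A$a$a + (if a = i then (1/p - 1) * A$i$i else 0) else 0)" for a b
      using True by (auto simp: algebra_simps)
    then show ?thesis
      by (simp only: expectation_xi_monomial4[OF p]) (simp add: True sum.distrib)
  next
    case False
    have "A$a$b * (if a = b \<and> i = j then (if a = i then 1 / p else 1)
        else if (a = i \<and> b = j) \<or> (a = j \<and> b = i) then 1 else 0) =
      (if b = j then if a = i then A$i$j else 0 else 0) + (if b = i then
          if a = j then A$j$i else 0 else 0)" for a b
      using False by auto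
    then show ?thesis
      by (simp only: expectation_xi_monomial4[OF p]) (simp add: False sum.distrib)
  qed
  finally show ?thesis .
qed

lemma expectation_kern2: "xi_mean p (kern2 p :: real^'n \<Rightarrow> _) = 0"
proof -
  have "xi_mean p (kern2 p :: real^'n \<Rightarrow> _) $ i $ j = 0" for i j
    using expectation_xi_monomial2[OF p, of i j] p
    by (cases "i = j") (simp_all add: expectation_xi_nth kern2_nth integrable_xi_pmf power2_eq_square)
  then show ?thesis by (simp add: vec_eq_iff)
qed

text \<open>On the diagonal, the 1 subtracted from \<xi>_i^2 removes the trace, and the factor 2 p /
  (1 - p) cancels the excess of the fourth moment. Off the diagonal the result is
  \<open>A$i$j + A$j$i\<close>, which is where the symmetry of \<open>A\<close> enters.\<close>

lemma expectation_quad_kern2: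
  fixes A :: "real^'n^'n"
  assumes "A \<in> sym_mats"
  shows "xi_mean p (\<lambda>\<xi>. (\<xi> \<bullet> (A *v \<xi>)) *\<^sub>R kern2 p \<xi>) = 2 *\<^sub>R A"
proof -
  have s: "A$j$i = A$i$j" for i j
    using assms by (simp add: sym_mats_def transpose_def vec_eq_iff)
  have "xi_mean p (\<lambda>\<xi>. (\<xi> \<bullet> (A *v \<xi>)) *\<^sub>R kern2 p \<xi>) $ i $ j = 2 * A$i$j" for i j
  proof (cases "i = j")
    case True
    have "xi_mean p (\<lambda>\<xi>. (\<xi> \<bullet> (A *v \<xi>)) *\<^sub>R kern2 p \<xi>) $ i $ j =
      xi_mean p (\<lambda>\<xi>. 2 * p / (1 - p) * ((\<xi> \<bullet> (A *v \<xi>)) * (\<xi> $ i * \<xi> $ i) - \<xi> \<bullet> (A *v \<xi>)))"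
    proof -
      have "(\<xi> \<bullet> (A *v \<xi>)) *\<^sub>R kern2 p \<xi> $ i $ j =
          2 * p / (1 - p) * ((\<xi> \<bullet> (A *v \<xi>)) * (\<xi> $ i * \<xi> $ i) - \<xi> \<bullet> (A *v \<xi>))" for \<xi>
        using True p by (simp add: kern2_nth power2_eq_square) (simp add: algebra_simps)
      then show ?thesis by (simp add: expectation_xi_nth)
    qed
    also have "\<dots> = 2 * p / (1 - p) * ((1 / p - 1) * A$i$i)"
      by (simp add: integrable_xi_pmf[OF p] expectation_quad_xi_monomial2 expectation_quad_xi)
    also have "\<dots> = 2 * A$i$i" using p by (simp add: field_simps)
    finally show ?thesis using True by simp
  next
    case False
    then show ?thesis using p s
      by (simp add: expectation_xi_nth kern2_nth expectation_quad_xi_monomial2)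
  qed
  then show ?thesis by (simp add: vec_eq_iff)
qed

text \<open>The kernel \<kappa> stays arbitrary so that 1, \<xi> and \<open>kern2 p\<close> give
  \<open>D0\<close>, \<open>D1\<close> and \<open>D2\<close> alike. The coefficients
  \<open>a3\<close> and \<open>r\<close> are kept as functions of \<xi>; parity of the former and
  bounds on both are what the error estimates use.\<close>

lemma expectation_expansion:
  fixes f :: "real^'n \<Rightarrow> real" and \<kappa> :: "real^'n \<Rightarrow> 'b::{banach,second_countable_topology}"
  assumes "\<And>\<xi>. \<xi> \<in> set_pmf (xi_pmf p) \<Longrightarrow>
    f \<xi> = f0 + s * (b \<bullet> \<xi>) + s\<^sup>2 / 2 * (\<xi> \<bullet> (A *v \<xi>)) + s ^ 3 * a3 \<xi> + s ^ 4 * r \<xi>"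
  shows "xi_mean p (\<lambda>\<xi>. f \<xi> *\<^sub>R \<kappa> \<xi>) =
    f0 *\<^sub>R xi_mean p \<kappa> +
    s *\<^sub>R xi_mean p (\<lambda>\<xi>. (b \<bullet> \<xi>) *\<^sub>R \<kappa> \<xi>) +
    (s\<^sup>2 / 2) *\<^sub>R xi_mean p (\<lambda>\<xi>. (\<xi> \<bullet> (A *v \<xi>)) *\<^sub>R \<kappa> \<xi>) +
    s ^ 3 *\<^sub>R xi_mean p (\<lambda>\<xi>. a3 \<xi> *\<^sub>R \<kappa> \<xi>) +
    s ^ 4 *\<^sub>R xi_mean p (\<lambda>\<xi>. r \<xi> *\<^sub>R \<kappa> \<xi>)"
proof -
  have "xi_mean p (\<lambda>\<xi>. f \<xi> *\<^sub>R \<kappa> \<xi>) =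
    xi_mean p (\<lambda>\<xi>. f0 *\<^sub>R \<kappa> \<xi> + s *\<^sub>R ((b \<bullet> \<xi>) *\<^sub>R \<kappa> \<xi>) +
      (s\<^sup>2 / 2) *\<^sub>R ((\<xi> \<bullet> (A *v \<xi>)) *\<^sub>R \<kappa> \<xi>) + s ^ 3 *\<^sub>R (a3 \<xi> *\<^sub>R \<kappa> \<xi>) + s ^ 4 *\<^sub>R (r \<xi> *\<^sub>R \<kappa> \<xi>))"
    by (intro integral_cong_AE) (auto simp: AE_measure_pmf_iff assms scaleR_add_left)
  also have "\<dots> = f0 *\<^sub>R xi_mean p \<kappa> +
    s *\<^sub>R xi_mean p (\<lambda>\<xi>. (b \<bullet> \<xi>) *\<^sub>R \<kappa> \<xi>) +
    (s\<^sup>2 / 2) *\<^sub>R xi_mean p (\<lambda>\<xi>. (\<xi> \<bullet> (A *v \<xi>)) *\<^sub>R \<kappa> \<xi>) +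
    s ^ 3 *\<^sub>R xi_mean p (\<lambda>\<xi>. a3 \<xi> *\<^sub>R \<kappa> \<xi>) +
    s ^ 4 *\<^sub>R xi_mean p (\<lambda>\<xi>. r \<xi> *\<^sub>R \<kappa> \<xi>)"
    by (simp del: scaleR_scaleR add: integrable_xi_pmf[OF p])
  finally show ?thesis .
qed

end

lemma matrix_add_rdistrib: "(A + B) ** C = A ** C + B ** C" for A :: "real^'n^'m" and C :: "real^'k^'n"
  by (simp add: matrix_matrix_mult_def vec_eq_iff sum.distrib algebra_simps)

lemma bounded_linear_conj: "bounded_linear (\<lambda>X. A ** X ** B)"
    for A :: "real^'n^'m" and B :: "real^'k^'l"
  by (intro linear_conv_bounded_linear[THEN iffD1] linearI)
     (simp_all add: matrix_mult_scaleR_right matrix_mult_scaleR_left matrix_add_ldistrib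
         matrix_add_rdistrib)

lemma D1_eq:
  assumes "0 < p t x" "p t x < 1"
  shows "D1 \<sigma>0 p t h \<phi> x = (1 / sqrt h) *\<^sub>R (transpose (matrix_inv (\<sigma>0 t x)) *v
    xi_mean (p t x) (\<lambda>\<xi>. \<phi> (x + sqrt h *\<^sub>R (\<sigma>0 t x *v \<xi>)) *\<^sub>R \<xi>))"
proof -
  have "bounded_linear (\<lambda>v. (1 / sqrt h) *\<^sub>R (transpose (matrix_inv (\<sigma>0 t x)) *v v))"
    by (intro bounded_linear_intros matrix_vector_mul_bounded_linear)
  note expectation_xi_linear[OF assms this]
  moreover have "\<phi> (x + sqrt h *\<^sub>R (\<sigma>0 t x *v \<xi>)) *\<^sub>R K1 (\<sigma>0 t x) h \<xi> =
    (1 / sqrt h) *\<^sub>R (transpose (matrix_inv (\<sigma>0 t x)) *v (\<phi> (x +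
        sqrt h *\<^sub>R (\<sigma>0 t x *v \<xi>)) *\<^sub>R \<xi>))" for \<xi>
    by (simp add: K1_def matrix_vector_mult_scaleR mult.commute del: transpose_matrix_vector)
  ultimately show ?thesis by (simp only: D1_def)
qed

lemma D2_eq:
  assumes "0 < p t x" "p t x < 1"
  shows "D2 \<sigma>0 p t h \<phi> x = (1 / h) *\<^sub>R (transpose (matrix_inv (\<sigma>0 t x)) **
    xi_mean (p t x) (\<lambda>\<xi>. \<phi> (x + sqrt h *\<^sub>R (\<sigma>0 t x *v \<xi>)) *\<^sub>R kern2 (p t x) \<xi>) **
    matrix_inv (\<sigma>0 t x))"
proof -
  have "bounded_linear (\<lambda>X. (1 / h) *\<^sub>R (transpose (matrix_inv (\<sigma>0 t x)) ** X ** matrix_inv (\<sigma>0 t x)))"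
    by (intro bounded_linear_intros bounded_linear_conj)
  note expectation_xi_linear[OF assms this]
  moreover have "\<phi> (x + sqrt h *\<^sub>R (\<sigma>0 t x *v \<xi>)) *\<^sub>R K2 (\<sigma>0 t x) (p t x) h \<xi> =
    (1 / h) *\<^sub>R (transpose (matrix_inv (\<sigma>0 t x)) **
      (\<phi> (x + sqrt h *\<^sub>R (\<sigma>0 t x *v \<xi>)) *\<^sub>R kern2 (p t x) \<xi>) ** matrix_inv (\<sigma>0 t x))" for \<xi>
    by (simp add: K2_eq_kern2 matrix_mult_scaleR_right matrix_mult_scaleR_left mult.commute)
  ultimately show ?thesis by (simp only: D2_def)
qed


section \<open>Monotonicity\<close>

lemma has_derivative_along_line:
  fixes H :: "'a::real_normed_vector \<Rightarrow> real"
  assumes "(H has_derivative D) (at (P + s0 *\<^sub>R w) within S)" and "\<And>s. P + s *\<^sub>R w \<in> S"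
  shows "((\<lambda>s. H (P + s *\<^sub>R w)) has_real_derivative D w) (at s0)"
proof -
  have dl: "((\<lambda>s. P + s *\<^sub>R w) has_derivative (\<lambda>s. s *\<^sub>R w)) (at s0)"
    by (auto intro!: derivative_eq_intros)
  have "(H has_derivative D) (at (P + s0 *\<^sub>R w) within range (\<lambda>s. P + s *\<^sub>R w))"
    using assms by (meson has_derivative_subset image_subsetI)
  from has_derivative_in_compose[OF dl this]
  have "((\<lambda>s. H (P + s *\<^sub>R w)) has_derivative (\<lambda>s. D (s *\<^sub>R w))) (at s0)" by simp
  moreover have "D (s *\<^sub>R w) = s * D w" for s
    using has_derivative_linear[OF assms(1)] by (simp add: linear_cmul)
  ultimately show ?thesis by (simp add: has_field_derivative_def mult.commute[of _ "D w"])
qed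

lemma lipschitz_derivative_bound:
  fixes H :: "'a::real_normed_vector \<Rightarrow> real"
  assumes D: "(H has_derivative D) (at P within S)" and S: "\<And>s. P + s *\<^sub>R w \<in> S"
      and L: "L-lipschitz_on S H"
  shows "\<bar>D w\<bar> \<le> L * norm w"
proof -
  have "((\<lambda>s. H (P + s *\<^sub>R w)) has_real_derivative D w) (at 0)"
    by (rule has_derivative_along_line[where S=S]) (use D S in auto)
  then have "((\<lambda>s. (H (P + s *\<^sub>R w) - H P) / s) \<longlongrightarrow> D w) (at 0)"
    by (simp add: DERIV_def)
  then have lim: "((\<lambda>s. \<bar>(H (P + s *\<^sub>R w) - H P) / s\<bar>) \<longlongrightarrow> \<bar>D w\<bar>) (at 0)"
    by (rule tendsto_rabs)
  have "\<bar>(H (P + s *\<^sub>R w) - H P) / s\<bar> \<le> L * norm w" if "s \<noteq> 0" for s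
  proof -
    have "\<bar>H (P + s *\<^sub>R w) - H P\<bar> \<le> L * norm (s *\<^sub>R w)"
      using lipschitz_onD[OF L S[of s], of P] S[of 0] by (simp add: dist_norm)
    then show ?thesis using that by (simp add: field_simps)
  qed
  then have "\<forall>\<^sub>F s in at 0. \<bar>(H (P + s *\<^sub>R w) - H P) / s\<bar> \<le> L * norm w"
    by (auto simp: eventually_at intro!: exI[of _ 1])
  from tendsto_upperbound[OF lim this] show ?thesis by simp
qed

lemma transpose_add: "transpose (A + B) = transpose A + transpose (B :: real^'n^'m)"
  by (simp add: transpose_def vec_eq_iff)

lemma linear_transpose: "linear (transpose :: real^'n^'m \<Rightarrow> _)"
  by (intro linearI) (simp_all add: transpose_add transpose_scalar)

text \<open>A derivative within \<open>sym_mats\<close> carries no information in nonsymmetric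
  directions. Composed with symmetrisation it becomes a functional that still equals
  \<open>D\<close> on symmetric directions and is represented by a symmetric matrix.\<close>

lemma is_G_gamma_exists:
  assumes D: "(f has_derivative D) (at \<gamma> within sym_mats)" and g: "\<gamma> \<in> sym_mats"
  obtains A where "is_G_gamma f \<gamma> A" "\<And>\<eta>. \<eta> \<in> sym_mats \<Longrightarrow> A \<bullet> \<eta> = D \<eta>"
proof -
  define l where "l \<eta> = D ((1 / 2) *\<^sub>R (\<eta> + transpose \<eta>))" for \<eta>
  have linD: "linear D" by (rule has_derivative_linear[OF D])
  have "linear (\<lambda>\<eta>::real^'n^'n. (1 / 2) *\<^sub>R (\<eta> + transpose \<eta>))"
    by (intro linearI) (simp_all add: transpose_add transpose_scalar scaleR_add_right)
  then have "linear l" unfolding l_def using linear_compose[OF _ linD] by (simp add: o_def)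
  \<comment> \<open>The Riesz representative of the real functional \<open>l\<close> is the image of
    1 under its adjoint.\<close>
  define A where "A = adjoint l 1"
  have A: "A \<bullet> \<eta> = l \<eta>" for \<eta>
    using adjoint_works[OF \<open>linear l\<close>, of \<eta> 1] by (simp add: A_def inner_commute)
  have "transpose A \<bullet> \<eta> = A \<bullet> \<eta>" for \<eta>
    using A[of "transpose \<eta>"] inner_transpose[of A "transpose \<eta>"]
    by (simp add: A l_def add.commute)
  then have sym: "A \<in> sym_mats"
    by (metis (mono_tags, lifting) mem_Collect_eq sym_mats_def vector_eq_rdot)
  have AD: "A \<bullet> \<eta> = D \<eta>" if "\<eta> \<in> sym_mats" for \<eta>
  proof -
    have "(1 / 2) *\<^sub>R (\<eta> + transpose \<eta>) = \<eta>"
      using that by (simp add: sym_mats_def flip: scaleR_2)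
    then show ?thesis by (simp add: A l_def)
  qed
  have "(f has_derivative (\<lambda>\<eta>. A \<bullet> \<eta>)) (at \<gamma> within sym_mats)"
    unfolding has_derivative_within
  proof (intro conjI bounded_linear_inner_right)
    have "((\<lambda>y. (1 / norm (y - \<gamma>)) *\<^sub>R (f y - (f \<gamma> + D (y - \<gamma>)))) \<longlongrightarrow> 0) (at \<gamma> within sym_mats)"
      using D by (simp add: has_derivative_within)
    moreover have "A \<bullet> (y - \<gamma>) = D (y - \<gamma>)" if "y \<in> sym_mats" for y
      using AD subspace_diff[OF sym_mats_subspace that g] by simp
    then have "\<forall>\<^sub>F y in at \<gamma> within sym_mats.
      (1 / norm (y - \<gamma>)) *\<^sub>R (f y - (f \<gamma> + D (y - \<gamma>))) =
          (1 / norm (y - \<gamma>)) *\<^sub>R (f y - (f \<gamma> + A \<bullet> (y - \<gamma>)))"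
      by (auto simp: eventually_at intro!: exI[of _ 1])
    ultimately show "((\<lambda>y. (1 / norm (y - \<gamma>)) *\<^sub>R (f y - (f \<gamma> + A \<bullet> (y -
        \<gamma>)))) \<longlongrightarrow> 0) (at \<gamma> within sym_mats)"
      by (rule Lim_transform_eventually)
  qed
  then have "is_G_gamma f \<gamma> A" using sym by (auto simp: is_G_gamma_def)
  then show ?thesis using AD that by blast
qed

text \<open>Monotonicity rests on a mean value argument in (y, z, \<gamma>) at once, hence on the
  joint derivative. Its \<gamma>-part has to be identified with \<open>G_gamma\<close>, the object
  that \<open>assumption_M\<close> speaks about.\<close>

lemma nonlinearity_derivative:
  fixes G :: "'n::finite nonlinearity"
  assumes "differentiable_nonlinearity T G" "assumption_S2 T L G g" "t \<in> {0..T}" "\<gamma> \<in> sym_mats"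
  obtains D where "((\<lambda>(y, z, \<gamma>). G t x y z \<gamma>) has_derivative D) (at (y, z,
      \<gamma>) within UNIV \<times> UNIV \<times> sym_mats)"
    "\<And>y' z' \<gamma>'. \<gamma>' \<in> sym_mats \<Longrightarrow> \<bar>D (y', z', \<gamma>')\<bar> \<le> L * norm (y', z', \<gamma>')"
    "\<And>\<eta>. \<eta> \<in> sym_mats \<Longrightarrow> D (0, 0, \<eta>) = G_gamma G t x y z \<gamma> \<bullet> \<eta>"
    "G_gamma G t x y z \<gamma> \<in> sym_mats" "norm (G_gamma G t x y z \<gamma>) \<le> L"
proof -
  let ?H = "\<lambda>(y, z, \<gamma>). G t x y z \<gamma>" and ?S = "UNIV \<times> UNIV \<times> sym_mats"
  have "?H differentiable (at (y, z, \<gamma>) within ?S)"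
    using assms(1,3,4) unfolding differentiable_nonlinearity_def by blast
  then obtain D where D: "(?H has_derivative D) (at (y, z, \<gamma>) within ?S)"
    unfolding differentiable_def by blast
  have "L-lipschitz_on (UNIV \<times> UNIV \<times> UNIV \<times> sym_mats) (\<lambda>(x, y, z, \<gamma>). G t x y z \<gamma>)"
    using assms by (auto simp: assumption_S2_def)
  note Lip = this
  have lip: "L-lipschitz_on ?S ?H"
  proof (rule lipschitz_onI[OF _ lipschitz_on_nonneg[OF Lip]])
    fix P Q :: "real \<times> (real^'n) \<times> (real^'n^'n)" assume "P \<in> ?S" "Q \<in> ?S"
    then show "dist (?H P) (?H Q) \<le> L * dist P Q"
      using lipschitz_onD[OF Lip, of "(x, P)" "(x, Q)"]
          by (auto simp: dist_Pair_Pair split: prod.splits)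
  qed
  have bound: "\<bar>D (y', z', \<gamma>')\<bar> \<le> L * norm (y', z', \<gamma>')" if "\<gamma>' \<in> sym_mats" for y' z' \<gamma>'
    by (rule lipschitz_derivative_bound[OF D _ lip])
       (use that assms(4) in \<open>auto intro!: subspace_add[OF sym_mats_subspace] subspace_scale[OF
           sym_mats_subspace]\<close>)
  have "((\<lambda>\<gamma>. (y, z, \<gamma>)) has_derivative (\<lambda>\<eta>. (0, 0, \<eta>))) (at \<gamma> within sym_mats)"
    by (auto intro!: derivative_eq_intros)
  from has_derivative_in_compose[OF this, of ?H D]
  have "(G t x y z has_derivative (\<lambda>\<eta>. D (0, 0, \<eta>))) (at \<gamma> within sym_mats)"
    using has_derivative_subset[OF D, of "(\<lambda>\<gamma>. (y, z, \<gamma>)) ` sym_mats"] by auto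
  then obtain A where A: "is_G_gamma (G t x y z) \<gamma> A" "\<And>\<eta>. \<eta> \<in> sym_mats \<Longrightarrow> A \<bullet> \<eta> = D (0, 0, \<eta>)"
    by (rule is_G_gamma_exists[OF _ assms(4)]) blast
  have GA: "G_gamma G t x y z \<gamma> = A" using A(1) by (intro G_gamma_unique[OF assms(4)])
  have symA: "A \<in> sym_mats" using A(1) by (simp add: is_G_gamma_def)
  \<comment> \<open>Testing the derivative on its own representative turns the Lipschitz bound into
    |A|^2 \<le> L |A|.\<close>
  have "norm A * norm A = D (0, 0, A)" using A(2)[OF symA]
      by (simp add: dot_square_norm power2_eq_square)
  also have "\<dots> \<le> L * norm A" using bound[OF symA, of 0 0] by (simp add: norm_Pair)
  finally have "norm A \<le> L \<or> norm A \<le> 0" by (metis mult_right_le_imp_le not_less)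
  moreover have "0 \<le> L" using lip by (simp add: lipschitz_on_def)
  ultimately have "norm A \<le> L" by linarith
  then show ?thesis using that[OF D bound] A(2) GA symA by simp
qed

section \<open>Positivity of the weight\<close>

lemma diag_part_le_mat:
  assumes "\<And>i. (A::real^'n^'n)$i$i \<le> b"
  shows "diag_part A \<preceq> mat b"
proof -
  have "v \<bullet> ((mat b - diag_part A) *v v) = (\<Sum>i\<in>UNIV. (b - A$i$i) * (v$i)\<^sup>2)" for v
  proof -
    have "mat b - diag_part A = diag_part (mat b - A)" by (simp add: vec_eq_iff diag_part_def mat_def)
    then show ?thesis by (simp add: quad_diag_part) (simp add: mat_def)
  qed
  then show ?thesis using assms by (simp add: mat_le_def sum_nonneg)
qed

lemma mat_le_diag: "A \<preceq> B \<Longrightarrow> (A::real^'n^'n)$i$i \<le> B$i$i"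
proof -
  have "axis i 1 \<bullet> ((B - A) *v axis i 1) = B$i$i - A$i$i"
    by (simp add: inner_axis' matrix_vector_mult_basis column_def)
  then show "A \<preceq> B \<Longrightarrow> A$i$i \<le> B$i$i" unfolding mat_le_def by (metis diff_ge_0_iff_ge)
qed

text \<open>Conjugation with \<sigma>^-1 turns a0 into the identity and \<open>G_gamma\<close> into
  \<open>G_tilde\<close>. The weight is thereby expressed through \<open>kern2\<close> and the
  matrix whose bounds are \<alpha>, \<beta> and \<theta>.\<close>

lemma weight_eq:
  assumes "invertible \<sigma>" "h \<noteq> 0" "p < 1"
  shows "h * (\<Gamma> \<bullet> K2 \<sigma> p h \<xi> - 1 / 2 * ((\<sigma> ** transpose \<sigma>) \<bullet> K2 \<sigma> p h \<xi>)) =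
    (matrix_inv \<sigma> ** \<Gamma> ** transpose (matrix_inv \<sigma>)) \<bullet> kern2 p \<xi> - 1 / 2 * (mat 1 \<bullet> kern2 p \<xi>)"
proof -
  let ?M = "matrix_inv \<sigma>"
  have X: "h * (X \<bullet> K2 \<sigma> p h \<xi>) = (?M ** X ** transpose ?M) \<bullet> kern2 p \<xi>" for X
  proof -
    have "X \<bullet> (transpose ?M ** kern2 p \<xi> ** ?M) = (X ** transpose ?M) \<bullet> (transpose ?M ** kern2 p \<xi>)"
      by (rule inner_matrix_mult_right)
    also have "\<dots> = (?M ** X ** transpose ?M) \<bullet> kern2 p \<xi>"
      by (simp only: inner_matrix_mult_left transpose_transpose matrix_mul_assoc)
    finally show ?thesis using assms(2) by (simp add: K2_eq_kern2)
  qed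
  have "?M ** (\<sigma> ** transpose \<sigma>) ** transpose ?M = (?M ** \<sigma>) ** (transpose \<sigma> ** transpose ?M)"
    by (simp add: matrix_mul_assoc)
  also have "\<dots> = mat 1" by (simp only: inverse_matrix[OF assms(1)] matrix_mul_lid)
  finally show ?thesis using X[of \<Gamma>] X[of "\<sigma> ** transpose \<sigma>"] by (simp add: right_diff_distrib)
qed

lemma inner_kern2:
  fixes A :: "real^'n^'n"
  assumes "p < 1"
  shows "(1 - p) * (A \<bullet> kern2 p \<xi>) =
    (1 - p) * (\<xi> \<bullet> (A *v \<xi>)) - (1 - 3 * p) * (\<Sum>i\<in>UNIV. A$i$i * (\<xi>$i)\<^sup>2) - 2 * p * (\<Sum>i\<in>UNIV. A$i$i)"
  using assms by (simp add: kern2_def inner_diff_right inner_outer inner_diag_part inner_mat_1)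
    (simp add: outer_def power2_eq_square)

text \<open>The bound is proved coordinate by coordinate:
    where \<open>\<xi>\<close> vanishes it uses \<open>A $ i $ i \<le> \<beta>\<close>, elsewhere
  \<open>\<alpha> \<le> A $ i $ i\<close> together with \<open>ap \<ge> 2 p\<close>; the choice of \<open>c\<close> makes the two values equal.\<close>

lemma weight_lower_bound:
  fixes A :: "real^'n^'n"
  assumes p: "0 < p" "p \<le> 1 / 3" "\<theta> / (2 * (1 + \<theta>)) \<le> p" and \<theta>: "0 \<le> \<theta>"
    and \<xi>: "\<xi> \<in> set_pmf (xi_pmf p)"
    and diag: "\<And>i. \<alpha> \<le> A$i$i" "\<And>i. A$i$i \<le> \<beta>" and quad: "diag_part A \<preceq> (1 + \<theta>) *\<^sub>R A"
    and ap: "ap = (p * (2 + 3 * \<theta>) - \<theta>) / (p * (1 + \<theta>))"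
    and c: "c\<^sup>2 = 2 * p * (\<beta> / \<alpha>) + ap - 2 * p" "0 < c" "\<alpha> = 1 / c\<^sup>2"
  shows "((1 - p + p * real CARD('n)) * c - 2 * p * real CARD('n) * (\<beta> / \<alpha>) / c) / c
    \<le> (1 - p) * (1 + A \<bullet> kern2 p \<xi> - 1 / 2 * (mat 1 \<bullet> kern2 p \<xi>))"
proof -
  let ?d = "real CARD('n)"
  define q where "q i = (\<xi>$i)\<^sup>2" for i
  have p1: "p < 1" using p by simp
  have q: "q i = 0 \<or> q i = 1 / p" for i using set_xi_pmf_sq[OF p(1) p1 \<xi>] by (simp add: q_def)
  \<comment> \<open>Evaluated at \<xi> itself, \<open>quad\<close> bounds the full quadratic form
    below by its diagonal part; after this the estimate splits over the coordinates.\<close>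
  have "0 \<le> \<xi> \<bullet> (((1 + \<theta>) *\<^sub>R A - diag_part A) *v \<xi>)" using quad by (simp add: mat_le_def)
  then have "(\<Sum>i\<in>UNIV. A$i$i * q i) \<le> (1 + \<theta>) * (\<xi> \<bullet> (A *v \<xi>))"
    by (simp add: matrix_vector_mult_diff_rdistrib inner_diff_right quad_diag_part q_def flip:
      scaleR_matrix_vector_assoc)
  then have "(\<Sum>i\<in>UNIV. A$i$i * q i) / (1 + \<theta>) \<le> \<xi> \<bullet> (A *v \<xi>)"
    using \<theta> by (simp add: pos_divide_le_eq mult.commute)
  then have "(1 - p) * ((\<Sum>i\<in>UNIV. A$i$i * q i) / (1 + \<theta>)) \<le> (1 - p) * (\<xi> \<bullet> (A *v \<xi>))"
    using p1 by (intro mult_left_mono) auto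
  moreover have "p * ap = (p * (2 + 3 * \<theta>) - \<theta>) / (1 + \<theta>)"
    using p by (simp add: ap)
  \<comment> \<open>Origin of \<open>ap\<close>: up to the factor p it is the net coefficient of the
    diagonal sum, once the diagonal correction 1 - 3 p of the kernel is subtracted.\<close>
  then have "(1 - p) / (1 + \<theta>) - (1 - 3 * p) = p * ap"
    using \<theta> by (simp add: field_simps)
  then have "(1 - p) * (S / (1 + \<theta>)) - (1 - 3 * p) * S = p * ap * S" for S
    by (metis (no_types, opaque_lifting) left_diff_distrib mult.commute times_divide_eq_right)
  ultimately have A: "p * ap * (\<Sum>i\<in>UNIV. A$i$i * q i) - 2 * p * (\<Sum>i\<in>UNIV. A$i$i) \<le>
      (1 - p) * (A \<bullet> kern2 p \<xi>)"
    by (simp add: inner_kern2[OF p1] q_def) (smt (verit))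
  have I: "(1 - p) * (1 / 2 * (mat 1 \<bullet> kern2 p \<xi>)) = p * (\<Sum>i\<in>UNIV. q i) - p * ?d"
    using inner_kern2[OF p1, of "mat 1" \<xi>] by (simp add: q_def) (simp add: mat_def inner_vec_def
        power2_eq_square algebra_simps)
  have summand: "- (2 * p * (\<beta> / \<alpha>) / c\<^sup>2) \<le> p * ap * (A$i$i * q i) - 2 * p * A$i$i - p * q i" for i
  proof -
    have \<alpha>: "0 < \<alpha>" using c by simp
    have b: "2 * p * (\<beta> / \<alpha>) / c\<^sup>2 = 2 * p * \<beta>" using \<alpha> c(3) by (simp add: field_simps)
    \<comment> \<open>The factorisation shows that \<open>ap\<close> \<ge> 2 p is exactly the lower
      bound \<theta> / (2 (1 + \<theta>)) imposed on p.\<close>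
    have "ap - 2 * p = (2 * (1 + \<theta>) * p - \<theta>) * (1 - p) / (p * (1 + \<theta>))"
    proof -
      have "p * (1 + \<theta>) \<noteq> 0" using p \<theta> by simp
      then have "ap - 2 * p = ((p * (2 + 3 * \<theta>) - \<theta>) - 2 * p * (p * (1 + \<theta>))) / (p * (1 + \<theta>))"
        unfolding ap diff_divide_distrib by simp
      also have "(p * (2 + 3 * \<theta>) - \<theta>) - 2 * p * (p * (1 + \<theta>)) = (2 * (1 + \<theta>) * p - \<theta>) * (1 - p)"
        by (simp add: algebra_simps)
      finally show ?thesis .
    qed
    moreover have "0 \<le> 2 * (1 + \<theta>) * p - \<theta>" using p(3) \<theta> by (simp add: field_simps)
    ultimately have ap0: "0 \<le> ap - 2 * p" using p1 p \<theta> by simp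
    from q[of i] show ?thesis
    proof
      assume "q i = 0"
      moreover have "2 * p * A$i$i \<le> 2 * p * \<beta>" using p diag(2)[of i] by (intro mult_left_mono) auto
      ultimately show ?thesis unfolding b by simp
    next
      assume qi: "q i = 1 / p"
      have "(ap - 2 * p) * \<alpha> \<le> (ap - 2 * p) * A$i$i"
        using ap0 diag(1)[of i] by (rule mult_left_mono[rotated])
      moreover have "(ap - 2 * p) * \<alpha> - 1 = - (2 * p * (\<beta> / \<alpha>) / c\<^sup>2)"
      proof -
        have "ap - 2 * p = c\<^sup>2 - 2 * p * (\<beta> / \<alpha>)" using c(1) by simp
        then have "(ap - 2 * p) * \<alpha> = (c\<^sup>2 - 2 * p * (\<beta> / \<alpha>)) / c\<^sup>2" using c(3) by simp
        then show ?thesis using c(2) by (simp add: diff_divide_distrib)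
      qed
      ultimately show ?thesis using p qi by (simp add: algebra_simps)
    qed
  qed
  have "((1 - p + p * ?d) * c - 2 * p * ?d * (\<beta> / \<alpha>) / c) / c =
      1 - p + p * ?d + (\<Sum>i\<in>(UNIV::'n set). - (2 * p * (\<beta> / \<alpha>) / c\<^sup>2))"
    using c(2) by (simp add: diff_divide_distrib power2_eq_square mult_ac)
  also have "\<dots> \<le> 1 - p + p * ?d + (\<Sum>i\<in>UNIV. p * ap * (A$i$i * q i) - 2 * p * A$i$i - p * q i)"
    by (intro add_left_mono sum_mono summand)
  also have "\<dots> = 1 - p + (p * ap * (\<Sum>i\<in>UNIV. A$i$i * q i) - 2 * p * (\<Sum>i\<in>UNIV. A$i$i)) -
      (p * (\<Sum>i\<in>UNIV. q i) - p * ?d)"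
    by (simp add: sum_subtractf sum_distrib_left)
  also have "\<dots> \<le> (1 - p) + (1 - p) * (A \<bullet> kern2 p \<xi>) - (1 - p) * (1 / 2 * (mat 1 \<bullet> kern2 p \<xi>))"
    unfolding I using A by linarith
  also have "\<dots> = (1 - p) * (1 + A \<bullet> kern2 p \<xi> - 1 / 2 * (mat 1 \<bullet> kern2 p \<xi>))"
    by (simp add: algebra_simps)
  finally show ?thesis .
qed

text \<open>The preceding bound needs \<alpha>, \<beta>, \<theta> as real numbers satisfying their
  own defining inequalities. Most of the work is to show that the suprema and infima in the extended
  reals are finite and attained.\<close>

lemma weight_bound:
  fixes G :: "'n::finite nonlinearity"
  assumes st: "standing_assumptions T B L G g" and M: "assumption_M T K G \<sigma>0 p"
      and ls: "lambda_star T G \<sigma>0 = ereal lam"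
    and t: "t \<in> {0..T}" and \<gamma>: "\<gamma> \<in> sym_mats" and h: "0 < h" and \<xi>: "\<xi> \<in> set_pmf (xi_pmf (p t x))"
  shows "lam / 2 * (norm (matrix_inv (\<sigma>0 t x)) / sqrt (p t x)) \<le>
    1 + h * (G_gamma G t x y z \<gamma> \<bullet> K2 (\<sigma>0 t x) (p t x) h \<xi>
      - 1 / 2 * ((\<sigma>0 t x ** transpose (\<sigma>0 t x)) \<bullet> K2 (\<sigma>0 t x) (p t x) h \<xi>))"
proof -
  let ?s = "\<sigma>0 t x" and ?p = "p t x" and ?d = "real CARD('n)"
  let ?A = "\<lambda>y z \<gamma>. G_tilde G \<sigma>0 t x y z \<gamma>"
  have sd: "scheme_data T K \<sigma>0 p" and M1: "assumption_M1 T G \<sigma>0" and M2: "assumption_M2 T G \<sigma>0 p"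
    using M by (auto simp: assumption_M_def)
  have inv: "invertible ?s" and nK: "norm (matrix_inv ?s) \<le> K"
    using sd t by (auto simp: scheme_data_def)
  have pr: "?p \<in> p_range G \<sigma>0 t x" and lp: "lambda_star T G \<sigma>0 / 2 \<le> ereal (lambda_p G \<sigma>0 t x ?p)"
    and al: "alpha_low G \<sigma>0 t x = ereal (1 / (c_p G \<sigma>0 t x ?p)\<^sup>2)"
    using M2 t by (auto simp: assumption_M2_def)
  have th2: "theta G \<sigma>0 t x \<le> 2" using M1 t by (auto simp: assumption_M1_def)
  have dG: "differentiable_nonlinearity T G" and S2: "assumption_S2 T L G g"
    using st by (auto simp: standing_assumptions_def)
  have nm: "0 < norm (matrix_inv ?s)"
    using norm_matrix_ge_1_inverse[OF inv] by (cases "norm (matrix_inv ?s) = 0") auto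
  define c where "c = c_p G \<sigma>0 t x ?p"
  define \<alpha> where "\<alpha> = 1 / c\<^sup>2"
  have al: "alpha_low G \<sigma>0 t x = ereal \<alpha>" using al by (simp add: c_def \<alpha>_def)
  \<comment> \<open>Adding 1 makes the bound strictly positive, as membership in the set defining
    \<open>alpha_up\<close> demands.\<close>
  define \<Gamma>bd where "\<Gamma>bd = K * \<bar>L\<bar> * K + 1"
  have K0: "0 \<le> K" using nm nK by linarith
  have entry: "\<bar>?A y z \<gamma> $ i $ j\<bar> \<le> K * \<bar>L\<bar> * K" if "\<gamma> \<in> sym_mats" for y z \<gamma> i j
  proof -
    have "\<bar>?A y z \<gamma> $ i $ j\<bar> \<le> norm (?A y z \<gamma>)"
      by (rule order_trans[OF component_le_norm_cart Finite_Cartesian_Product.norm_nth_le])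
    also have "\<dots> \<le> norm (matrix_inv ?s ** G_gamma G t x y z \<gamma>) * norm (transpose (matrix_inv ?s))"
      unfolding G_tilde_def by (rule norm_matrix_mult_le)
    also have "\<dots> \<le> norm (matrix_inv ?s) * norm (G_gamma G t x y z \<gamma>) * norm (matrix_inv ?s)"
      by (simp add: norm_transpose norm_matrix_mult_le mult_right_mono)
    also have "\<dots> \<le> K * \<bar>L\<bar> * K"
    proof -
      have "norm (G_gamma G t x y z \<gamma>) \<le> L"
        by (rule nonlinearity_derivative[OF dG S2 t that, of x y z])
      then show ?thesis using nK K0 by (intro mult_mono) auto
    qed
    finally show ?thesis .
  qed
  have low_pos: "0 < \<alpha>"
  proof -
    let ?S = "{ereal \<alpha> | \<alpha>. 0 < \<alpha> \<and> (\<forall>y z. \<forall>\<gamma>\<in>sym_mats. mat \<alpha> \<preceq> diag_part (?A y z \<gamma>))}"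
    have S: "Sup ?S = ereal \<alpha>" using al by (simp add: alpha_low_def)
    \<comment> \<open>The supremum of the empty set is minus infinity, contrary to the real value
      prescribed by \<open>assumption_M2\<close>.\<close>
    have "?S \<noteq> {}"
    proof
      assume "?S = {}"
      from S[unfolded this] show False by (simp add: bot_ereal_def)
    qed
    then obtain a where "0 < a" "ereal a \<in> ?S" by auto
    then have "ereal a \<le> ereal \<alpha>" unfolding S[symmetric] by (intro Sup_upper)
    then show ?thesis using \<open>0 < a\<close> by simp
  qed
  have low: "\<alpha> \<le> ?A y z \<gamma> $ i $ i" if "\<gamma> \<in> sym_mats" for y z \<gamma> i
  proof -
    have "alpha_low G \<sigma>0 t x \<le> ereal (?A y z \<gamma> $ i $ i)"
      unfolding alpha_low_def
    proof (rule Sup_least, clarsimp)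
      fix a assume "\<forall>y z. \<forall>\<gamma>\<in>sym_mats. mat a \<preceq> diag_part (?A y z \<gamma>)"
      then have "(mat a :: real^'n^'n) $ i $ i \<le> diag_part (?A y z \<gamma>) $ i $ i" using that
          by (intro mat_le_diag) auto
      then show "a \<le> ?A y z \<gamma> $ i $ i" by (simp add: mat_def diag_part_def)
    qed
    then show ?thesis by (simp add: al)
  qed
  let ?U = "{ereal \<alpha> | \<alpha>. 0 < \<alpha> \<and> (\<forall>y z. \<forall>\<gamma>\<in>sym_mats. diag_part (?A y z \<gamma>) \<preceq> mat \<alpha>)}"
  have "alpha_up G \<sigma>0 t x \<le> ereal \<Gamma>bd"
    unfolding alpha_up_def
  proof (rule Inf_lower, clarsimp, intro conjI allI ballI diag_part_le_mat)
    show "0 < \<Gamma>bd" using K0 by (simp add: \<Gamma>bd_def add_nonneg_pos)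
    show "?A y z \<gamma> $ i $ i \<le> \<Gamma>bd" if "\<gamma> \<in> sym_mats" for y z \<gamma> i
      using entry[OF that, of y z i i] by (simp add: \<Gamma>bd_def)
  qed
  moreover have "0 \<le> alpha_up G \<sigma>0 t x"
    unfolding alpha_up_def by (rule Inf_greatest) auto
  ultimately obtain \<beta> where au: "alpha_up G \<sigma>0 t x = ereal \<beta>" and \<beta>0: "0 \<le> \<beta>"
    by (cases "alpha_up G \<sigma>0 t x") auto
  have up: "?A y z \<gamma> $ i $ i \<le> \<beta>" if "\<gamma> \<in> sym_mats" for y z \<gamma> i
  proof -
    have "ereal (?A y z \<gamma> $ i $ i) \<le> alpha_up G \<sigma>0 t x"
      unfolding alpha_up_def
    proof (rule Inf_greatest, clarsimp)
      fix a assume "\<forall>y z. \<forall>\<gamma>\<in>sym_mats. diag_part (?A y z \<gamma>) \<preceq> mat a"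
      then have "diag_part (?A y z \<gamma>) $ i $ i \<le> (mat a :: real^'n^'n) $ i $ i" using that
          by (intro mat_le_diag) auto
      then show "?A y z \<gamma> $ i $ i \<le> a" by (simp add: mat_def diag_part_def)
    qed
    then show ?thesis by (simp add: au)
  qed
  let ?Th = "{ereal \<theta> | \<theta>. 0 \<le> \<theta> \<and> (\<forall>y z. \<forall>\<gamma>\<in>sym_mats. diag_part (?A y z \<gamma>) \<preceq> (1 + \<theta>) *\<^sub>R ?A y z \<gamma>)}"
  have "0 \<le> theta G \<sigma>0 t x" unfolding theta_def by (rule Inf_greatest) auto
  then obtain \<theta> where th: "theta G \<sigma>0 t x = ereal \<theta>" and \<theta>0: "0 \<le> \<theta>"
    using th2 by (cases "theta G \<sigma>0 t x") auto
  have "?Th \<noteq> {}"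
  proof
    assume "?Th = {}"
    from th[unfolded theta_def this] show False by (simp add: top_ereal_def)
  qed
  then obtain \<theta>1 where \<theta>1: "0 \<le> \<theta>1" "\<And>y z \<gamma>. \<gamma> \<in> sym_mats \<Longrightarrow>
      diag_part (?A y z \<gamma>) \<preceq> (1 + \<theta>1) *\<^sub>R ?A y z \<gamma>"
    by auto
  have quad: "diag_part (?A y z \<gamma>) \<preceq> (1 + \<theta>) *\<^sub>R ?A y z \<gamma>" if "\<gamma> \<in> sym_mats" for y z \<gamma>
    unfolding mat_le_def
  proof
    fix v
    define q where "q = v \<bullet> (?A y z \<gamma> *v v)"
    define e where "e = v \<bullet> (diag_part (?A y z \<gamma>) *v v)"
    have eq: "v \<bullet> (((1 + \<theta>) *\<^sub>R ?A y z \<gamma> - diag_part (?A y z \<gamma>)) *v v) = (1 + \<theta>) * q - e" for \<theta>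
      by (simp add: q_def e_def matrix_vector_mult_diff_rdistrib inner_diff_right flip:
        scaleR_matrix_vector_assoc)
    have le: "e \<le> (1 + \<theta>') * q" if "diag_part (?A y z \<gamma>) \<preceq> (1 + \<theta>') *\<^sub>R ?A y z \<gamma>" for \<theta>'
      using that eq[of \<theta>'] unfolding mat_le_def by (metis diff_ge_0_iff_ge)
    have e0: "0 \<le> e"
      unfolding e_def quad_diag_part using low[OF that, of y z] low_pos
          by (intro sum_nonneg mult_nonneg_nonneg) (auto intro: order_trans less_imp_le)
    then have "0 \<le> (1 + \<theta>1) * q" using le[OF \<theta>1(2)[OF that]] by linarith
    then have q0: "0 \<le> q" using \<theta>1(1) by (simp add: zero_le_mult_iff)
    \<comment> \<open>The infimum is attained: for q > 0 the number e / q - 1 lies below every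
      admissible value, and for q = 0 a single admissible value already forces e \<le> 0.\<close>
    have "e \<le> (1 + \<theta>) * q"
    proof (cases "q = 0")
      case True
      then show ?thesis using le[OF \<theta>1(2)[OF that]] by simp
    next
      case False
      then have q0: "0 < q" using q0 by simp
      have "ereal (e / q - 1) \<le> theta G \<sigma>0 t x"
        unfolding theta_def
      proof (rule Inf_greatest, clarsimp)
        fix \<theta>' assume "\<forall>y z. \<forall>\<gamma>\<in>sym_mats. diag_part (?A y z \<gamma>) \<preceq> (1 + \<theta>') *\<^sub>R ?A y z \<gamma>"
        then have "e \<le> (1 + \<theta>') * q" using that by (intro le) auto
        then show "e / q - 1 \<le> \<theta>'" using q0 by (simp add: field_simps)
      qed
      then show ?thesis using q0 th by (simp add: field_simps)
    qed
    then show "0 \<le> v \<bullet> (((1 + \<theta>) *\<^sub>R ?A y z \<gamma> - diag_part (?A y z \<gamma>)) *v v)" using eq[of \<theta>] by simp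
  qed
  have p: "0 < ?p" "?p \<le> 1 / 3" "\<theta> / (2 * (1 + \<theta>)) \<le> ?p"
    using pr th by (auto simp: p_range_def Let_def)
  then have p1: "?p < 1" by simp
  have Lam: "Lambda G \<sigma>0 t x = \<beta> / \<alpha>" by (simp add: Lambda_def au al)
  define ap where "ap = (?p * (2 + 3 * \<theta>) - \<theta>) / (?p * (1 + \<theta>))"
  have ap: "alpha_p G \<sigma>0 t x ?p = ap" by (simp add: alpha_p_def th ap_def Let_def)
  have "c \<noteq> 0" using low_pos by (auto simp: \<alpha>_def)
  have c_sqrt: "c = sqrt (2 * ?p * (\<beta> / \<alpha>) + ap - 2 * ?p)" by (simp add: c_def c_p_def Lam ap)
  \<comment> \<open>\<open>sqrt\<close> is negative on negative arguments, so c^2 equals the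
    radicand only once the latter is known to be nonnegative. This follows from \<beta> \<ge>
    \<alpha> and from the lower bound on p.\<close>
  have rad: "0 \<le> 2 * ?p * (\<beta> / \<alpha>) + ap - 2 * ?p"
  proof -
    have "\<alpha> \<le> \<beta>" using order_trans[OF low[OF \<gamma>] up[OF \<gamma>]] by blast
    then have "1 \<le> \<beta> / \<alpha>" using low_pos by simp
    then have "2 * ?p * 1 \<le> 2 * ?p * (\<beta> / \<alpha>)" using p by (intro mult_left_mono) auto
    moreover have "0 \<le> ap"
    proof -
      have "\<theta> \<le> ?p * (2 * (1 + \<theta>))" using p(3) \<theta>0 by (simp add: pos_divide_le_eq)
      also have "\<dots> \<le> ?p * (2 + 3 * \<theta>)" using p \<theta>0 by (intro mult_left_mono) auto
      finally show ?thesis using p \<theta>0 by (simp add: ap_def)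
    qed
    ultimately show ?thesis by linarith
  qed
  have c: "c\<^sup>2 = 2 * ?p * (\<beta> / \<alpha>) + ap - 2 * ?p" "0 < c"
    using c_sqrt rad \<open>c \<noteq> 0\<close> by (simp_all add: less_le)
  define W where "W = ((1 - ?p + ?p * ?d) * c - 2 * ?p * ?d * (\<beta> / \<alpha>) / c) / c"
  have lb: "W \<le> (1 - ?p) * (1 + ?A y z \<gamma> \<bullet> kern2 ?p \<xi> - 1 / 2 * (mat 1 \<bullet> kern2 ?p \<xi>))"
    unfolding W_def
    by (rule weight_lower_bound[OF p \<theta>0 \<xi> low[OF \<gamma>] up[OF \<gamma>] quad[OF \<gamma>] ap_def c \<alpha>_def])
  \<comment> \<open>Since \<alpha> = 1 / c^2, the factor sqrt \<alpha> in \<open>lambda_p\<close> is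
    the division by c that \<open>W\<close> carries.\<close>
  have lW: "lambda_p G \<sigma>0 t x ?p = sqrt ?p * W / norm (matrix_inv ?s)"
    using c(2) by (simp add: lambda_p_def Let_def Lam al \<alpha>_def W_def real_sqrt_divide flip: c_def)
  have "lam / 2 \<le> sqrt ?p * W / norm (matrix_inv ?s)"
    using lp ls lW by simp
  then have lW': "lam / 2 * (norm (matrix_inv ?s) / sqrt ?p) \<le> W"
    using nm p by (simp add: field_simps)
  have "0 < lam" using M1 ls by (simp add: assumption_M1_def)
  then have W0: "0 < W" using lW' nm p by (smt (verit) divide_pos_pos half_gt_zero mult_pos_pos
      real_sqrt_gt_zero)
  let ?X = "1 + ?A y z \<gamma> \<bullet> kern2 ?p \<xi> - 1 / 2 * (mat 1 \<bullet> kern2 ?p \<xi>)"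
  \<comment> \<open>The factor 1 - p < 1 may be dropped from the lower bound only after
    \<open>?X\<close> is known to be positive, which the positivity of \<open>lam\<close>
    provides.\<close>
  have "0 < (1 - ?p) * ?X" using lb W0 by linarith
  then have "0 < ?X" using p1 by (simp add: zero_less_mult_iff)
  then have "(1 - ?p) * ?X \<le> 1 * ?X" using p by (intro mult_right_mono) auto
  moreover have "?X = 1 + h * (G_gamma G t x y z \<gamma> \<bullet> K2 ?s ?p h \<xi> -
      1 / 2 * ((?s ** transpose ?s) \<bullet> K2 ?s ?p h \<xi>))"
    using weight_eq[OF inv _ p1, of h "G_gamma G t x y z \<gamma>" \<xi>] h by (simp add: G_tilde_def)
  ultimately show ?thesis using order_trans[OF lW' lb] by (simp only: mult_1)
qed

section \<open>From the weight to monotonicity of the operator\<close>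

lemma norm_K1_le:
  assumes "0 < p" "p < 1" "\<xi> \<in> set_pmf (xi_pmf p :: (real^'n) pmf)" "0 < h"
  shows "norm (K1 \<sigma> h \<xi>) \<le> norm (matrix_inv \<sigma>) * sqrt (real CARD('n) / p) / sqrt h"
proof -
  have "norm (transpose (matrix_inv \<sigma>) *v \<xi>) \<le> norm (matrix_inv \<sigma>) * sqrt (real CARD('n) / p)"
    using norm_matrix_vector_mult_le[of "transpose (matrix_inv \<sigma>)" \<xi>] norm_xi_le[OF assms(1-3)]
    by (metis (no_types, opaque_lifting) mult_left_mono norm_ge_zero norm_transpose order_trans)
  then show ?thesis using assms(4) by (simp add: K1_def divide_right_mono del: transpose_matrix_vector)
qed

lemma K2_sym: "K2 \<sigma> p h \<xi> \<in> sym_mats"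
proof -
  have "transpose (matrix_inv \<sigma>) ** kern2 p \<xi> ** matrix_inv \<sigma> \<in> sym_mats"
    by (rule conj_sym_mats[OF kern2_sym])
  then show ?thesis by (simp add: K2_eq_kern2 subspace_scale[OF sym_mats_subspace])
qed

lemma D2_sym:
  assumes "0 < p t x" "p t x < 1"
  shows "D2 \<sigma>0 p t h \<phi> x \<in> sym_mats"
proof -
  have "bounded_linear (transpose :: real^'n^'n \<Rightarrow> _)"
    using linear_transpose linear_conv_bounded_linear by blast
  from expectation_xi_linear[OF assms this, of "\<lambda>\<xi>. \<phi> (x +
      sqrt h *\<^sub>R (\<sigma>0 t x *v \<xi>)) *\<^sub>R K2 (\<sigma>0 t x) (p t x) h \<xi>"]
  show ?thesis using K2_sym[of "\<sigma>0 t x" "p t x" h]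
    by (simp add: D2_def sym_mats_def transpose_scalar)
qed

text \<open>In units of |\<sigma>0^-1| / sqrt p the main part of the weight is at least lam / 2,
  while the derivative in z contributes at most sqrt h L sqrt d and the derivative in y at most h L
  K. The condition on h compares exactly these.\<close>

lemma scheme_op_mono:
  fixes G :: "'n::finite nonlinearity"
  assumes st: "standing_assumptions T B L G g" and M: "assumption_M T K G \<sigma>0 p"
      and ls: "lambda_star T G \<sigma>0 = ereal lam"
    and t: "t \<in> {0..T}" and h: "0 < h" "sqrt h * (L * sqrt (real CARD('n))) + h * (L * K) \<le> lam / 2"
    and le: "\<And>x. \<phi> x \<le> \<psi> x"
  shows "scheme_op G \<sigma>0 p t h \<phi> x \<le> scheme_op G \<sigma>0 p t h \<psi> x"
proof -
  let ?s = "\<sigma>0 t x" and ?p = "p t x" and ?d = "real CARD('n)"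
  let ?a = "?s ** transpose ?s" and ?m = "norm (matrix_inv ?s)"
  have sd: "scheme_data T K \<sigma>0 p" using M by (auto simp: assumption_M_def)
  have inv: "invertible ?s" and nK: "norm ?s \<le> K" and p: "0 < ?p" "?p < 1"
    using sd t by (auto simp: scheme_data_def)
  have dG: "differentiable_nonlinearity T G" and S2: "assumption_S2 T L G g"
    using st by (auto simp: standing_assumptions_def)
  have L0: "0 \<le> L" using S2 by (auto simp: assumption_S2_def lipschitz_on_def)
  define \<delta> where "\<delta> \<xi> = \<psi> (x + sqrt h *\<^sub>R (?s *v \<xi>)) - \<phi> (x + sqrt h *\<^sub>R (?s *v \<xi>))" for \<xi>
  define y z \<gamma> where "y = D0 \<sigma>0 p t h \<phi> x" "z = D1 \<sigma>0 p t h \<phi> x" "\<gamma> = D2 \<sigma>0 p t h \<phi> x"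
  define y' z' \<gamma>' where "y' = D0 \<sigma>0 p t h \<psi> x" "z' = D1 \<sigma>0 p t h \<psi> x" "\<gamma>' = D2 \<sigma>0 p t h \<psi> x"
  let ?E = "xi_mean ?p"
  note int = integrable_xi_pmf[OF p]
  have dy: "y' - y = ?E \<delta>"
    by (simp add: y_z_\<gamma>_def y'_z'_\<gamma>'_def D0_def \<delta>_def[abs_def] int)
  have dz: "z' - z = ?E (\<lambda>\<xi>. \<delta> \<xi> *\<^sub>R K1 ?s h \<xi>)"
    by (simp add: y_z_\<gamma>_def y'_z'_\<gamma>'_def D1_def \<delta>_def int scaleR_diff_left)
  have dg: "\<gamma>' - \<gamma> = ?E (\<lambda>\<xi>. \<delta> \<xi> *\<^sub>R K2 ?s ?p h \<xi>)"
    by (simp add: y_z_\<gamma>_def y'_z'_\<gamma>'_def D2_def \<delta>_def int scaleR_diff_left)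
  have sym: "\<gamma> \<in> sym_mats" "\<gamma>' \<in> sym_mats" by (auto simp: y_z_\<gamma>_def y'_z'_\<gamma>'_def D2_sym p)
  define H where "H = (\<lambda>(y, z, \<gamma>). G t x y z \<gamma>)"
  define P where "P = (y, z, \<gamma>)"
  define w where "w = (y' - y, z' - z, \<gamma>' - \<gamma>)"
  have inS: "P + s *\<^sub>R w \<in> UNIV \<times> UNIV \<times> sym_mats" for s
    using sym by (auto simp: P_def w_def intro!: subspace_add[OF sym_mats_subspace]
        subspace_scale[OF sym_mats_subspace] subspace_diff[OF sym_mats_subspace])
  \<comment> \<open>A derivative is fixed at every point of the line beforehand, because the mean
    value theorem selects the point only afterwards.\<close>
  have "\<forall>s. \<exists>D. (H has_derivative D) (at (P + s *\<^sub>R w) within UNIV \<times> UNIV \<times> sym_mats)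
      \<and> (\<forall>y' z'. \<forall>\<gamma>'\<in>sym_mats. \<bar>D (y', z', \<gamma>')\<bar> \<le> L * norm (y', z', \<gamma>'))
      \<and> (\<exists>y z. \<exists>\<gamma>\<in>sym_mats. \<forall>\<eta>\<in>sym_mats. D (0, 0, \<eta>) = G_gamma G t x y z \<gamma> \<bullet> \<eta>)"
  proof
    fix s
    obtain y1 z1 \<gamma>1 where P1: "P + s *\<^sub>R w = (y1, z1, \<gamma>1)" by (metis surj_pair)
    then have g1: "\<gamma>1 \<in> sym_mats" using inS[of s] by auto
    show "\<exists>D. (H has_derivative D) (at (P + s *\<^sub>R w) within UNIV \<times> UNIV \<times> sym_mats)
      \<and> (\<forall>y' z'. \<forall>\<gamma>'\<in>sym_mats. \<bar>D (y', z', \<gamma>')\<bar> \<le> L * norm (y', z', \<gamma>'))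
      \<and> (\<exists>y z. \<exists>\<gamma>\<in>sym_mats. \<forall>\<eta>\<in>sym_mats. D (0, 0, \<eta>) = G_gamma G t x y z \<gamma> \<bullet> \<eta>)"
      unfolding P1 H_def
      by (rule nonlinearity_derivative[OF dG S2 t g1, of x y1 z1]) (use g1 in blast)
  qed
  from choice[OF this] obtain DD where DD: "\<And>s. (H has_derivative DD s) (at (P +
      s *\<^sub>R w) within UNIV \<times> UNIV \<times> sym_mats)
      \<and> (\<forall>y' z'. \<forall>\<gamma>'\<in>sym_mats. \<bar>DD s (y', z', \<gamma>')\<bar> \<le> L * norm (y', z', \<gamma>'))
      \<and> (\<exists>y z. \<exists>\<gamma>\<in>sym_mats. \<forall>\<eta>\<in>sym_mats. DD s (0, 0, \<eta>) = G_gamma G t x y z \<gamma> \<bullet> \<eta>)"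
    by blast
  have "((\<lambda>s. H (P + s *\<^sub>R w)) has_real_derivative DD s w) (at s)" for s
    using has_derivative_along_line[OF conjunct1[OF DD] inS] .
  then obtain s where "H (P + 1 *\<^sub>R w) - H (P + 0 *\<^sub>R w) = (1 - 0) * DD s w"
    using MVT2[of 0 1 "\<lambda>s. H (P + s *\<^sub>R w)" "\<lambda>s. DD s w"] by auto
  then have mvt: "G t x y' z' \<gamma>' - G t x y z \<gamma> = DD s w"
    by (simp add: H_def P_def w_def)
  obtain y1 z1 \<gamma>1 where g1: "\<gamma>1 \<in> sym_mats" "\<And>\<eta>. \<eta> \<in> sym_mats \<Longrightarrow>
      DD s (0, 0, \<eta>) = G_gamma G t x y1 z1 \<gamma>1 \<bullet> \<eta>"
    using DD[of s] by blast
  let ?\<Gamma> = "G_gamma G t x y1 z1 \<gamma>1"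
  have lin: "linear (DD s)" using DD[of s] has_derivative_linear by blast
  have bnd: "\<bar>DD s (a, b, 0)\<bar> \<le> L * norm (a, b)" for a b
  proof -
    have "\<bar>DD s (a, b, 0)\<bar> \<le> L * norm (a, b, 0 :: real^'n^'n)"
      using DD[of s] subspace_0[OF sym_mats_subspace] by blast
    then show ?thesis by (simp add: norm_Pair)
  qed
  define N2 where "N2 b = DD s (0, b, 0)" for b
  have N2: "bounded_linear N2"
    unfolding linear_conv_bounded_linear[symmetric]
  proof (rule linearI)
    show "N2 (a + b) = N2 a + N2 b" for a b using linear_add[OF lin, of "(0, a, 0)" "(0, b, 0)"]
        by (simp add: N2_def)
    show "N2 (r *\<^sub>R b) = r *\<^sub>R N2 b" for r b using linear_scale[OF lin, of r "(0, b, 0)"]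
        by (simp add: N2_def)
  qed
  define k where "k = DD s (1, 0, 0)"
  have dd: "DD s w = k * (y' - y) + N2 (z' - z) + ?\<Gamma> \<bullet> (\<gamma>' - \<gamma>)"
  proof -
    have "w = (y' - y) *\<^sub>R (1, 0, 0) + (0, z' - z, 0) + (0, 0, \<gamma>' - \<gamma>)" by (simp add: w_def)
    then have "DD s w = (y' - y) * DD s (1, 0, 0) + DD s (0, z' - z, 0) + DD s (0, 0, \<gamma>' - \<gamma>)"
      by (simp only: linear_add[OF lin] linear_scale[OF lin] real_scaleR_def)
    then show ?thesis using g1(2)[of "\<gamma>' - \<gamma>"] sym
      by (simp add: k_def N2_def subspace_diff[OF sym_mats_subspace])
  qed
  let ?W = "\<lambda>\<xi>. 1 + h * k + h * N2 (K1 ?s h \<xi>) + h * (?\<Gamma> \<bullet> K2 ?s ?p h \<xi> - 1 / 2 * (?a \<bullet> K2 ?s ?p h \<xi>))"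
  have "scheme_op G \<sigma>0 p t h \<psi> x - scheme_op G \<sigma>0 p t h \<phi> x =
    (y' - y) + h * ((G t x y' z' \<gamma>' - G t x y z \<gamma>) - 1 / 2 * (?a \<bullet> (\<gamma>' - \<gamma>)))"
    unfolding scheme_op_def F_op_def inner_diff_right
    by (simp flip: y_z_\<gamma>_def y'_z'_\<gamma>'_def) (simp add: field_simps)
  also have "\<dots> = (y' - y) + h * (k * (y' - y) + N2 (z' - z) + ?\<Gamma> \<bullet> (\<gamma>' - \<gamma>) - 1 / 2 * (?a \<bullet> (\<gamma>' - \<gamma>)))"
    by (simp only: mvt dd)
  also have "\<dots> = ?E (\<lambda>\<xi>. \<delta> \<xi> * ?W \<xi>)"
  proof -
    have 1: "N2 (z' - z) = ?E (\<lambda>\<xi>. \<delta> \<xi> * N2 (K1 ?s h \<xi>))"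
      using expectation_xi_linear[OF p N2, of "\<lambda>\<xi>. \<delta> \<xi> *\<^sub>R K1 ?s h \<xi>"]
      by (simp add: dz linear_simps(5)[OF N2])
    have 2: "X \<bullet> (\<gamma>' - \<gamma>) = ?E (\<lambda>\<xi>. \<delta> \<xi> * (X \<bullet> K2 ?s ?p h \<xi>))" for X
      using expectation_xi_linear[OF p bounded_linear_inner_right, of X "\<lambda>\<xi>. \<delta> \<xi> *\<^sub>R K2 ?s ?p h \<xi>"]
      by (simp add: dg)
    have "(\<lambda>\<xi>. \<delta> \<xi> * ?W \<xi>) = (\<lambda>\<xi>. (1 + h * k) * \<delta> \<xi> + h * (\<delta> \<xi> * N2 (K1 ?s h \<xi>)) +
       h * (\<delta> \<xi> * (?\<Gamma> \<bullet> K2 ?s ?p h \<xi>)) - h / 2 * (\<delta> \<xi> * (?a \<bullet> K2 ?s ?p h \<xi>)))"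
      by (rule ext) (simp add: algebra_simps)
    then show ?thesis unfolding 1 2 dy by (simp add: int) (simp add: algebra_simps)
  qed
  also have "\<dots> \<ge> 0"
  proof (rule integral_nonneg_AE, unfold AE_measure_pmf_iff, intro ballI mult_nonneg_nonneg)
    fix \<xi> :: "real^'n" assume \<xi>: "\<xi> \<in> set_pmf (xi_pmf ?p)"
    show "0 \<le> \<delta> \<xi>" using le by (simp add: \<delta>_def)
    have "\<bar>h * k\<bar> \<le> h * L" using bnd[of 1 0] h by (simp add: k_def abs_mult norm_Pair)
    moreover have "\<bar>h * N2 (K1 ?s h \<xi>)\<bar> \<le> sqrt h * (L * sqrt ?d) * (?m / sqrt ?p)"
    proof -
      have "\<bar>h * N2 (K1 ?s h \<xi>)\<bar> \<le> h * (L * norm (K1 ?s h \<xi>))"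
        using bnd[of 0 "K1 ?s h \<xi>"] h by (simp add: N2_def abs_mult norm_Pair)
      also have "\<dots> \<le> h * (L * (?m * sqrt (?d / ?p) / sqrt h))"
        using norm_K1_le[OF p \<xi> h(1), of ?s] h L0 by (intro mult_left_mono) auto
      also have "\<dots> = (h / sqrt h) * (L * (?m * (sqrt ?d / sqrt ?p)))" by (simp add: real_sqrt_divide)
      also have "h / sqrt h = sqrt h" using h by (simp add: real_div_sqrt)
      finally show ?thesis by (simp add: mult_ac)
    qed
    \<comment> \<open>The term from y has no factor |\<sigma>0^-1| of its own; it is supplied by 1
      \<le> |\<sigma>0| |\<sigma>0^-1| \<le> K |\<sigma>0^-1| together with p < 1.\<close>
    moreover have "h * L \<le> h * (L * K) * (?m / sqrt ?p)"
    proof -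
      have "1 \<le> norm ?s * ?m" by (rule norm_matrix_ge_1_inverse[OF inv])
      also have "\<dots> \<le> K * ?m" using nK by (intro mult_right_mono) auto
      also have "\<dots> \<le> K * ?m / sqrt ?p"
      proof -
        have "0 \<le> K * ?m" using \<open>norm ?s * ?m \<le> K * ?m\<close>
            by (meson mult_nonneg_nonneg norm_ge_zero order_trans)
        moreover have "sqrt ?p \<le> 1" using p by simp
        ultimately show ?thesis using p by (simp add: pos_le_divide_eq mult_left_le)
      qed
      finally have "h * L * 1 \<le> h * L * (K * ?m / sqrt ?p)" using h L0 by (intro mult_left_mono) auto
      then show ?thesis by (simp add: mult_ac)
    qed
    moreover have "(sqrt h * (L * sqrt ?d) + h * (L * K)) * (?m / sqrt ?p) \<le> lam / 2 * (?m / sqrt ?p)"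
      using h(2) p by (intro mult_right_mono) auto
    moreover note weight_bound[OF st M ls t g1(1) h(1) \<xi>, of y1 z1]
    ultimately show "0 \<le> ?W \<xi>" by (simp only: distrib_right)
  qed
  finally show ?thesis by simp
qed

lemma monotone_scheme_bound:
  assumes "0 < lam"
  shows "\<exists>hbar>0. \<forall>(G :: 'n::finite nonlinearity) g \<sigma>0 p.
    standing_assumptions T B L G g \<and> assumption_M T K G \<sigma>0 p \<and> lambda_star T G \<sigma>0 = ereal lam \<longrightarrow>
      monotone_scheme T G \<sigma>0 p hbar"
proof -
  \<comment> \<open>For h \<le> 1 both perturbations together are at most sqrt h times
    \<open>Q\<close>, and \<open>hb\<close> makes this at most lam / 2. Absolute values appear
    because no sign of \<open>L\<close> and \<open>K\<close> is assumed; the summand 1 keeps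
    \<open>Q\<close> positive.\<close>
  define Q where "Q = \<bar>L\<bar> * sqrt (real CARD('n)) + \<bar>L\<bar> * \<bar>K\<bar> + 1"
  have Q: "0 < Q" by (simp add: Q_def add_nonneg_pos)
  define hb where "hb = min 1 ((lam / (2 * Q))\<^sup>2)"
  have hb: "0 < hb" using assms Q by (simp add: hb_def)
  have key: "sqrt h * (L * sqrt (real CARD('n))) + h * (L * K) \<le> lam / 2" if h: "0 < h" "h \<le> hb" for h
  proof -
    have h1: "h \<le> 1" "h \<le> (lam / (2 * Q))\<^sup>2" using h by (auto simp: hb_def)
    have "h \<le> sqrt h" using h h1 by (intro real_le_rsqrt) (simp add: power2_eq_square mult_left_le)
    then have "h * (\<bar>L\<bar> * \<bar>K\<bar>) \<le> sqrt h * (\<bar>L\<bar> * \<bar>K\<bar>)" by (intro mult_right_mono) auto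
    moreover have "L * K \<le> \<bar>L\<bar> * \<bar>K\<bar>" by (metis abs_ge_self abs_mult)
    then have "h * (L * K) \<le> h * (\<bar>L\<bar> * \<bar>K\<bar>)" using h by (intro mult_left_mono) auto
    moreover have "sqrt h * (L * sqrt (real CARD('n))) \<le> sqrt h * (\<bar>L\<bar> * sqrt (real CARD('n)))"
      using h by (intro mult_left_mono mult_right_mono) auto
    ultimately have "sqrt h * (L * sqrt (real CARD('n))) + h * (L * K) \<le> sqrt h * Q"
      using real_sqrt_gt_zero[OF h(1)] unfolding Q_def distrib_left by linarith
    also have "sqrt h \<le> lam / (2 * Q)"
      using h1 assms Q by (intro real_le_lsqrt) auto
    then have "sqrt h * Q \<le> lam / (2 * Q) * Q" using Q by (intro mult_right_mono) auto
    also have "\<dots> = lam / 2" using Q by simp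
    finally show ?thesis .
  qed
  have "monotone_scheme T G \<sigma>0 p hb"
    if "standing_assumptions T B L G g" "assumption_M T K G \<sigma>0 p" "lambda_star T G \<sigma>0 = ereal lam"
    for G :: "'n nonlinearity" and g \<sigma>0 p
    unfolding monotone_scheme_def
  proof (intro ballI allI impI)
    fix t h x and \<phi> \<psi> :: "real^'n \<Rightarrow> real"
    assume "t \<in> {0..<T}" "h \<in> {0<..hb}" "\<forall>x. \<phi> x \<le> \<psi> x"
    then show "scheme_op G \<sigma>0 p t h \<phi> x \<le> scheme_op G \<sigma>0 p t h \<psi> x"
      by (intro scheme_op_mono[OF that _ _ key]) auto
  qed
  then show ?thesis using hb by blast
qed


section \<open>Consistency\<close>

lemma gderiv_along_line:
  assumes "GDERIV f (q + a *\<^sub>R v) :> D"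
  shows "((\<lambda>a. f (q + a *\<^sub>R v)) has_real_derivative v \<bullet> D) (at a)"
  by (rule has_derivative_along_line[where S=UNIV and D="\<lambda>h. h \<bullet> D"]) (use assms in \<open>auto simp:
    gderiv_def\<close>)

lemma inner_derivative_along_line:
  fixes g :: "real^'n \<Rightarrow> real^'m"
  assumes "(g has_derivative (\<lambda>v. A *v v)) (at (q + a *\<^sub>R v))"
  shows "((\<lambda>a. w \<bullet> g (q + a *\<^sub>R v)) has_real_derivative w \<bullet> (A *v v)) (at a)"
  by (rule has_derivative_along_line[where S=UNIV and H="\<lambda>y. w \<bullet> g y" and D="\<lambda>v. w \<bullet> (A *v v)"])
     (auto intro!: derivative_eq_intros assms)

text \<open>Schwarz's theorem: by the mean value theorem, applied in both orders, the second difference in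
  directions \<open>v\<close>, \<open>w\<close> is a value of either mixed derivative near \<open>x\<close>.\<close>

lemma hessian_sym_mats:
  fixes f :: "real^'n \<Rightarrow> real"
  assumes g: "\<And>y. GDERIV f y :> g y" and H: "\<And>y. (g has_derivative (\<lambda>v. H y *v v)) (at y)"
    and cont: "continuous_on UNIV H"
  shows "H x \<in> sym_mats"
proof -
  have df: "((\<lambda>a. f (q + a *\<^sub>R v)) has_real_derivative v \<bullet> g (q + a *\<^sub>R v)) (at a)" for q v a
    by (rule gderiv_along_line[OF g])
  have dg: "((\<lambda>a. w \<bullet> g (q + a *\<^sub>R v)) has_real_derivative w \<bullet> (H (q + a *\<^sub>R v) *v v)) (at a)"
      for q v w a
    by (rule inner_derivative_along_line[OF H])
  have second_difference: "\<exists>\<alpha>\<in>{0..s}. \<exists>\<beta>\<in>{0..s}. f (x + s *\<^sub>R v + s *\<^sub>R w) - f (x + s *\<^sub>R v) -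
      f (x + s *\<^sub>R w) + f x
      = s\<^sup>2 * (v \<bullet> (H (x + \<alpha> *\<^sub>R v + \<beta> *\<^sub>R w) *v w))" if s: "0 < s" for s v w
  proof -
    define \<phi> where "\<phi> a = f ((x + s *\<^sub>R w) + a *\<^sub>R v) - f (x + a *\<^sub>R v)" for a
    have "(\<phi> has_real_derivative v \<bullet> g ((x + s *\<^sub>R w) + a *\<^sub>R v) - v \<bullet> g (x + a *\<^sub>R v)) (at a)" for a
      unfolding \<phi>_def by (intro DERIV_diff df)
    then obtain \<alpha> where \<alpha>: "0 < \<alpha>" "\<alpha> < s"
        "\<phi> s - \<phi> 0 = (s - 0) * (v \<bullet> g ((x + s *\<^sub>R w) + \<alpha> *\<^sub>R v) - v \<bullet> g (x + \<alpha> *\<^sub>R v))"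
      using MVT2[OF s, of \<phi> "\<lambda>a. v \<bullet> g ((x + s *\<^sub>R w) + a *\<^sub>R v) - v \<bullet> g (x + a *\<^sub>R v)"] by blast
    obtain \<beta> where \<beta>: "0 < \<beta>" "\<beta> < s"
        "v \<bullet> g (x + \<alpha> *\<^sub>R v + s *\<^sub>R w) - v \<bullet> g (x + \<alpha> *\<^sub>R v + 0 *\<^sub>R w) =
            (s - 0) * (v \<bullet> (H (x + \<alpha> *\<^sub>R v + \<beta> *\<^sub>R w) *v w))"
      using MVT2[OF s, of "\<lambda>b. v \<bullet> g (x + \<alpha> *\<^sub>R v + b *\<^sub>R w)"
          "\<lambda>b. v \<bullet> (H (x + \<alpha> *\<^sub>R v + b *\<^sub>R w) *v w)"] dg by blast
    have "f (x + s *\<^sub>R v + s *\<^sub>R w) - f (x + s *\<^sub>R v) - f (x + s *\<^sub>R w) + f x = \<phi> s - \<phi> 0"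
      by (simp add: \<phi>_def algebra_simps)
    also have "\<dots> = s\<^sup>2 * (v \<bullet> (H (x + \<alpha> *\<^sub>R v + \<beta> *\<^sub>R w) *v w))"
      using \<alpha>(3) \<beta>(3) by (simp add: algebra_simps power2_eq_square)
    finally show ?thesis using \<alpha> \<beta> by (intro bexI[of _ \<alpha>] bexI[of _ \<beta>]) auto
  qed
  have "v \<bullet> (H x *v w) = w \<bullet> (H x *v v)" for v w
  proof (rule ccontr)
    define Q where "Q v w y = v \<bullet> (H y *v w)" for v w y
    assume "v \<bullet> (H x *v w) \<noteq> w \<bullet> (H x *v v)"
    then have e: "0 < \<bar>Q v w x - Q w v x\<bar> / 2" (is "0 < ?e") by (simp add: Q_def)
    have "isCont (Q v w) x" for v w
    proof -
      have H: "isCont H x" using cont by (simp add: continuous_on_eq_continuous_at)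
      have "bounded_linear (\<lambda>A::real^'n^'n. v \<bullet> (A *v w))"
        unfolding linear_conv_bounded_linear[symmetric]
        by (intro linearI) (simp_all add: matrix_vector_mult_add_rdistrib inner_add_right flip:
          scaleR_matrix_vector_assoc)
      from bounded_linear.isCont[OF this H] show ?thesis unfolding Q_def .
    qed
    note cQ = this
    obtain d1 where d1: "0 < d1" "\<And>y. dist y x < d1 \<Longrightarrow> dist (Q v w y) (Q v w x) < ?e"
      using cQ[of v w] e unfolding continuous_at_eps_delta by metis
    obtain d2 where d2: "0 < d2" "\<And>y. dist y x < d2 \<Longrightarrow> dist (Q w v y) (Q w v x) < ?e"
      using cQ[of w v] e unfolding continuous_at_eps_delta by metis
    \<comment> \<open>This size keeps the whole parallelogram spanned by s v and s w inside both
      balls; the summand 1 keeps the denominator positive.\<close>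
    define s where "s = min d1 d2 / (norm v + norm w + 1)"
    have s: "0 < s" using d1 d2 by (auto simp: s_def intro!: divide_pos_pos add_nonneg_pos)
    have small: "s * (norm v + norm w) < min d1 d2"
    proof -
      have "s * (norm v + norm w) < s * (norm v + norm w + 1)" using s by simp
      also have "\<dots> = min d1 d2"
        unfolding s_def by (simp add: add_nonneg_eq_0_iff)
      finally show ?thesis .
    qed
    have near: "dist (x + a *\<^sub>R v + b *\<^sub>R w) x < min d1 d2" if "a \<in> {0..s}" "b \<in> {0..s}" for a b
    proof -
      have "dist (x + a *\<^sub>R v + b *\<^sub>R w) x = norm (a *\<^sub>R v + b *\<^sub>R w)" by (simp add: dist_norm)
      also have "\<dots> \<le> a * norm v + b * norm w"
        using norm_triangle_ineq[of "a *\<^sub>R v" "b *\<^sub>R w"] that by simp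
      also have "\<dots> \<le> s * norm v + s * norm w" using that by (intro add_mono mult_right_mono) auto
      finally show ?thesis using small by (simp add: distrib_left)
    qed
    obtain a b where ab: "a \<in> {0..s}" "b \<in> {0..s}"
        "f (x + s *\<^sub>R v + s *\<^sub>R w) - f (x + s *\<^sub>R v) - f (x + s *\<^sub>R w) + f x
      = s\<^sup>2 * Q v w (x + a *\<^sub>R v + b *\<^sub>R w)" using second_difference[OF s, of v w] by (auto simp: Q_def)
    obtain a' b' where ab': "a' \<in> {0..s}" "b' \<in> {0..s}"
        "f (x + s *\<^sub>R w + s *\<^sub>R v) - f (x + s *\<^sub>R w) - f (x + s *\<^sub>R v) + f x
      = s\<^sup>2 * Q w v (x + a' *\<^sub>R w + b' *\<^sub>R v)" using second_difference[OF s,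
          of w v] by (auto simp: Q_def)
    have "s\<^sup>2 * Q v w (x + a *\<^sub>R v + b *\<^sub>R w) = s\<^sup>2 * Q w v (x + a' *\<^sub>R w + b' *\<^sub>R v)"
      using ab(3) ab'(3) by (simp add: algebra_simps)
    then have "Q v w (x + a *\<^sub>R v + b *\<^sub>R w) = Q w v (x + b' *\<^sub>R v + a' *\<^sub>R w)"
      using s by (simp add: add_ac)
    moreover have "dist (Q v w (x + a *\<^sub>R v + b *\<^sub>R w)) (Q v w x) < ?e"
      using near[OF ab(1,2)] by (intro d1) simp
    moreover have "dist (Q w v (x + b' *\<^sub>R v + a' *\<^sub>R w)) (Q w v x) < ?e"
      using near[OF ab'(2,1)] by (intro d2) simp
    ultimately show False by (simp add: dist_real_def) (smt (verit) field_sum_of_halves)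
  qed
  then have "axis i 1 \<bullet> (H x *v axis j 1) = axis j 1 \<bullet> (H x *v axis i 1)" for i j by blast
  then have "H x $ i $ j = H x $ j $ i" for i j
    by (simp add: inner_axis' matrix_vector_mult_basis column_def)
  then show ?thesis by (simp add: sym_mats_def transpose_def vec_eq_iff)
qed

text \<open>Maclaurin's formula for the restriction of \<open>f\<close> to the line through x in
  direction \<open>v\<close>. Beyond the Hessian, regularity is given only for its individual
  entries, hence the double sums over \<open>H3 i j\<close> and \<open>H4 i j\<close>.\<close>

lemma taylor4_along_line:
  fixes f :: "real^'n \<Rightarrow> real"
  assumes g: "\<And>y. GDERIV f y :> g y" and H: "\<And>y. (g has_derivative (\<lambda>v. H y *v v)) (at y)"
    and H3: "\<And>i j y. GDERIV (\<lambda>y. H y $ i $ j) y :> H3 i j y"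
    and H4: "\<And>i j y. (H3 i j has_derivative (\<lambda>v. H4 i j y *v v)) (at y)"
    and s: "0 < s"
  shows "\<exists>\<tau>. f (x + s *\<^sub>R v) = f x + s * (v \<bullet> g x) + s\<^sup>2 / 2 * (v \<bullet> (H x *v v)) +
    s ^ 3 * ((\<Sum>i\<in>UNIV. \<Sum>j\<in>UNIV. v$i * v$j * (v \<bullet> H3 i j x)) / 6) +
    s ^ 4 * ((\<Sum>i\<in>UNIV. \<Sum>j\<in>UNIV. v$i * v$j * (v \<bullet> (H4 i j (x + \<tau> *\<^sub>R v) *v v))) / 24)"
proof -
  have d0: "((\<lambda>a. f (x + a *\<^sub>R v)) has_real_derivative v \<bullet> g (x + a *\<^sub>R v)) (at a)" for a
    by (rule gderiv_along_line[OF g])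
  have d1: "((\<lambda>a. v \<bullet> g (x + a *\<^sub>R v)) has_real_derivative v \<bullet> (H (x + a *\<^sub>R v) *v v)) (at a)" for a
    by (rule inner_derivative_along_line[OF H])
  have dH: "((\<lambda>a. H (x + a *\<^sub>R v) $ i $ j) has_real_derivative v \<bullet> H3 i j (x + a *\<^sub>R v)) (at a)"
      for a i j
    by (rule gderiv_along_line[OF H3])
  have d2: "((\<lambda>a. v \<bullet> (H (x + a *\<^sub>R v) *v v)) has_real_derivative
      (\<Sum>i\<in>UNIV. \<Sum>j\<in>UNIV. v$i * v$j * (v \<bullet> H3 i j (x + a *\<^sub>R v)))) (at a)" for a
  proof -
    have "((\<lambda>a. \<Sum>i\<in>UNIV. \<Sum>j\<in>UNIV. H (x + a *\<^sub>R v) $ i $ j * (v$i * v$j)) has_real_derivative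
      (\<Sum>i\<in>UNIV. \<Sum>j\<in>UNIV. v \<bullet> H3 i j (x + a *\<^sub>R v) * (v$i * v$j))) (at a)"
      by (intro DERIV_sum DERIV_cmult_right dH)
    then show ?thesis by (simp only: quad_form_sum mult.commute[of _ "v$_ * v$_"])
  qed
  have "((\<lambda>a. v \<bullet> H3 i j (x + a *\<^sub>R v)) has_real_derivative v \<bullet> (H4 i j (x + a *\<^sub>R v) *v v)) (at a)"
      for a i j
    by (rule inner_derivative_along_line[OF H4])
  then have d3: "((\<lambda>a. \<Sum>i\<in>UNIV. \<Sum>j\<in>UNIV. v$i * v$j * (v \<bullet> H3 i j (x + a *\<^sub>R v))) has_real_derivative
      (\<Sum>i\<in>UNIV. \<Sum>j\<in>UNIV. v$i * v$j * (v \<bullet> (H4 i j (x + a *\<^sub>R v) *v v)))) (at a)" for a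
    by (intro DERIV_sum DERIV_cmult)
  define D where "D m a = (if m = (0::nat) then f (x + a *\<^sub>R v) else if m = 1 then v \<bullet> g (x + a *\<^sub>R v)
    else if m = 2 then v \<bullet> (H (x + a *\<^sub>R v) *v v)
    else if m = 3 then \<Sum>i\<in>UNIV. \<Sum>j\<in>UNIV. v$i * v$j * (v \<bullet> H3 i j (x + a *\<^sub>R v))
    else \<Sum>i\<in>UNIV. \<Sum>j\<in>UNIV. v$i * v$j * (v \<bullet> (H4 i j (x + a *\<^sub>R v) *v v)))" for m a
  have "\<exists>\<tau>. 0 < \<tau> \<and> \<tau> < s \<and> f (x + s *\<^sub>R v) =
      (\<Sum>m<4. (D m 0 / fact m) * s ^ m) + (D 4 \<tau> / fact 4) * s ^ 4"
  proof (rule Maclaurin[OF s])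
    show "D 0 = (\<lambda>a. f (x + a *\<^sub>R v))" by (simp add: D_def fun_eq_iff)
    show "\<forall>m a. m < 4 \<and> 0 \<le> a \<and> a \<le> s \<longrightarrow> (D m has_real_derivative D (Suc m) a) (at a)"
    proof (intro allI impI)
      fix m :: nat and a assume "m < 4 \<and> 0 \<le> a \<and> a \<le> s"
      then consider "m = 0" | "m = 1" | "m = 2" | "m = 3" by linarith
      then show "(D m has_real_derivative D (Suc m) a) (at a)"
        using d0 d1 d2 d3 by cases (simp_all add: D_def[abs_def] numeral_2_eq_2 numeral_3_eq_3)
    qed
  qed simp
  then obtain \<tau> where "f (x + s *\<^sub>R v) = (\<Sum>m<4. (D m 0 / fact m) * s ^ m) +
      (D 4 \<tau> / fact 4) * s ^ 4" by blast
  also have "(\<Sum>m<4. (D m 0 / fact m) * s ^ m) = D 0 0 + D 1 0 * s + D 2 0 / 2 * s\<^sup>2 + D 3 0 / 6 * s ^ 3"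
  proof -
    have "{..<4} = {0, 1, 2, 3 :: nat}" by auto
    then show ?thesis by (simp add: fact_numeral)
  qed
  finally have "f (x + s *\<^sub>R v) = f x + s * (v \<bullet> g x) + s\<^sup>2 / 2 * (v \<bullet> (H x *v v)) +
    s ^ 3 * ((\<Sum>i\<in>UNIV. \<Sum>j\<in>UNIV. v$i * v$j * (v \<bullet> H3 i j x)) / 6) +
    s ^ 4 * ((\<Sum>i\<in>UNIV. \<Sum>j\<in>UNIV. v$i * v$j * (v \<bullet> (H4 i j (x + \<tau> *\<^sub>R v) *v v))) / 24)"
    by (simp add: D_def fact_numeral mult.commute)
  then show ?thesis ..
qed

section \<open>Truncation errors of the three discrete operators\<close>

lemma matrix_adjoint: "(A *v x) \<bullet> y = (transpose A *v y) \<bullet> x" for A :: "real^'n^'m"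
  using dot_lmul_matrix[of x "transpose A" y]
      by (simp only: vector_transpose_matrix inner_commute[of x])

lemma matrix_quad: "(A *v x) \<bullet> (H *v (A *v x)) = x \<bullet> ((transpose A ** H ** A) *v x)"
    for A H :: "real^'n^'n"
  unfolding matrix_adjoint[of A x] inner_commute[of x]
      by (simp only: matrix_vector_mul_assoc matrix_mul_assoc)

context
  fixes \<sigma>0 :: "'n::finite mat_fun" and p :: "'n scalar_fun" and t h K M :: real and x :: "real^'n"
    and \<phi> :: "real^'n \<Rightarrow> real" and f0 :: real and b :: "real^'n" and H :: "real^'n^'n"
        and a3 r :: "real^'n \<Rightarrow> real"
  assumes p: "0 < p t x" "p t x \<le> 1 / 3" "1 / p t x \<le> K" and inv: "invertible (\<sigma>0 t x)"
    and nK: "norm (\<sigma>0 t x) \<le> K" "norm (matrix_inv (\<sigma>0 t x)) \<le> K" and h: "0 < h"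
    and H: "H \<in> sym_mats" "norm H \<le> M" and odd: "\<And>\<xi>. a3 (- \<xi>) = - a3 \<xi>"
    and bounds: "\<And>\<xi>. \<xi> \<in> set_pmf (xi_pmf (p t x)) \<Longrightarrow> \<bar>a3 \<xi>\<bar> \<le> M"
        "\<And>\<xi>. \<xi> \<in> set_pmf (xi_pmf (p t x)) \<Longrightarrow> \<bar>r \<xi>\<bar> \<le> M"
    and expansion: "\<And>\<xi>. \<xi> \<in> set_pmf (xi_pmf (p t x)) \<Longrightarrow> \<phi> (x + sqrt h *\<^sub>R (\<sigma>0 t x *v \<xi>)) =
      f0 + sqrt h * ((\<sigma>0 t x *v \<xi>) \<bullet> b) + (sqrt h)\<^sup>2 / 2 * ((\<sigma>0 t x *v \<xi>) \<bullet> (H *v (\<sigma>0 t x *v \<xi>)))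
      + sqrt h ^ 3 * a3 \<xi> + sqrt h ^ 4 * r \<xi>"
begin


private lemma p_lt_1: "p t x < 1" using p by simp

private lemma M_nonneg: "0 \<le> M" using H(2) norm_ge_zero order_trans by blast
private lemma K_nonneg: "0 \<le> K" using nK(1) norm_ge_zero order_trans by blast

lemma expectation_scheme_expansion:
  fixes \<kappa> :: "real^'n \<Rightarrow> 'b::{banach,second_countable_topology}"
  shows "xi_mean (p t x) (\<lambda>\<xi>. \<phi> (x + sqrt h *\<^sub>R (\<sigma>0 t x *v \<xi>)) *\<^sub>R \<kappa> \<xi>) =
    f0 *\<^sub>R xi_mean (p t x) \<kappa> + sqrt h *\<^sub>R xi_mean (p t x) (\<lambda>\<xi>. ((transpose (\<sigma>0 t x) *v b) \<bullet> \<xi>) *\<^sub>R \<kappa>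
        \<xi>) +
    (h / 2) *\<^sub>R xi_mean (p t x) (\<lambda>\<xi>. (\<xi> \<bullet> ((transpose (\<sigma>0 t x) ** H ** (\<sigma>0 t x)) *v \<xi>)) *\<^sub>R \<kappa> \<xi>) +
    (sqrt h ^ 3) *\<^sub>R xi_mean (p t x) (\<lambda>\<xi>. a3 \<xi> *\<^sub>R \<kappa> \<xi>) + h\<^sup>2 *\<^sub>R xi_mean (p t x) (\<lambda>\<xi>. r \<xi> *\<^sub>R \<kappa> \<xi>)"
proof -
  have "sqrt h ^ 4 = h\<^sup>2" using h by (simp add: power4_eq_xxxx power2_eq_square)
  then show ?thesis
    using expectation_expansion[OF p(1) p_lt_1, of "\<lambda>\<xi>. \<phi> (x + sqrt h *\<^sub>R (\<sigma>0 t x *v \<xi>))" f0 "sqrt h"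
        "transpose (\<sigma>0 t x) *v b" "transpose (\<sigma>0 t x) ** H ** (\<sigma>0 t x)" a3 r \<kappa>] expansion h
    by (simp only: matrix_quad matrix_adjoint[of "\<sigma>0 t x" _ b]) simp
qed

text \<open>Parity removes the linear and the cubic term. The mean of the quadratic form is a trace,
  and the trace of \<open>transpose \<sigma> ** H ** \<sigma>\<close> is the pairing of a0 with
  \<open>H\<close>.\<close>

lemma D0_consistency: "\<bar>D0 \<sigma>0 p t h \<phi> x - (f0 + h / 2 * ((\<sigma>0 t x ** transpose (\<sigma>0 t x)) \<bullet> H))\<bar> \<le>
    M * h\<^sup>2"
proof -
  have "(\<Sum>i\<in>UNIV. (transpose (\<sigma>0 t x) ** H ** (\<sigma>0 t x)) $ i $ i) = (\<sigma>0 t x ** transpose (\<sigma>0 t x)) \<bullet> H"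
  proof -
    have "(\<Sum>i\<in>UNIV. (transpose (\<sigma>0 t x) ** H ** (\<sigma>0 t x)) $ i $ i) =
        mat 1 \<bullet> (transpose (\<sigma>0 t x) ** H ** (\<sigma>0 t x))"
      by (simp add: inner_mat_1[symmetric] inner_commute)
    also have "\<dots> = (mat 1 ** transpose (\<sigma>0 t x)) \<bullet> (transpose (\<sigma>0 t x) ** H)"
        by (rule inner_matrix_mult_right)
    also have "\<dots> = (transpose (transpose (\<sigma>0 t x)) ** (mat 1 ** transpose (\<sigma>0 t x))) \<bullet> H"
        by (rule inner_matrix_mult_left)
    finally show ?thesis by simp
  qed
  moreover have "xi_mean (p t x) (\<lambda>\<xi>. (transpose (\<sigma>0 t x) *v b) \<bullet> \<xi>) = 0" "xi_mean (p t x) a3 = 0"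
    by (rule expectation_xi_odd[OF p(1) p_lt_1]; simp add: odd)+
  ultimately have "D0 \<sigma>0 p t h \<phi> x = f0 + h / 2 * ((\<sigma>0 t x ** transpose (\<sigma>0 t x)) \<bullet> H) +
      h\<^sup>2 * xi_mean (p t x) r"
    using expectation_scheme_expansion[of "\<lambda>_. 1::real"]
    by (simp add: D0_def expectation_quad_xi[OF p(1) p_lt_1] del: transpose_matrix_vector)
  moreover have "\<bar>xi_mean (p t x) r\<bar> \<le> M"
    using expectation_xi_norm_le[OF p(1) p_lt_1, of r M] bounds(2) by simp
  then have "\<bar>h\<^sup>2 * xi_mean (p t x) r\<bar> \<le> M * h\<^sup>2"
      by (simp add: abs_mult mult.commute[of M] mult_left_mono)
  ultimately show ?thesis by simp
qed

private lemma norm_xi_le_K: "\<xi> \<in> set_pmf (xi_pmf (p t x)) \<Longrightarrow> norm (\<xi> :: real^'n) \<le>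
    sqrt (real CARD('n) * K)"
proof -
  assume "\<xi> \<in> set_pmf (xi_pmf (p t x))"
  then have "norm \<xi> \<le> sqrt (real CARD('n) / p t x)" by (rule norm_xi_le[OF p(1) p_lt_1])
  also have "\<dots> \<le> sqrt (real CARD('n) * K)"
    using mult_left_mono[OF p(3), of "real CARD('n)"] by simp
  finally show ?thesis .
qed

text \<open>After division by sqrt h the linear term is exact, and those of order 0 and 2 vanish by
  parity. The cubic term leaves O(h) and the remainder O(h^(3/2)), which is the origin of the factor
  (1 + sqrt h) h.\<close>

lemma D1_consistency: "norm (D1 \<sigma>0 p t h \<phi> x - b) \<le> K * (M * sqrt (real CARD('n) * K)) * (1 +
    sqrt h) * h"
proof -
  let ?Mt = "transpose (matrix_inv (\<sigma>0 t x))" and ?R = "sqrt (real CARD('n) * K)"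
  define e3 e4 where "e3 = xi_mean (p t x) (\<lambda>\<xi>. a3 \<xi> *\<^sub>R \<xi>)" and "e4 = xi_mean (p t x) (\<lambda>\<xi>. r \<xi> *\<^sub>R \<xi>)"
  have z: "xi_mean (p t x) (\<lambda>\<xi>. \<xi>) = 0" "xi_mean (p t x) (\<lambda>\<xi>. (\<xi> \<bullet> ((transpose (\<sigma>0 t x) ** H ** (\<sigma>0
      t x)) *v \<xi>)) *\<^sub>R \<xi>) = 0"
    by (rule expectation_xi_odd[OF p(1) p_lt_1]; simp add: linear_neg matrix_vector_mul_linear)+
  have s: "sqrt h ^ 3 = sqrt h * h" "h\<^sup>2 = sqrt h * (sqrt h * h)" using h
      by (simp_all add: power3_eq_cube power2_eq_square)
  have "xi_mean (p t x) (\<lambda>\<xi>. \<phi> (x + sqrt h *\<^sub>R (\<sigma>0 t x *v \<xi>)) *\<^sub>R \<xi>) =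
      sqrt h *\<^sub>R (transpose (\<sigma>0 t x) *v b + h *\<^sub>R e3 + (sqrt h * h) *\<^sub>R e4)"
    unfolding expectation_scheme_expansion z expectation_inner_xi[OF p(1) p_lt_1]
    by (simp add: s e3_def e4_def scaleR_add_right del: transpose_matrix_vector)
  then have "D1 \<sigma>0 p t h \<phi> x = ?Mt *v (transpose (\<sigma>0 t x) *v b + h *\<^sub>R e3 + (sqrt h * h) *\<^sub>R e4)"
    using h by (simp add: D1_eq[where p=p and t=t and x=x,
        OF p(1) p_lt_1] matrix_vector_mult_scaleR del: transpose_matrix_vector)
  also have "\<dots> = b + ?Mt *v (h *\<^sub>R e3 + (sqrt h * h) *\<^sub>R e4)"
    by (simp add: matrix_vector_right_distrib matrix_vector_mul_assoc inverse_matrix[OF inv] del: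
      transpose_matrix_vector)
  finally have "norm (D1 \<sigma>0 p t h \<phi> x - b) = norm (?Mt *v (h *\<^sub>R e3 + (sqrt h * h) *\<^sub>R e4))" by simp
  also have "\<dots> \<le> norm (matrix_inv (\<sigma>0 t x)) * norm (h *\<^sub>R e3 + (sqrt h * h) *\<^sub>R e4)"
    using norm_matrix_vector_mult_le[of ?Mt] by (simp only: norm_transpose)
  also have "\<dots> \<le> K * (h * (M * ?R) + sqrt h * h * (M * ?R))"
  proof (intro mult_mono nK(2) K_nonneg norm_ge_zero order_trans[OF norm_triangle_ineq] add_mono)
    have "norm e3 \<le> M * ?R" unfolding e3_def
      using bounds(1) norm_xi_le_K M_nonneg by (intro expectation_xi_norm_le[OF p(1) p_lt_1]) (simp
          add: mult_mono)
    then show "norm (h *\<^sub>R e3) \<le> h * (M * ?R)" using h by (simp add: mult_left_mono)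
    have "norm e4 \<le> M * ?R" unfolding e4_def
      using bounds(2) norm_xi_le_K M_nonneg by (intro expectation_xi_norm_le[OF p(1) p_lt_1]) (simp
          add: mult_mono)
    then show "norm ((sqrt h * h) *\<^sub>R e4) \<le> sqrt h * h * (M * ?R)"
      using h by (simp add: abs_mult mult_left_mono)
  qed
  finally show ?thesis by (simp add: algebra_simps)
qed

text \<open>Against the even kernel the linear and cubic terms vanish, the constant one vanishes
  because the kernel has mean zero, and the quadratic one reproduces \<open>H\<close> exactly. Only
  the remainder, of order h^2, is left to be divided by h.\<close>

lemma D2_consistency: "norm (D2 \<sigma>0 p t h \<phi> x - H) \<le> K * K * (M * ((real CARD('n))\<^sup>2 * K)) * h"
proof -
  let ?Mt = "transpose (matrix_inv (\<sigma>0 t x))" and ?d = "real CARD('n)"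
  define e4 where "e4 = xi_mean (p t x) (\<lambda>\<xi>. r \<xi> *\<^sub>R kern2 (p t x) \<xi>)"
  have z: "xi_mean (p t x) (\<lambda>\<xi>. ((transpose (\<sigma>0 t x) *v b) \<bullet> \<xi>) *\<^sub>R kern2 (p t x) \<xi>) = 0"
      "xi_mean (p t x) (\<lambda>\<xi>. a3 \<xi> *\<^sub>R kern2 (p t x) \<xi>) = 0"
    by (rule expectation_xi_odd[OF p(1) p_lt_1]; simp add: odd kern2_minus)+
  have S: "transpose (\<sigma>0 t x) ** H ** (\<sigma>0 t x) \<in> sym_mats" by (rule conj_sym_mats[OF H(1)])
  have "xi_mean (p t x) (\<lambda>\<xi>. \<phi> (x + sqrt h *\<^sub>R (\<sigma>0 t x *v \<xi>)) *\<^sub>R kern2 (p t x) \<xi>) =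
      h *\<^sub>R (transpose (\<sigma>0 t x) ** H ** (\<sigma>0 t x) + h *\<^sub>R e4)"
    unfolding expectation_scheme_expansion z expectation_kern2[OF p(1) p_lt_1]
        expectation_quad_kern2[OF p(1) p_lt_1 S]
    by (simp add: e4_def scaleR_add_right power2_eq_square)
  then have "D2 \<sigma>0 p t h \<phi> x = ?Mt ** (transpose (\<sigma>0 t x) ** H ** (\<sigma>0 t x) +
      h *\<^sub>R e4) ** matrix_inv (\<sigma>0 t x)"
    using h by (simp add: D2_eq[where p=p and t=t and x=x,
        OF p(1) p_lt_1] matrix_mult_scaleR_left matrix_mult_scaleR_right)
  also have "\<dots> = (?Mt ** transpose (\<sigma>0 t x)) ** H ** (\<sigma>0 t x ** matrix_inv (\<sigma>0 t x)) +
      h *\<^sub>R (?Mt ** e4 ** matrix_inv (\<sigma>0 t x))"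
    by (simp add: matrix_add_ldistrib matrix_add_rdistrib matrix_mult_scaleR_left
      matrix_mult_scaleR_right matrix_mul_assoc)
  also have "\<dots> = H + h *\<^sub>R (?Mt ** e4 ** matrix_inv (\<sigma>0 t x))" by (simp add: inverse_matrix[OF inv])
  finally have "norm (D2 \<sigma>0 p t h \<phi> x - H) = h * norm (?Mt ** e4 ** matrix_inv (\<sigma>0 t x))" using h
      by simp
  also have "\<dots> \<le> h * (K * (M * (?d\<^sup>2 * K)) * K)"
  proof (intro mult_left_mono order_trans[OF norm_matrix_mult_le] mult_mono nK(2) K_nonneg
      norm_ge_zero mult_nonneg_nonneg M_nonneg)
    show "norm ?Mt \<le> K" using nK(2) by (simp add: norm_transpose)
    have "norm (kern2 (p t x) \<xi>) \<le> ?d\<^sup>2 * K" if "\<xi> \<in> set_pmf (xi_pmf (p t x))" for \<xi> :: "real^'n"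
      using order_trans[OF norm_kern2_le[OF p(1,2) that]] mult_left_mono[OF p(3), of "?d\<^sup>2"] by simp
    then show "norm e4 \<le> M * (?d\<^sup>2 * K)" unfolding e4_def
      using bounds(2) M_nonneg by (intro expectation_xi_norm_le[OF p(1) p_lt_1]) (simp add: mult_mono)
  qed (use h in auto)
  finally show ?thesis by (simp add: mult_ac)
qed

end

section \<open>Stability of the scheme operator\<close>

lemma nonlinearity_lipschitz:
  assumes "assumption_S2 T L G g" "t \<in> {0..T}" "\<gamma> \<in> sym_mats" "\<gamma>' \<in> sym_mats"
  shows "\<bar>G t x y z \<gamma> - G t x y' z' \<gamma>'\<bar> \<le> L * (\<bar>y - y'\<bar> + norm (z - z') + norm (\<gamma> - \<gamma>'))"
proof -
  have lip: "L-lipschitz_on (UNIV \<times> UNIV \<times> UNIV \<times> sym_mats) (\<lambda>(x, y, z, \<gamma>). G t x y z \<gamma>)"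
    using assms by (auto simp: assumption_S2_def)
  have "\<bar>G t x y z \<gamma> - G t x y' z' \<gamma>'\<bar> \<le> L * dist (x, y, z, \<gamma>) (x, y', z', \<gamma>')"
    using lipschitz_onD[OF lip, of "(x, y, z, \<gamma>)" "(x, y', z', \<gamma>')"] assms by (simp add: dist_real_def)
  also have "dist (x, y, z, \<gamma>) (x, y', z', \<gamma>') \<le> \<bar>y - y'\<bar> + norm (z - z') + norm (\<gamma> - \<gamma>')"
    using sqrt_sum_squares_le_sum[of "norm (z - z')" "norm (\<gamma> - \<gamma>')"]
      sqrt_sum_squares_le_sum[of "\<bar>y - y'\<bar>" "sqrt ((norm (z - z'))\<^sup>2 + (norm (\<gamma> - \<gamma>'))\<^sup>2)"]
    by (simp add: dist_norm norm_Pair)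
  finally show ?thesis using lipschitz_on_nonneg[OF lip] by (simp add: mult_left_mono)
qed

lemma scheme_op_cong:
  assumes "\<And>\<xi>. \<xi> \<in> set_pmf (xi_pmf (p t x)) \<Longrightarrow> \<phi> (x + sqrt h *\<^sub>R (\<sigma>0 t x *v \<xi>)) =
      \<psi> (x + sqrt h *\<^sub>R (\<sigma>0 t x *v \<xi>))"
  shows "scheme_op G \<sigma>0 p t h \<phi> x = scheme_op G \<sigma>0 p t h \<psi> x"
proof -
  have "D0 \<sigma>0 p t h \<phi> x = D0 \<sigma>0 p t h \<psi> x" "D1 \<sigma>0 p t h \<phi> x = D1 \<sigma>0 p t h \<psi> x"
      "D2 \<sigma>0 p t h \<phi> x = D2 \<sigma>0 p t h \<psi> x"
    unfolding D0_def D1_def D2_def by (intro integral_cong_AE; simp add: AE_measure_pmf_iff assms)+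
  then show ?thesis by (simp add: scheme_op_def)
qed

text \<open>The coefficients are not assumed to be measurable, so neither are the grid functions; but the
  operator sees its argument at finitely many points only.\<close>

lemma monotone_schemeD:
  fixes \<phi> \<psi> :: "real^'n \<Rightarrow> real"
  assumes mon: "monotone_scheme T G \<sigma>0 p h0" and t: "t \<in> {0..<T}" "h \<in> {0<..h0}" "t + h \<le> T"
    and p: "0 < p t x" "p t x < 1" and le: "\<And>y. \<phi> y \<le> \<psi> y"
  shows "scheme_op G \<sigma>0 p t h \<phi> x \<le> scheme_op G \<sigma>0 p t h \<psi> x"
proof -
  define S where "S = (\<lambda>\<xi>. x + sqrt h *\<^sub>R (\<sigma>0 t x *v \<xi>)) ` set_pmf (xi_pmf (p t x))"
  have fin: "finite S" by (simp add: S_def finite_set_xi_pmf[OF p])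
  \<comment> \<open>\<open>loc f\<close> agrees with \<open>f\<close> on \<open>S\<close> and
    vanishes elsewhere; as a finite combination of indicators of points it is measurable.\<close>
  define loc :: "(real^'n \<Rightarrow> real) \<Rightarrow> real^'n \<Rightarrow> real" where "loc f y = (\<Sum>z\<in>S. f z * indicator {z} y)"
      for f y
  have meas: "loc f \<in> borel_measurable borel" for f unfolding loc_def by measurable
  have on: "loc f y = f y" if "y \<in> S" for f y
  proof -
    have "loc f y = (\<Sum>z\<in>S. if z = y then f y else 0)"
      unfolding loc_def by (intro sum.cong) (auto simp: indicator_def)
    then show ?thesis using fin that by simp
  qed
  have eq: "scheme_op G \<sigma>0 p t h (loc f) x = scheme_op G \<sigma>0 p t h f x" for f
    by (rule scheme_op_cong, rule on) (unfold S_def, erule imageI)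
  have "loc \<phi> y \<le> loc \<psi> y" for y unfolding loc_def using le by (intro sum_mono mult_right_mono) auto
  then have "scheme_op G \<sigma>0 p t h (loc \<phi>) x \<le> scheme_op G \<sigma>0 p t h (loc \<psi>) x"
    using mon t meas unfolding monotone_scheme_def by blast
  then show ?thesis by (simp add: eq)
qed

text \<open>\<open>K1\<close> and \<open>K2\<close> have mean zero and annihilate constants, so
  \<open>c\<close> reaches \<open>G\<close> through y alone, where the Lipschitz constant
  applies.\<close>

lemma scheme_op_add_const:
  fixes G :: "'n::finite nonlinearity"
  assumes S2: "assumption_S2 T L G g" and t: "t \<in> {0..T}" and h: "0 < h" and p: "0 < p t x"
      "p t x < 1" and c: "0 \<le> c"
  shows "scheme_op G \<sigma>0 p t h (\<lambda>y. \<phi> y + c) x \<le> scheme_op G \<sigma>0 p t h \<phi> x + (1 + L * h) * c"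
proof -
  note int = integrable_xi_pmf[OF p]
  have "D0 \<sigma>0 p t h (\<lambda>y. \<phi> y + c) x = D0 \<sigma>0 p t h \<phi> x + c" by (simp add: D0_def int)
  moreover have "D1 \<sigma>0 p t h (\<lambda>y. \<phi> y + c) x = D1 \<sigma>0 p t h \<phi> x"
  proof -
    have "xi_mean (p t x) (\<lambda>\<xi>. \<xi>) = (0 :: real^'n)" by (rule expectation_xi_odd[OF p]) simp
    then show ?thesis unfolding D1_eq[where p=p and t=t and x=x, OF p]
        by (simp add: int scaleR_add_left)
  qed
  moreover have "D2 \<sigma>0 p t h (\<lambda>y. \<phi> y + c) x = D2 \<sigma>0 p t h \<phi> x"
    unfolding D2_eq[where p=p and t=t and x=x, OF p]
        by (simp add: int scaleR_add_left expectation_kern2[OF p])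
  moreover have "\<bar>G t x (y + c) z \<gamma> - G t x y z \<gamma>\<bar> \<le> L * c" if "\<gamma> \<in> sym_mats" for y z \<gamma>
    using nonlinearity_lipschitz[OF S2 t that that, of x "y + c" z y z] c by simp
  from this[OF D2_sym[where p=p and t=t and x=x, OF p], of "D0 \<sigma>0 p t h \<phi> x" "D1 \<sigma>0 p t h \<phi> x" \<sigma>0 h \<phi>]
  have "G t x (D0 \<sigma>0 p t h \<phi> x + c) (D1 \<sigma>0 p t h \<phi> x) (D2 \<sigma>0 p t h \<phi> x) \<le>
    G t x (D0 \<sigma>0 p t h \<phi> x) (D1 \<sigma>0 p t h \<phi> x) (D2 \<sigma>0 p t h \<phi> x) + L * c" by linarith
  then have "h * G t x (D0 \<sigma>0 p t h \<phi> x + c) (D1 \<sigma>0 p t h \<phi> x) (D2 \<sigma>0 p t h \<phi> x) \<le>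
    h * (G t x (D0 \<sigma>0 p t h \<phi> x) (D1 \<sigma>0 p t h \<phi> x) (D2 \<sigma>0 p t h \<phi> x) + L * c)"
    using h by (intro mult_left_mono) auto
  ultimately show ?thesis by (simp add: scheme_op_def F_op_def algebra_simps)
qed

text \<open>Monotonicity compares \<phi> with \<psi> + e, and the response of the operator to the
  added constant is known; exchanging \<phi> and \<psi> gives the other sign.\<close>

lemma scheme_op_stable:
  fixes G :: "'n::finite nonlinearity"
  assumes mon: "monotone_scheme T G \<sigma>0 p h0" and t: "t \<in> {0..<T}" "h \<in> {0<..h0}" "t + h \<le> T"
    and S2: "assumption_S2 T L G g" and p: "0 < p t x" "p t x < 1" and e: "\<And>y. \<bar>\<phi> y - \<psi> y\<bar> \<le> e"
  shows "\<bar>scheme_op G \<sigma>0 p t h \<phi> x - scheme_op G \<sigma>0 p t h \<psi> x\<bar> \<le> (1 + L * h) * e"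
proof -
  have e0: "0 \<le> e" using e[of undefined] by linarith
  have le: "scheme_op G \<sigma>0 p t h \<phi> x \<le> scheme_op G \<sigma>0 p t h \<psi> x + (1 + L * h) * e"
    if "\<And>y. \<phi> y \<le> \<psi> y + e" for \<phi> \<psi>
  proof -
    have "scheme_op G \<sigma>0 p t h \<phi> x \<le> scheme_op G \<sigma>0 p t h (\<lambda>y. \<psi> y + e) x"
      by (rule monotone_schemeD[OF mon t p]) (rule that)
    also have "\<dots> \<le> scheme_op G \<sigma>0 p t h \<psi> x + (1 + L * h) * e"
      using t p e0 by (intro scheme_op_add_const[OF S2]) auto
    finally show ?thesis .
  qed
  have le_e: "\<phi> y \<le> \<psi> y + e" "\<psi> y \<le> \<phi> y + e" for y using e[of y] by linarith+
  show ?thesis using le[of \<phi> \<psi>, OF le_e(1)] le[of \<psi> \<phi>, OF le_e(2)] by linarith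
qed

text \<open>The second order part of \<open>D0\<close> and the a0-term of \<open>F_op\<close> cancel
  up to O(h^2), which leaves one Euler step with \<open>G\<close>. The constants \<open>e0\<close>,
  \<open>e1\<close>, \<open>e2\<close> bound the errors in y, z and \<gamma> relative to h; surplus
  powers of h are absorbed by h \<le> T.\<close>

lemma scheme_op_consistency:
  fixes \<sigma>0 :: "'n::finite mat_fun" and b :: "real^'n"
  assumes S2: "assumption_S2 T L G g" and t: "t \<in> {0..T}" and hT: "h \<le> T"
    and p: "0 < p t x" "p t x \<le> 1 / 3" "1 / p t x \<le> K" and inv: "invertible (\<sigma>0 t x)"
    and nK: "norm (\<sigma>0 t x) \<le> K" "norm (matrix_inv (\<sigma>0 t x)) \<le> K" and h: "0 < h"
    and H: "H \<in> sym_mats" "norm H \<le> M" and odd: "\<And>\<xi>. a3 (- \<xi>) = - a3 \<xi>"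
    and bounds: "\<And>\<xi>. \<xi> \<in> set_pmf (xi_pmf (p t x)) \<Longrightarrow> \<bar>a3 \<xi>\<bar> \<le> M"
        "\<And>\<xi>. \<xi> \<in> set_pmf (xi_pmf (p t x)) \<Longrightarrow> \<bar>r \<xi>\<bar> \<le> M"
    and expansion: "\<And>\<xi>. \<xi> \<in> set_pmf (xi_pmf (p t x)) \<Longrightarrow> \<phi> (x + sqrt h *\<^sub>R (\<sigma>0 t x *v \<xi>)) =
      f0 + sqrt h * ((\<sigma>0 t x *v \<xi>) \<bullet> b) + (sqrt h)\<^sup>2 / 2 * ((\<sigma>0 t x *v \<xi>) \<bullet> (H *v (\<sigma>0 t x *v \<xi>)))
      + sqrt h ^ 3 * a3 \<xi> + sqrt h ^ 4 * r \<xi>"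
  defines "e0 \<equiv> K\<^sup>2 * M / 2 + M * T" and "e1 \<equiv> K * (M * sqrt (real CARD('n) * K)) * (1 + sqrt T)"
    and "e2 \<equiv> K * K * (M * ((real CARD('n))\<^sup>2 * K))"
  shows "\<bar>scheme_op G \<sigma>0 p t h \<phi> x - (f0 + h * G t x f0 b H)\<bar> \<le>
      (M + L * (e0 + e1 + e2) + K\<^sup>2 * e2 / 2) * h\<^sup>2"
proof -
  let ?a = "\<sigma>0 t x ** transpose (\<sigma>0 t x)"
  define y z \<gamma> where "y = D0 \<sigma>0 p t h \<phi> x" "z = D1 \<sigma>0 p t h \<phi> x" "\<gamma> = D2 \<sigma>0 p t h \<phi> x"
  have p1: "p t x < 1" using p by simp
  have M0: "0 \<le> M" using H(2) norm_ge_zero order_trans by blast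
  have K0: "0 \<le> K" using nK(1) norm_ge_zero order_trans by blast
  have L0: "0 \<le> L" using S2 t by (auto simp: assumption_S2_def lipschitz_on_def)
  have na: "\<bar>?a \<bullet> X\<bar> \<le> K\<^sup>2 * norm X" for X
  proof -
    have "\<bar>?a \<bullet> X\<bar> \<le> norm ?a * norm X" by (rule Cauchy_Schwarz_ineq2)
    also have "norm ?a \<le> norm (\<sigma>0 t x) * norm (transpose (\<sigma>0 t x))" by (rule norm_matrix_mult_le)
    also have "\<dots> \<le> K\<^sup>2" unfolding norm_transpose power2_eq_square using nK(1) K0
        by (intro mult_mono) auto
    finally show ?thesis by (simp add: mult_right_mono)
  qed
  have c0: "\<bar>y - (f0 + h / 2 * (?a \<bullet> H))\<bar> \<le> M * h\<^sup>2"
    unfolding y_z_\<gamma>_def by (rule D0_consistency[where p=p and t=t and x=x and ?\<sigma>0.0=\<sigma>0 and \<phi>=\<phi> and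
        ?a3.0=a3 and r=r, OF p inv nK h H odd bounds expansion])
  have c1: "norm (z - b) \<le> e1 * h"
  proof -
    have "norm (z - b) \<le> K * (M * sqrt (real CARD('n) * K)) * (1 + sqrt h) * h"
      unfolding y_z_\<gamma>_def by (rule D1_consistency[where p=p and t=t and x=x and ?\<sigma>0.0=\<sigma>0 and \<phi>=\<phi> and
          ?a3.0=a3 and r=r, OF p inv nK h H odd bounds expansion])
    also have "\<dots> \<le> e1 * h" unfolding e1_def using h hT K0 M0
        by (intro mult_right_mono mult_left_mono) auto
    finally show ?thesis .
  qed
  have c2: "norm (\<gamma> - H) \<le> e2 * h"
    unfolding y_z_\<gamma>_def e2_def by (rule D2_consistency[where p=p and t=t and x=x and ?\<sigma>0.0=\<sigma>0 and
        \<phi>=\<phi> and ?a3.0=a3 and r=r, OF p inv nK h H odd bounds expansion])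
  have y0: "\<bar>y - f0\<bar> \<le> e0 * h"
  proof -
    have "\<bar>h / 2 * (?a \<bullet> H)\<bar> \<le> h / 2 * (K\<^sup>2 * M)"
    proof -
      have "\<bar>?a \<bullet> H\<bar> \<le> K\<^sup>2 * M" using na[of H] H(2) mult_left_mono[of "norm H" M "K\<^sup>2"] by simp
      then show ?thesis using h by (simp add: abs_mult mult_left_mono)
    qed
    moreover have "M * h\<^sup>2 \<le> M * T * h"
      using h hT M0 by (simp add: power2_eq_square mult.assoc mult_left_mono mult_right_mono)
    ultimately have "\<bar>y - f0\<bar> \<le> h / 2 * (K\<^sup>2 * M) + M * T * h" using c0 by linarith
    then show ?thesis by (simp add: e0_def algebra_simps)
  qed
  have "\<bar>G t x y z \<gamma> - G t x f0 b H\<bar> \<le> L * (\<bar>y - f0\<bar> + norm (z - b) + norm (\<gamma> - H))"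
    by (rule nonlinearity_lipschitz[OF S2 t _ H(1)]) (simp add: y_z_\<gamma>_def D2_sym[where p=p and t=t
      and x=x, OF p(1) p1])
  also have "\<dots> \<le> L * (e0 * h + e1 * h + e2 * h)" using L0 y0 c1 c2 by (intro mult_left_mono add_mono)
  finally have "\<bar>h * (G t x y z \<gamma> - G t x f0 b H)\<bar> \<le> h * (L * (e0 * h + e1 * h + e2 * h))"
    using h by (simp add: abs_mult mult_left_mono)
  moreover have "\<bar>?a \<bullet> (\<gamma> - H)\<bar> \<le> K\<^sup>2 * (e2 * h)"
      using na[of "\<gamma> - H"] mult_left_mono[OF c2, of "K\<^sup>2"] by simp
  then have "\<bar>h / 2 * (?a \<bullet> (\<gamma> - H))\<bar> \<le> h / 2 * (K\<^sup>2 * (e2 * h))" using h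
      by (simp add: abs_mult mult_left_mono)
  moreover have "scheme_op G \<sigma>0 p t h \<phi> x - (f0 + h * G t x f0 b H) =
    (y - (f0 + h / 2 * (?a \<bullet> H))) + h * (G t x y z \<gamma> - G t x f0 b H) - h / 2 * (?a \<bullet> (\<gamma> - H))"
    unfolding scheme_op_def F_op_def inner_diff_right by (simp flip: y_z_\<gamma>_def) (simp add: field_simps)
  ultimately have "\<bar>scheme_op G \<sigma>0 p t h \<phi> x - (f0 + h * G t x f0 b H)\<bar> \<le>
    M * h\<^sup>2 + h * (L * (e0 * h + e1 * h + e2 * h)) + h / 2 * (K\<^sup>2 * (e2 * h))"
    using c0 by linarith
  also have "\<dots> = (M + L * (e0 + e1 + e2) + K\<^sup>2 * e2 / 2) * h\<^sup>2"
    by (simp add: algebra_simps power2_eq_square)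
  finally show ?thesis .
qed

section \<open>Regularity in time and the local error of the exact solution\<close>

lemma bounded_on_stripD:
  assumes "bounded_on_strip T f"
  shows "\<exists>B\<ge>0. \<forall>t\<in>{0..T}. \<forall>x. norm (f t x) \<le> B"
proof -
  obtain B where B: "\<forall>v\<in>(\<lambda>(t, x). f t x) ` strip T. norm v \<le> B"
    using assms by (auto simp: bounded_on_strip_def bounded_iff)
  have "norm (f t x) \<le> \<bar>B\<bar>" if "t \<in> {0..T}" for t x
  proof -
    have "f t x \<in> (\<lambda>(t, x). f t x) ` strip T" using that by force
    then have "norm (f t x) \<le> B" using B by blast
    then show ?thesis by simp
  qed
  then show ?thesis by (intro exI[of _ "\<bar>B\<bar>"]) auto
qed

lemma C2b_time_lipschitz:
  assumes "C2b T v"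
  shows "\<exists>B\<ge>0. \<forall>t\<in>{0..T}. \<forall>s\<in>{0..T}. \<forall>x. \<bar>v t x - v s x\<bar> \<le> B * \<bar>t - s\<bar>"
proof -
  obtain vt Dv D2v where C: "C2b_with T v vt Dv D2v" using assms by (auto simp: C2b_def)
  then obtain B where B: "0 \<le> B" "\<And>t x. t \<in> {0..T} \<Longrightarrow> \<bar>vt t x\<bar> \<le> B"
    using bounded_on_stripD[of T vt] by (auto simp: C2b_with_def)
  have "\<bar>v t x - v s x\<bar> \<le> B * \<bar>t - s\<bar>" if "t \<in> {0..T}" "s \<in> {0..T}" for t s x
    using field_differentiable_bound[of "{0..T}" "\<lambda>s. v s x" "\<lambda>s. vt s x" B t s] C that B(2)
    by (auto simp: C2b_with_def C12_with_def)
  then show ?thesis using B(1) by blast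
qed

text \<open>The mean value theorem, with a Lipschitz bound for f' in the role of a second
  derivative. The derivative within [0, T] is restricted to [t, t + h], since it is one-sided at the
  end points.\<close>

lemma time_taylor_bound:
  assumes "\<And>s. s \<in> {0..T} \<Longrightarrow> (f has_real_derivative f' s) (at s within {0..T})"
    and B: "0 \<le> B" "\<And>s s'. s \<in> {0..T} \<Longrightarrow> s' \<in> {0..T} \<Longrightarrow> \<bar>f' s - f' s'\<bar> \<le> B * \<bar>s - s'\<bar>"
    and t: "0 \<le> t" "0 < h" "t + h \<le> T"
  shows "\<bar>f (t + h) - f t - h * f' t\<bar> \<le> B * h\<^sup>2"
proof -
  have "(f has_derivative (\<lambda>d. f' s * d)) (at s within {t..t + h})" if "t \<le> s" "s \<le> t + h" for s
    by (rule has_derivative_subset[OF assms(1)[unfolded has_field_derivative_def]]) (use t that in auto)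
  then have "\<exists>s\<in>{t<..<t + h}. f (t + h) - f t = f' s * (t + h - t)"
    using t(2) by (intro mvt_simple[of t "t + h" f "\<lambda>s d. f' s * d"]) auto
  then obtain s where "s \<in> {t<..<t + h}" and fs: "f (t + h) - f t = f' s * (t + h - t)" by blast
  then have s: "t < s" "s < t + h" by auto
  have "f (t + h) - f t - h * f' t = h * (f' s - f' t)" using fs by (simp add: algebra_simps)
  also have "\<bar>\<dots>\<bar> \<le> h * (B * \<bar>s - t\<bar>)"
    using B(2)[of s t] s t by (simp add: abs_mult)
  also have "\<dots> \<le> h * (B * h)" using s t B(1) by (intro mult_left_mono) auto
  finally show ?thesis by (simp add: power2_eq_square mult_ac)
qed

text \<open>The components may themselves be vectors, so that two applications treat a matrix row by
  row.\<close>

lemma vec_time_lipschitz: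
  fixes v :: "real \<Rightarrow> real^'n \<Rightarrow> 'b::real_normed_vector^'m"
  assumes "\<And>i. \<exists>B\<ge>0. \<forall>t\<in>{0..T}. \<forall>s\<in>{0..T}. \<forall>x. norm (v t x $ i - v s x $ i) \<le> B * \<bar>t - s\<bar>"
  shows "\<exists>B\<ge>0. \<forall>t\<in>{0..T}. \<forall>s\<in>{0..T}. \<forall>x. norm (v t x - v s x) \<le> B * \<bar>t - s\<bar>"
proof -
  have "\<forall>i. \<exists>B. 0 \<le> B \<and> (\<forall>t\<in>{0..T}. \<forall>s\<in>{0..T}. \<forall>x. norm (v t x $ i - v s x $ i) \<le> B * \<bar>t - s\<bar>)"
    using assms by blast
  from choice[OF this] obtain B where B: "\<And>i. 0 \<le> B i"
    "\<And>i t s x. t \<in> {0..T} \<Longrightarrow> s \<in> {0..T} \<Longrightarrow> norm (v t x $ i - v s x $ i) \<le> B i * \<bar>t - s\<bar>"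
    by blast
  have "norm (v t x - v s x) \<le> (\<Sum>i\<in>UNIV. B i) * \<bar>t - s\<bar>" if "t \<in> {0..T}" "s \<in> {0..T}" for t s x
  proof -
    have "norm (v t x - v s x) \<le> (\<Sum>i\<in>UNIV. norm ((v t x - v s x) $ i))"
      unfolding norm_vec_def by (rule L2_set_le_sum) simp
    also have "\<dots> \<le> (\<Sum>i\<in>UNIV. B i * \<bar>t - s\<bar>)" using B(2)[OF that] by (intro sum_mono) simp
    finally show ?thesis by (simp add: sum_distrib_right)
  qed
  moreover have "0 \<le> (\<Sum>i\<in>UNIV. B i)" by (intro sum_nonneg B)
  ultimately show ?thesis by blast
qed

lemma double_sum_bound:
  fixes v :: "real^'n" and q m :: "'n \<Rightarrow> 'n \<Rightarrow> real"
  assumes "\<And>i j. \<bar>q i j\<bar> \<le> m i j * c" "norm v \<le> V" "\<And>i j. 0 \<le> m i j" "0 \<le> c"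
  shows "\<bar>\<Sum>i\<in>UNIV. \<Sum>j\<in>UNIV. v$i * v$j * q i j\<bar> \<le> V\<^sup>2 * c * (\<Sum>i\<in>UNIV. \<Sum>j\<in>UNIV. m i j)"
proof -
  have v: "\<bar>v$i\<bar> \<le> V" for i using component_le_norm_cart[of v i] assms(2) by linarith
  have V0: "0 \<le> V" using assms(2) norm_ge_zero order_trans by blast
  have "\<bar>v$i * v$j * q i j\<bar> \<le> V * V * (m i j * c)" for i j
    unfolding abs_mult by (intro mult_mono v assms(1) mult_nonneg_nonneg V0) auto
  then have "\<bar>\<Sum>i\<in>UNIV. \<Sum>j\<in>UNIV. v$i * v$j * q i j\<bar> \<le> (\<Sum>i\<in>UNIV. \<Sum>j\<in>UNIV. V * V * (m i j * c))"
    by (intro order_trans[OF sum_abs] sum_mono)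
  also have "\<dots> = V\<^sup>2 * c * (\<Sum>i\<in>UNIV. \<Sum>j\<in>UNIV. m i j)"
    by (simp add: sum_distrib_left power2_eq_square mult_ac)
  finally show ?thesis .
qed

text \<open>Space is expanded at time t + h, where the operator evaluates \<open>u\<close>;
  afterwards \<open>u\<close> and the arguments of \<open>G\<close> are moved back to t by their
  Lipschitz bounds in time.\<close>

lemma exact_solution_consistency:
  fixes G :: "'n::finite nonlinearity"
  assumes T: "0 < T" and S2: "assumption_S2 T L G g" and sd: "scheme_data T K \<sigma>0 p"
    and p3: "\<And>t x. t \<in> {0..T} \<Longrightarrow> p t x \<le> 1 / 3"
    and visc: "viscosity_solution T G g u" and C4: "C4b T u"
  shows "\<exists>C\<ge>0. \<forall>t\<in>{0..<T}. \<forall>h>0. t + h \<le> T \<longrightarrow> (\<forall>x. \<bar>scheme_op G \<sigma>0 p t h (u (t + h)) x - u t x\<bar> \<le>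
      C * h\<^sup>2)"
proof -
  obtain ut Du D2u where C2: "C2b_with T u ut Du D2u" and Cut: "C2b T ut"
    and CDu: "\<And>i. C2b T (\<lambda>t x. Du t x $ i)" and CD2: "\<And>i j. C2b T (\<lambda>t x. D2u t x $ i $ j)"
    using C4 unfolding C4b_def by blast
  have C12: "C12_with T u ut Du D2u" using C2 by (simp add: C2b_with_def)
  \<comment> \<open>Derivatives of the Hessian are given entry by entry; repeated choice turns them
    into families indexed by i and j.\<close>
  have "\<forall>i. \<exists>H3. \<forall>j. \<exists>H4 q. C2b_with T (\<lambda>t x. D2u t x $ i $ j) q (H3 j) H4"
  proof
    fix i
    have "\<forall>j. \<exists>H3 H4 q. C2b_with T (\<lambda>t x. D2u t x $ i $ j) q H3 H4" using CD2 unfolding C2b_def by blast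
    from choice[OF this] show "\<exists>H3. \<forall>j. \<exists>H4 q. C2b_with T (\<lambda>t x. D2u t x $ i $ j) q (H3 j) H4" .
  qed
  from choice[OF this] obtain H3 where "\<forall>i j. \<exists>H4 q. C2b_with T (\<lambda>t x. D2u t x $ i $ j) q (H3 i j)
      H4" by blast
  then have "\<forall>i. \<exists>H4. \<forall>j. \<exists>q. C2b_with T (\<lambda>t x. D2u t x $ i $ j) q (H3 i j) (H4 j)"
    by (intro allI choice) blast
  from choice[OF this] obtain H4 where H34: "\<And>i j. \<exists>q. C2b_with T (\<lambda>t x. D2u t x $ i $ j) q (H3 i j)
      (H4 i j)" by blast
  have "\<forall>ij. \<exists>B\<ge>0. \<forall>t\<in>{0..T}. \<forall>x. norm (H3 (fst ij) (snd ij) t x) \<le> B"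
    using H34 by (intro allI bounded_on_stripD) (auto simp: C2b_with_def)
  from choice[OF this] obtain m3 where m3: "\<And>i j. 0 \<le> m3 (i, j)"
      "\<And>i j t x. t \<in> {0..T} \<Longrightarrow> norm (H3 i j t x) \<le> m3 (i, j)"
    by (metis fst_conv snd_conv)
  have "\<forall>ij. \<exists>B\<ge>0. \<forall>t\<in>{0..T}. \<forall>x. norm (H4 (fst ij) (snd ij) t x) \<le> B"
    using H34 by (intro allI bounded_on_stripD) (auto simp: C2b_with_def)
  from choice[OF this] obtain m4 where m4: "\<And>i j. 0 \<le> m4 (i, j)"
      "\<And>i j t x. t \<in> {0..T} \<Longrightarrow> norm (H4 i j t x) \<le> m4 (i, j)"
    by (metis fst_conv snd_conv)
  obtain m2 where m2: "0 \<le> m2" "\<And>t x. t \<in> {0..T} \<Longrightarrow> norm (D2u t x) \<le> m2"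
    using bounded_on_stripD[of T D2u] C2 by (auto simp: C2b_with_def)
  have "C2b T u" using C2 by (auto simp: C2b_def)
  then obtain B0 where B0: "0 \<le> B0" "\<And>t s x. t \<in> {0..T} \<Longrightarrow> s \<in> {0..T} \<Longrightarrow> \<bar>u t x - u s x\<bar> \<le> B0 * \<bar>t - s\<bar>"
    using C2b_time_lipschitz by blast
  obtain Bt where Bt: "0 \<le> Bt" "\<And>t s x. t \<in> {0..T} \<Longrightarrow> s \<in> {0..T} \<Longrightarrow> \<bar>ut t x - ut s x\<bar> \<le> Bt * \<bar>t - s\<bar>"
    using C2b_time_lipschitz[OF Cut] by blast
  have "\<exists>B\<ge>0. \<forall>t\<in>{0..T}. \<forall>s\<in>{0..T}. \<forall>x. norm (Du t x - Du s x) \<le> B * \<bar>t - s\<bar>"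
    using C2b_time_lipschitz[OF CDu] by (intro vec_time_lipschitz) simp
  then obtain B1 where B1: "0 \<le> B1" "\<And>t s x. t \<in> {0..T} \<Longrightarrow> s \<in> {0..T} \<Longrightarrow> norm (Du t x - Du s x) \<le>
      B1 * \<bar>t - s\<bar>"
    by blast
  have "\<exists>B\<ge>0. \<forall>t\<in>{0..T}. \<forall>s\<in>{0..T}. \<forall>x. norm (D2u t x $ i - D2u s x $ i) \<le> B * \<bar>t - s\<bar>" for i
    using C2b_time_lipschitz[OF CD2, of i] by (intro vec_time_lipschitz[of _ "\<lambda>t x. D2u t x $ i"]) simp
  then have "\<exists>B\<ge>0. \<forall>t\<in>{0..T}. \<forall>s\<in>{0..T}. \<forall>x. norm (D2u t x - D2u s x) \<le> B * \<bar>t - s\<bar>"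
    by (rule vec_time_lipschitz)
  then obtain B2 where B2: "0 \<le> B2" "\<And>t s x. t \<in> {0..T} \<Longrightarrow> s \<in> {0..T} \<Longrightarrow> norm (D2u t x - D2u s x) \<le>
      B2 * \<bar>t - s\<bar>"
    by blast
  have derivs: "((\<lambda>s. u s x) has_real_derivative ut t x) (at t within {0..T})"
      "GDERIV (u t) x :> Du t x"
    "(Du t has_derivative (\<lambda>v. D2u t x *v v)) (at x)"
    "GDERIV (\<lambda>x. D2u t x $ i $ j) x :> H3 i j t x"
        "(H3 i j t has_derivative (\<lambda>v. H4 i j t x *v v)) (at x)"
    if "t \<in> {0..T}" for t x i j
    using that C12 H34[of i j] by (auto simp: C12_with_def C2b_with_def)
  have D2sym: "D2u t x \<in> sym_mats" if "t \<in> {0..T}" for t x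
  proof (rule hessian_sym_mats[OF derivs(2)[OF that] derivs(3)[OF that]])
    have "continuous_on (strip T) (\<lambda>(t, x). D2u t x)" using C12 by (simp add: C12_with_def)
    then have "continuous_on UNIV (\<lambda>x. (\<lambda>(t, x). D2u t x) (t, x))"
      by (rule continuous_on_compose2) (use that in \<open>auto intro: continuous_on_Pair
        continuous_on_const continuous_on_id\<close>)
    then show "continuous_on UNIV (D2u t)" by simp
  qed
  have pde: "ut t x = - G t x (u t x) (Du t x) (D2u t x)" if "t \<in> {0..<T}" for t x
  proof (rule antisym)
    have "- ut t x - G t x (u t x) (Du t x) (D2u t x) \<le> 0"
      using visc that C12 unfolding viscosity_solution_def viscosity_subsolution_def by fastforce
    then show "- G t x (u t x) (Du t x) (D2u t x) \<le> ut t x" by linarith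
    have "0 \<le> - ut t x - G t x (u t x) (Du t x) (D2u t x)"
      using visc that C12 unfolding viscosity_solution_def viscosity_supersolution_def by fastforce
    then show "ut t x \<le> - G t x (u t x) (Du t x) (D2u t x)" by linarith
  qed
  have K0: "0 \<le> K"
  proof -
    have "norm (\<sigma>0 0 0) \<le> K" using sd T by (auto simp: scheme_data_def)
    then show ?thesis using norm_ge_zero order_trans by blast
  qed
  have L0: "0 \<le> L" using S2 T by (auto simp: assumption_S2_def lipschitz_on_def)
  \<comment> \<open>Bounds |\<sigma>0 \<xi>|, because |\<xi>| \<le> sqrt (d / p) and 1 / p \<le>
    K.\<close>
  define V where "V = K * sqrt (real CARD('n) * K)"
  have V0: "0 \<le> V" using K0 by (simp add: V_def)
  define S3 where "S3 = (\<Sum>i\<in>UNIV. \<Sum>j\<in>UNIV. m3 (i, j))"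
  define S4 where "S4 = (\<Sum>i\<in>UNIV. \<Sum>j\<in>UNIV. m4 (i, j))"
  have S0: "0 \<le> S3" "0 \<le> S4" by (auto simp: S3_def S4_def intro!: sum_nonneg m3(1) m4(1))
  \<comment> \<open>One constant that dominates the Hessian, the cubic coefficient and the
    remainder, as the truncation estimates require.\<close>
  define M where "M = m2 + V\<^sup>2 * V * S3 + V\<^sup>2 * (V * V) * S4"
  have M_ge: "m2 \<le> M" "V\<^sup>2 * V * S3 \<le> M" "V\<^sup>2 * (V * V) * S4 \<le> M"
    using m2(1) V0 S0 by (auto simp: M_def)
  have M0: "0 \<le> M" using m2(1) M_ge(1) by linarith
  define e0 where "e0 = K\<^sup>2 * M / 2 + M * T"
  define e1 where "e1 = K * (M * sqrt (real CARD('n) * K)) * (1 + sqrt T)"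
  define e2 where "e2 = K * K * (M * ((real CARD('n))\<^sup>2 * K))"
  have e0: "0 \<le> e0" "0 \<le> e1" "0 \<le> e2" using K0 M0 T by (auto simp: e0_def e1_def e2_def)
  define C where "C = (M + L * (e0 + e1 + e2) + K\<^sup>2 * e2 / 2) + Bt + L * (B0 + B1 + B2)"
  have C0: "0 \<le> C" using e0 M0 L0 Bt(1) B0(1) B1(1) B2(1) by (simp add: C_def)
  have "\<bar>scheme_op G \<sigma>0 p t h (u (t + h)) x - u t x\<bar> \<le> C * h\<^sup>2"
    if t: "t \<in> {0..<T}" and h: "0 < h" and th: "t + h \<le> T" for t h x
  proof -
    let ?s = "\<sigma>0 t x" and ?t = "t + h"
    have t': "t \<in> {0..T}" and t1: "?t \<in> {0..T}" using t h th by auto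
    have inv: "invertible ?s" and nK: "norm ?s \<le> K" "norm (matrix_inv ?s) \<le> K"
      and p: "0 < p t x" "p t x < 1" "1 / p t x \<le> K" using sd t' by (auto simp: scheme_data_def)
    have sh: "0 < sqrt h" using h by simp
    have "\<forall>v. \<exists>\<tau>. u ?t (x + sqrt h *\<^sub>R v) = u ?t x + sqrt h * (v \<bullet> Du ?t x) +
        (sqrt h)\<^sup>2 / 2 * (v \<bullet> (D2u ?t x *v v)) +
      sqrt h ^ 3 * ((\<Sum>i\<in>UNIV. \<Sum>j\<in>UNIV. v$i * v$j * (v \<bullet> H3 i j ?t x)) / 6) +
      sqrt h ^ 4 * ((\<Sum>i\<in>UNIV. \<Sum>j\<in>UNIV. v$i * v$j * (v \<bullet> (H4 i j ?t (x + \<tau> *\<^sub>R v) *v v))) / 24)"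
      by (intro allI taylor4_along_line derivs[OF t1] sh)
    from choice[OF this] obtain \<tau> where \<tau>: "\<And>v. u ?t (x + sqrt h *\<^sub>R v) =
        u ?t x + sqrt h * (v \<bullet> Du ?t x) + (sqrt h)\<^sup>2 / 2 * (v \<bullet> (D2u ?t x *v v)) +
      sqrt h ^ 3 * ((\<Sum>i\<in>UNIV. \<Sum>j\<in>UNIV. v$i * v$j * (v \<bullet> H3 i j ?t x)) / 6) +
      sqrt h ^ 4 * ((\<Sum>i\<in>UNIV. \<Sum>j\<in>UNIV. v$i * v$j * (v \<bullet> (H4 i j ?t (x + \<tau> v *\<^sub>R v) *v v))) / 24)"
      by blast
    \<comment> \<open>\<open>A3\<close> is odd in \<open>v\<close>. The point \<tau> depends on
      \<open>v\<close>, so no parity is claimed for \<open>A4\<close>, which is only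
      bounded.\<close>
    define A3 where "A3 v = (\<Sum>i\<in>UNIV. \<Sum>j\<in>UNIV. v$i * v$j * (v \<bullet> H3 i j ?t x)) / 6" for v
    define A4 where "A4 v = (\<Sum>i\<in>UNIV. \<Sum>j\<in>UNIV. v$i * v$j * (v \<bullet> (H4 i j ?t (x +
        \<tau> v *\<^sub>R v) *v v))) / 24" for v
    have nv: "norm (?s *v \<xi>) \<le> V" if "\<xi> \<in> set_pmf (xi_pmf (p t x))" for \<xi>
    proof -
      have "norm \<xi> \<le> sqrt (real CARD('n) / p t x)" by (rule norm_xi_le[OF p(1,2) that])
      also have "\<dots> \<le> sqrt (real CARD('n) * K)" using mult_left_mono[OF p(3), of "real CARD('n)"] by simp
      finally have "norm ?s * norm \<xi> \<le> V" unfolding V_def using nK K0 by (intro mult_mono) auto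
      then show ?thesis using norm_matrix_vector_mult_le[of ?s \<xi>] by linarith
    qed
    have b3: "\<bar>A3 v\<bar> \<le> M" if "norm v \<le> V" for v
    proof -
      have "\<bar>v \<bullet> H3 i j ?t x\<bar> \<le> m3 (i, j) * V" for i j
        using order_trans[OF Cauchy_Schwarz_ineq2 mult_mono'[OF that m3(2)[OF t1]]]
            by (simp add: mult.commute)
      from double_sum_bound[OF this that m3(1) V0] have "\<bar>6 * A3 v\<bar> \<le> V\<^sup>2 * V * S3"
          by (simp add: A3_def S3_def)
      then show ?thesis using M_ge(2) by linarith
    qed
    have b4: "\<bar>A4 v\<bar> \<le> M" if "norm v \<le> V" for v
    proof -
      have "\<bar>v \<bullet> (H4 i j ?t y *v v)\<bar> \<le> m4 (i, j) * (V * V)" for i j y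
      proof -
        have "\<bar>v \<bullet> (H4 i j ?t y *v v)\<bar> \<le> norm v * (norm (H4 i j ?t y) * norm v)"
          using order_trans[OF Cauchy_Schwarz_ineq2 mult_left_mono[OF norm_matrix_vector_mult_le]]
              by simp
        also have "\<dots> \<le> V * (m4 (i, j) * V)"
          by (intro mult_mono that m4 t1 V0 mult_nonneg_nonneg norm_ge_zero)
        finally show ?thesis by (simp add: mult_ac)
      qed
      from double_sum_bound[OF this that m4(1)] have "\<bar>24 * A4 v\<bar> \<le> V\<^sup>2 * (V * V) * S4"
        using V0 by (simp add: A4_def S4_def)
      then show ?thesis using M_ge(3) by linarith
    qed
    have odd: "A3 (?s *v (- \<xi>)) = - A3 (?s *v \<xi>)" for \<xi>
    proof -
      have "?s *v (- \<xi>) = - (?s *v \<xi>)" by (simp add: linear_neg matrix_vector_mul_linear)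
      then show ?thesis by (simp add: A3_def sum_negf)
    qed
    have exp: "u ?t (x + sqrt h *\<^sub>R (?s *v \<xi>)) = u ?t x + sqrt h * ((?s *v \<xi>) \<bullet> Du ?t x) +
        (sqrt h)\<^sup>2 / 2 * ((?s *v \<xi>) \<bullet> (D2u ?t x *v (?s *v \<xi>))) + sqrt h ^ 3 * A3 (?s *v \<xi>) +
            sqrt h ^ 4 * A4 (?s *v \<xi>)" for \<xi>
      unfolding A3_def A4_def by (rule \<tau>)
    have hT: "h \<le> T" using t th by simp
    have "\<bar>scheme_op G \<sigma>0 p t h (u ?t) x - (u ?t x + h * G t x (u ?t x) (Du ?t x) (D2u ?t x))\<bar>
       \<le> (M + L * (e0 + e1 + e2) + K\<^sup>2 * e2 / 2) * h\<^sup>2"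
      unfolding e0_def e1_def e2_def
      by (rule scheme_op_consistency[where G=G and ?\<sigma>0.0=\<sigma>0 and p=p and t=t and x=x and h=h and \<phi>="u
        ?t" and ?f0.0="u ?t x"
            and b="Du ?t x" and H="D2u ?t x" and M=M and ?a3.0="\<lambda>\<xi>. A3 (?s *v \<xi>)"
                and r="\<lambda>\<xi>. A4 (?s *v \<xi>)",
            OF S2 t' hT p(1) p3[OF t'] p(3) inv nK h D2sym[OF t1] order_trans[OF m2(2)[OF t1]
                M_ge(1)] odd b3[OF nv] b4[OF nv] exp])
    moreover have "\<bar>u ?t x - u t x - h * ut t x\<bar> \<le> Bt * h\<^sup>2"
      by (rule time_taylor_bound[of T "\<lambda>s. u s x" "\<lambda>s. ut s x"]) (use derivs(1) Bt t h th in auto)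
    moreover have "\<bar>h * (G t x (u ?t x) (Du ?t x) (D2u ?t x) - G t x (u t x) (Du t x) (D2u t x))\<bar> \<le>
        L * (B0 + B1 + B2) * h\<^sup>2"
    proof -
      have "\<bar>G t x (u ?t x) (Du ?t x) (D2u ?t x) - G t x (u t x) (Du t x) (D2u t x)\<bar>
        \<le> L * (\<bar>u ?t x - u t x\<bar> + norm (Du ?t x - Du t x) + norm (D2u ?t x - D2u t x))"
        by (rule nonlinearity_lipschitz[OF S2 t' D2sym[OF t1] D2sym[OF t']])
      also have "\<dots> \<le> L * (B0 * h + B1 * h + B2 * h)"
        using B0(2)[OF t1 t', of x] B1(2)[OF t1 t', of x] B2(2)[OF t1 t', of x] h L0
        by (intro mult_left_mono add_mono) auto
      finally have "h * \<bar>G t x (u ?t x) (Du ?t x) (D2u ?t x) - G t x (u t x) (Du t x) (D2u t x)\<bar> \<le>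
          h * (L * (B0 * h + B1 * h + B2 * h))"
        using h by (intro mult_left_mono) auto
      also have "\<dots> = L * (B0 + B1 + B2) * h\<^sup>2" by (simp add: algebra_simps power2_eq_square)
      finally show ?thesis using h by (simp add: abs_mult)
    qed
    \<comment> \<open>Truncation in space, Taylor remainder in time, and the shift of the arguments
      of \<open>G\<close> from t + h to t; the equation at t cancels the terms of first order in
      h.\<close>
    moreover have "scheme_op G \<sigma>0 p t h (u ?t) x - u t x =
      (scheme_op G \<sigma>0 p t h (u ?t) x - (u ?t x + h * G t x (u ?t x) (Du ?t x) (D2u ?t x))) +
          (u ?t x - u t x - h * ut t x)
      + h * (G t x (u ?t x) (Du ?t x) (D2u ?t x) - G t x (u t x) (Du t x) (D2u t x))"
      using pde[OF t, of x] by (simp add: algebra_simps)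
    ultimately have "\<bar>scheme_op G \<sigma>0 p t h (u ?t) x - u t x\<bar> \<le>
      (M + L * (e0 + e1 + e2) + K\<^sup>2 * e2 / 2) * h\<^sup>2 + Bt * h\<^sup>2 + L * (B0 + B1 + B2) * h\<^sup>2"
      by linarith
    then show ?thesis unfolding C_def distrib_right[of _ _ "h\<^sup>2"] .
  qed
  then show ?thesis using C0 by blast
qed

section \<open>Accumulation of the local errors\<close>

lemma convergence_rate:
  fixes G :: "'n::finite nonlinearity"
  assumes T: "0 < T" and st: "standing_assumptions T B L G g" and M: "assumption_M T K G \<sigma>0 p"
    and mon: "monotone_scheme T G \<sigma>0 p h0" and visc: "viscosity_solution T G g u" and C4: "C4b T u"
  shows "\<exists>C. \<forall>n\<ge>1. T / real n < h0 \<longrightarrow> (\<forall>t\<in>{0..T}. \<forall>x. \<bar>u_h T G g \<sigma>0 p n t x - u t x\<bar> \<le> C * (T / real n))"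
proof -
  have S2: "assumption_S2 T L G g" using st by (simp add: standing_assumptions_def)
  have L0: "0 \<le> L" using S2 T by (auto simp: assumption_S2_def lipschitz_on_def)
  have sd: "scheme_data T K \<sigma>0 p" and M2: "assumption_M2 T G \<sigma>0 p" using M
      by (auto simp: assumption_M_def)
  have p3: "p t x \<le> 1 / 3" if "t \<in> {0..T}" for t x
    using M2 that by (auto simp: assumption_M2_def p_range_def Let_def)
  have p: "0 < p t x" "p t x < 1" if "t \<in> {0..T}" for t x using sd that by (auto simp: scheme_data_def)
  have terminal: "u T = g"
    using visc by (auto simp: viscosity_solution_def viscosity_subsolution_def
        viscosity_supersolution_def fun_eq_iff intro: antisym)
  obtain C where C0: "0 \<le> C" and C: "\<And>t h x. t \<in> {0..<T} \<Longrightarrow> 0 < h \<Longrightarrow> t + h \<le> T \<Longrightarrow>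
      \<bar>scheme_op G \<sigma>0 p t h (u (t + h)) x - u t x\<bar> \<le> C * h\<^sup>2"
    using exact_solution_consistency[OF T S2 sd p3 visc C4] by blast
  \<comment> \<open>Step length and starting function are arbitrary, so this serves the full grid
    steps as well as the shorter step to a time between grid points.\<close>
  have step: "\<bar>scheme_op G \<sigma>0 p t h \<phi> x - u t x\<bar> \<le> (1 + L * h) * e + C * h\<^sup>2"
    if "t \<in> {0..<T}" "h \<in> {0<..h0}" "t + h \<le> T" "\<And>y. \<bar>\<phi> y - u (t + h) y\<bar> \<le> e" for t h \<phi> e x
  proof -
    have "\<bar>scheme_op G \<sigma>0 p t h \<phi> x - scheme_op G \<sigma>0 p t h (u (t + h)) x\<bar> \<le> (1 + L * h) * e"
      using that p[of t x] by (intro scheme_op_stable[OF mon _ _ _ S2]) auto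
    then show ?thesis using C[of t h x] that by auto
  qed
  \<comment> \<open>C T exp (L T) is the factor accumulated at grid times; 1 + L T and the summand C
    T come from one further, possibly shorter step.\<close>
  have main: "\<bar>u_h T G g \<sigma>0 p n t x - u t x\<bar> \<le>
      ((1 + L * T) * (C * T * exp (L * T)) + C * T) * (T / real n)"
    if n: "1 \<le> n" and nh: "T / real n < h0" and t: "t \<in> {0..T}" for n t x
  proof -
    define h where "h = T / real n"
    have h: "0 < h" "h < h0" and nhT: "real n * h = T" using T n nh by (auto simp: h_def)
    have hT: "h \<le> T" using nhT h(1) n by (metis mult_le_cancel_right1 of_nat_1 of_nat_le_iff
        order_less_imp_not_less)
    \<comment> \<open>This form closes under induction: 1 + L h \<le> exp (L h), and the new local
      error may be enlarged by the factor \<open>exp (L * h) ^ Suc k\<close> \<ge> 1.\<close>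
    have grid: "\<bar>u_grid T G g \<sigma>0 p n k y - u (real (n - k) * h) y\<bar> \<le>
        real k * (C * h\<^sup>2) * exp (L * h) ^ k" if "k \<le> n" for k y
      using that
    proof (induction k arbitrary: y)
      case 0
      then show ?case by (simp add: nhT terminal)
    next
      case (Suc k)
      \<comment> \<open>The index k counts backwards from T, so the new level lies one step earlier
        than the old one.\<close>
      define s where "s = real (n - Suc k) * h"
      have nk: "real (n - k) = real (n - Suc k) + 1" using Suc.prems by (simp add: of_nat_diff)
      have sh: "real (n - k) * h - real (n - Suc k) * h = h" "real (n - k) * h = s + h"
        by (simp_all add: nk s_def algebra_simps)
      have "s + h \<le> real n * h" unfolding sh(2)[symmetric] using h by (intro mult_right_mono) auto
      then have s: "s \<in> {0..<T}" "s + h \<le> T" using h nhT by (auto simp: s_def)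
      have IH: "\<bar>u_grid T G g \<sigma>0 p n k y - u (s + h) y\<bar> \<le> real k * (C * h\<^sup>2) * exp (L * h) ^ k" for y
        using Suc.prems by (intro Suc.IH[unfolded sh(2)]) simp
      have "u_grid T G g \<sigma>0 p n (Suc k) y = scheme_op G \<sigma>0 p s h (u_grid T G g \<sigma>0 p n k) y"
        unfolding u_grid.simps h_def[symmetric] sh(1) s_def ..
      then have "\<bar>u_grid T G g \<sigma>0 p n (Suc k) y - u s y\<bar> \<le>
          (1 + L * h) * (real k * (C * h\<^sup>2) * exp (L * h) ^ k) + C * h\<^sup>2"
        using step[OF s(1) _ s(2) IH] h by simp
      also have "\<dots> \<le> exp (L * h) * (real k * (C * h\<^sup>2) * exp (L * h) ^ k) +
          C * h\<^sup>2 * exp (L * h) ^ Suc k"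
      proof (intro add_mono mult_right_mono)
        show "1 + L * h \<le> exp (L * h)" by (rule exp_ge_add_one_self)
        have "1 \<le> exp (L * h) ^ Suc k" using L0 h by (intro one_le_power) simp
        then show "C * h\<^sup>2 \<le> C * h\<^sup>2 * exp (L * h) ^ Suc k" 
          using C0 mult_left_mono[of 1 "exp (L * h) ^ Suc k" "C * h\<^sup>2"] by simp
      qed (use C0 in auto)
      also have "\<dots> = real (Suc k) * (C * h\<^sup>2) * exp (L * h) ^ Suc k" by (simp add: algebra_simps)
      finally show ?case by (simp add: s_def)
    qed
    have grid': "\<bar>u_grid T G g \<sigma>0 p n k y - u (real (n - k) * h) y\<bar> \<le> C * T * exp (L * T) * h"
        if "k \<le> n" for k y
    proof -
      have kT: "real k * h \<le> T" using that h nhT by (metis mult_right_mono of_nat_le_iff less_imp_le)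
      have "exp (L * h) ^ k = exp (L * (real k * h))" by (simp add: exp_of_nat_mult[symmetric] mult_ac)
      also have "\<dots> \<le> exp (L * T)" using kT L0 by (simp add: mult_left_mono)
      finally have "(real k * h) * (C * h) * exp (L * h) ^ k \<le> T * (C * h) * exp (L * T)"
        using kT C0 h T by (intro mult_mono) auto
      then show ?thesis using grid[OF that, of y] by (simp add: power2_eq_square mult_ac)
    qed
    show ?thesis
    proof (cases "t = T")
      case True
      then show ?thesis using C0 L0 T n by (simp add: u_h_terminal terminal)
    next
      case False
      then have tT: "0 \<le> t" "t < T" using t by auto
      \<comment> \<open>The floor of t / h is i - 1, so a grid time lies at the left end of its
        interval and receives a full step.\<close>
      define i where "i = Suc (nat \<lfloor>t / h\<rfloor>)"
      have fl: "real (i - 1) = of_int \<lfloor>t / h\<rfloor>" using tT h by (simp add: i_def)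
      have "real (i - 1) \<le> t / h" "t / h < real (i - 1) + 1" unfolding fl by linarith+
      then have lo: "real (i - 1) * h \<le> t" and hi: "t < real i * h" using h
          by (auto simp: field_simps i_def)
      have "real (i - 1) * h < real n * h" using lo tT nhT by linarith
      then have "i - 1 < n" using h by simp
      then have i: "i \<in> {1..n}" by (auto simp: i_def)
      have iT: "real i * h \<le> T" using i h nhT
          by (metis atLeastAtMost_iff mult_right_mono of_nat_le_iff less_imp_le)
      define \<delta> where "\<delta> = real i * h - t"
      have \<delta>: "0 < \<delta>" "\<delta> \<le> h" "t + \<delta> = real i * h" using lo hi by (auto simp: \<delta>_def i_def algebra_simps)
      have "u_h T G g \<sigma>0 p n t = scheme_op G \<sigma>0 p t \<delta> (u_grid T G g \<sigma>0 p n (n - i))"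
        unfolding \<delta>_def h_def using u_h_step_grid[OF T n i] lo hi by (simp add: h_def)
      moreover have "\<bar>u_grid T G g \<sigma>0 p n (n - i) y - u (t + \<delta>) y\<bar> \<le> C * T * exp (L * T) * h" for y
        using grid'[of "n - i" y] i by (simp add: \<delta>(3))
      then have "\<bar>scheme_op G \<sigma>0 p t \<delta> (u_grid T G g \<sigma>0 p n (n - i)) x - u t x\<bar> \<le>
        (1 + L * \<delta>) * (C * T * exp (L * T) * h) + C * \<delta>\<^sup>2"
        using tT \<delta> h iT by (intro step) auto
      moreover have "\<dots> \<le> (1 + L * T) * (C * T * exp (L * T) * h) + C * (T * h)"
        using \<delta> hT L0 C0 T h unfolding power2_eq_square
        by (intro add_mono mult_right_mono mult_left_mono mult_mono) auto
      ultimately show ?thesis by (simp add: h_def[symmetric] algebra_simps)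
    qed
  qed
  then show ?thesis by blast
qed

text \<open>\<open>hbar\<close> is chosen before \<open>G\<close>, \<open>g\<close>, \<sigma>0 and
  \<open>p\<close>, which expresses that it depends on the constants only. The rate is then tied to
  no particular threshold: any \<open>h0\<close> that makes the scheme monotone qualifies. The
  constant \<open>C\<close> is chosen before n.\<close>

theorem theorem3p13:
  fixes T B L K lam :: real
  assumes "0 < T"
  shows "\<exists>hbar>0. \<forall>(G :: ('n::finite) nonlinearity) g \<sigma>0 p.
    standing_assumptions T B L G g \<and> assumption_M T K G \<sigma>0 p \<and>
    lambda_star T G \<sigma>0 = ereal lam \<longrightarrow>
      monotone_scheme T G \<sigma>0 p hbar \<and>
      (\<forall>h0 u. 0 < h0 \<and> monotone_scheme T G \<sigma>0 p h0 \<and>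
         bounded_on_strip T u \<and> viscosity_solution T G g u \<and>
         C4b T u \<and> locally_lipschitz_in_x T G \<longrightarrow>
         (\<exists>C. \<forall>n\<ge>1. T / real n < h0 \<longrightarrow>
            (\<forall>t\<in>{0..T}. \<forall>x. \<bar>u_h T G g \<sigma>0 p n t x - u t x\<bar> \<le> C * (T / real n))))"
proof (cases "0 < lam")
  case True
  then obtain hbar where "0 < hbar" and hbar: "\<And>(G :: 'n nonlinearity) g \<sigma>0 p.
      standing_assumptions T B L G g \<Longrightarrow> assumption_M T K G \<sigma>0 p \<Longrightarrow> lambda_star T G \<sigma>0 = ereal lam \<Longrightarrow>
      monotone_scheme T G \<sigma>0 p hbar"
    using monotone_scheme_bound[of lam T B L K] by metis
  then show ?thesis
    using convergence_rate[OF assms] by blast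
next
  case False
  \<comment> \<open>\<open>assumption_M1\<close> contains 0 < \<open>lambda_star\<close>, so for lam
    \<le> 0 the premises are contradictory and any positive \<open>hbar\<close> will do.\<close>
  then have "\<not> (assumption_M T K G \<sigma>0 p \<and> lambda_star T G \<sigma>0 = ereal lam)"
      for G :: "'n nonlinearity" and \<sigma>0 p
    by (auto simp: assumption_M_def assumption_M1_def)
  then show ?thesis by (intro exI[of _ 1]) auto
qed

end
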